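(* Let $G$ be a finite group and $q$ a prime power. (i) There are infinitely many integers $v$ such that there is a $2$-$(v,q+1,1)$-design $\mathbf{D}$ for which $\mathrm{Aut}\,\mathbf{D}\cong G$. (ii) If $q>2$ then there are infinitely many integers $v$ such that there is a $2$-$(v,q,1)$-design $\mathbf{D}$ for which $\mathrm{Aut}\,\mathbf{D}\cong G$.
   Context: A $2$-$(v,k,1)$-design consists of a set of $v$ points together with a family of $k$-element subsets of the point set, called blocks, such that any two distinct points lie in exactly one block. $\mathrm{Aut}\,\mathbf{D}$ is the full automorphism group of $\mathbf{D}$, i.e. the group of all permutations of the points that map blocks to blocks. *)

theory Defs
  imports "HOL-Algebra.Bij" "HOL-Number_Theory.Prime_Powers"
begin

text \<open>
  A 2-(v,k,1)-design with point set P and block set Bs. For k at least 2 the family of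
  blocks cannot contain a repeated block, so a set of blocks loses no generality.
\<close>

definition design_2_1 :: "nat \<Rightarrow> nat \<Rightarrow> 'p set \<Rightarrow> 'p set set \<Rightarrow> bool" where
  "design_2_1 v k P Bs \<longleftrightarrow>
     finite P \<and> card P = v \<and>
     (\<forall>b\<in>Bs. b \<subseteq> P \<and> card b = k) \<and>
     (\<forall>x\<in>P. \<forall>y\<in>P. x \<noteq> y \<longrightarrow> (\<exists>!b. b \<in> Bs \<and> x \<in> b \<and> y \<in> b))"

text \<open>
  As in \<^const>\<open>BijGroup\<close>, permutations of P are extensional functions, so that different
  values outside P do not produce different automorphisms. 
\<close>

definition design_automorphisms :: "'p set \<Rightarrow> 'p set set \<Rightarrow> ('p \<Rightarrow> 'p) set" where
  "design_automorphisms P Bs = {f \<in> Bij P. \<forall>b\<in>Bs. f ` b \<in> Bs}"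

definition design_Aut :: "'p set \<Rightarrow> 'p set set \<Rightarrow> ('p \<Rightarrow> 'p) monoid" where
  "design_Aut P Bs = BijGroup P \<lparr>carrier := design_automorphisms P Bs\<rparr>"

lemma subgroup_design_automorphisms:
  assumes "design_2_1 v k P Bs"
  shows "subgroup (design_automorphisms P Bs) (BijGroup P)"
proof (rule subgroup.intro)
  have sub: "b \<subseteq> P" if "b \<in> Bs" for b
    using assms that by (auto simp: design_2_1_def)
  have finBs: "finite Bs"
    using assms sub by (meson Pow_iff design_2_1_def finite_Pow_iff finite_subset subsetI)
  show "design_automorphisms P Bs \<subseteq> carrier (BijGroup P)"
    by (auto simp: design_automorphisms_def BijGroup_def)
  show "f \<otimes>\<^bsub>BijGroup P\<^esub> g \<in> design_automorphisms P Bs"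
    if "f \<in> design_automorphisms P Bs" "g \<in> design_automorphisms P Bs" for f g
  proof -
    have "compose P f g ` b = f ` (g ` b)" if "b \<in> Bs" for b
      using sub[OF that] by (auto simp: compose_def image_iff subset_iff)
    then show ?thesis
      using that by (simp add: design_automorphisms_def BijGroup_def compose_Bij)
  qed
  have "(\<lambda>x\<in>P. x) ` b = b" if "b \<in> Bs" for b
    using sub[OF that] by auto
  then show "\<one>\<^bsub>BijGroup P\<^esub> \<in> design_automorphisms P Bs"
    by (simp add: design_automorphisms_def BijGroup_def id_Bij)
  show "inv\<^bsub>BijGroup P\<^esub> f \<in> design_automorphisms P Bs"
    if f: "f \<in> design_automorphisms P Bs" for f
  proof -
    have fB: "f \<in> Bij P" and bij: "bij_betw f P P" and im: "image f ` Bs \<subseteq> Bs"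
      using f by (auto simp: design_automorphisms_def Bij_def)
    have "inj_on (image f) Bs"
      using bij sub by (intro inj_onI) (metis bij_betw_def inj_on_image_eq_iff)
    then have surj: "image f ` Bs = Bs"
      using finBs im by (simp add: endo_inj_surj)
    have "(\<lambda>x\<in>P. inv_into P f x) ` b \<in> Bs" if "b \<in> Bs" for b
    proof -
      obtain c where c: "c \<in> Bs" "b = f ` c"
        using surj \<open>b \<in> Bs\<close> by blast
      have "(\<lambda>x\<in>P. inv_into P f x) ` b = inv_into P f ` f ` c"
        using sub[OF that] c(2) by (auto simp: image_iff subset_iff)
      also have "\<dots> = c"
        using bij sub[OF c(1)] by (simp add: bij_betw_def inv_into_image_cancel)
      finally show ?thesis using c(1) by simp
    qed
    then show ?thesis
      by (simp add: design_automorphisms_def inv_BijGroup[OF fB] restrict_inv_into_Bij[OF fB])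
  qed
qed

end

theory Submission
  imports Defs "HOL-Library.Function_Algebras" "HOL-Algebra.Algebraic_Closure" "HOL-Number_Theory.Residues"
begin

text \<open>
  Start from the points and lines of a projective space over GF(q), or of an affine space if
  blocks of size q are wanted. Whenever two points of a subspace H are on a line, that line is
  inside H, so the lines inside H may be replaced by their images under any permutation of H without
  destroying the design property. Do this for a family of small subspaces, each spanned by
  some of the base points of a frame, any two meeting in at most one point.

  The new design determines the old geometry: an automorphism of the new design maps every
  line that is not contained in a small exceptional set to a line of the geometry, and every
  other line is the only doubtful line of some plane, which forces its image to be a line as well.
  The automorphism therefore also permutes the chosen subspaces, and it commutes with the
  permutations because their commutators are collineations of a subspace that move too few points.
  With a suitable cycle as permutation, an automorphism fixing a subspace as a set fixes it pointwise.

  What remains is combinatorial: the frame is indexed by copies of G, and the chosen subspaces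
  encode the right multiplications of G, so that only the left translations survive.
\<close>

section \<open>Linear spaces and planar spaces\<close>

text \<open>Recognition is done by counting. A chosen subspace on \<open>c\<close> base points has
  at least \<open>q ^ (c - 1)\<close> points, while its permutation moves at most
  \<open>k * c\<close> of them, so for large blocks the undisturbed part wins every comparison. The
  union of the chosen subspaces must in turn be small against the whole space; hence, with
  \<open>n\<close> the order of the group, blocks have at most \<open>d + n + 2\<close> indices and
  the frame at least \<open>d + d + n\<close>. Letting \<open>d\<close> grow makes \<open>v\<close>
  unbounded.

  Affine space is projective space without the points of the hyperplane where the coordinate sum
  vanishes. All base points survive, and coordinate permutations preserve the hyperplane, so both
  parts of the theorem share one argument. Small affine fields are the obstacle: to carry fixed
  points from two subspaces over to their span, two transversals through a point are needed, and two
  of the \<open>q\<close> candidates may be lost at infinity. Hence \<open>4 \<le> q\<close> in the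
  affine case, and block size 3 is obtained from projective spaces over the field with two
  elements.\<close>

definition flat :: "'p set set \<Rightarrow> 'p set \<Rightarrow> bool" where
  "flat L A \<longleftrightarrow> (\<forall>l\<in>L. \<forall>x\<in>l \<inter> A. \<forall>y\<in>l \<inter> A. x \<noteq> y \<longrightarrow> l \<subseteq> A)"

definition automorphism :: "'p set \<Rightarrow> 'p set set \<Rightarrow> ('p \<Rightarrow> 'p) \<Rightarrow> bool" where
  "automorphism P L f \<longleftrightarrow> bij_betw f P P \<and> (\<forall>l\<in>L. f ` l \<in> L)"

abbreviation moved :: "('p \<Rightarrow> 'p) \<Rightarrow> 'p set \<Rightarrow> 'p set" where
  "moved f A \<equiv> {x \<in> A. f x \<noteq> x}"

lemma flatD: "\<lbrakk>flat L A; l \<in> L; x \<in> l; x \<in> A; y \<in> l; y \<in> A; x \<noteq> y\<rbrakk> \<Longrightarrow> l \<subseteq> A"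
  unfolding flat_def by blast

lemma flatI: "(\<And>l x y. l \<in> L \<Longrightarrow> x \<in> l \<Longrightarrow> x \<in> A \<Longrightarrow> y \<in> l \<Longrightarrow> y \<in> A \<Longrightarrow> x \<noteq> y \<Longrightarrow> l \<subseteq> A) \<Longrightarrow> flat L A"
  unfolding flat_def by blast

lemma automorphism_compose:
  assumes "automorphism P L f" "automorphism P L g"
  shows "automorphism P L (f \<circ> g)"
  using assms unfolding automorphism_def
  by (metis bij_betw_trans image_comp)

lemma automorphism_cong:
  assumes "automorphism P L f" "\<And>l. l \<in> L \<Longrightarrow> l \<subseteq> P" "\<And>x. x \<in> P \<Longrightarrow> g x = f x"
  shows "automorphism P L g"
proof -
  have "g ` l = f ` l" if "l \<in> L" for l
    using assms(2)[OF that] assms(3) by (intro image_cong) auto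
  then show ?thesis
    using assms(1,3) unfolding automorphism_def by (simp cong: bij_betw_cong)
qed

locale linear_space =
  fixes P :: "'p set" and L :: "'p set set" and k :: nat
  assumes finite_points: "finite P"
    and line_sub: "l \<in> L \<Longrightarrow> l \<subseteq> P"
    and line_card: "l \<in> L \<Longrightarrow> card l = k"
    and line_ex: "\<lbrakk>x \<in> P; y \<in> P; x \<noteq> y\<rbrakk> \<Longrightarrow> \<exists>l\<in>L. x \<in> l \<and> y \<in> l"
    and line_unique: "\<lbrakk>l \<in> L; l' \<in> L; x \<in> l; y \<in> l; x \<in> l'; y \<in> l'; x \<noteq> y\<rbrakk> \<Longrightarrow> l = l'"
    and three_le: "3 \<le> k"
begin

definition contains_triple :: "'p set \<Rightarrow> bool" where
  "contains_triple S \<longleftrightarrow> (\<exists>l\<in>L. \<exists>a b c. {a, b, c} \<subseteq> l \<inter> S \<and> a \<noteq> b \<and> a \<noteq> c \<and> b \<noteq> c)"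

lemma design: "design_2_1 (card P) k P L"
proof -
  have "\<exists>!b. b \<in> L \<and> x \<in> b \<and> y \<in> b" if "x \<in> P" "y \<in> P" "x \<noteq> y" for x y
    using line_ex[OF that] line_unique[OF _ _ _ _ _ _ \<open>x \<noteq> y\<close>] by blast
  then show ?thesis
    by (simp add: design_2_1_def finite_points line_sub line_card)
qed

lemma finite_line: "l \<in> L \<Longrightarrow> finite l"
  using finite_points line_sub by (meson finite_subset)

lemma finite_lines: "finite L"
  using finite_points line_sub by (meson Pow_iff finite_Pow_iff finite_subset subsetI)

lemma line_third:
  assumes "l \<in> L" obtains z where "z \<in> l" "z \<noteq> x" "z \<noteq> y"
proof -
  have "card {x, y} < card l"
    using line_card[OF assms] three_le card_insert_le_m1[of 2 "{y}" x] by simp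
  then have "\<not> l \<subseteq> {x, y}"
    by (meson card_mono finite.emptyI finite.insertI leD)
  then show thesis using that by blast
qed

lemma line_eqI: "\<lbrakk>l \<in> L; l' \<in> L; l \<subseteq> l'\<rbrakk> \<Longrightarrow> l = l'"
  by (simp add: card_subset_eq finite_line line_card)

lemma automorphism_image_eq:
  assumes "automorphism P L f"
  shows "image f ` L = L"
proof -
  have "inj_on (image f) L"
    using assms line_sub unfolding automorphism_def bij_betw_def
    by (intro inj_onI) (metis inj_on_image_eq_iff)
  then show ?thesis
    using assms finite_lines unfolding automorphism_def by (intro endo_inj_surj) auto
qed

lemma automorphism_lineE:
  assumes "automorphism P L f" "l \<in> L" obtains m where "m \<in> L" "l = f ` m"
  using automorphism_image_eq[OF assms(1)] assms(2) by (metis imageE)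

lemma automorphism_image_iff:
  assumes "automorphism P L f" "A \<subseteq> P"
  shows "f ` A \<in> L \<longleftrightarrow> A \<in> L"
proof
  assume "f ` A \<in> L"
  then obtain l where "l \<in> L" "f ` A = f ` l"
    using automorphism_lineE[OF assms(1)] by metis
  then show "A \<in> L"
    using assms line_sub unfolding automorphism_def bij_betw_def
    by (metis inj_on_image_eq_iff)
qed (use assms in \<open>auto simp: automorphism_def\<close>)

lemma automorphism_inv:
  assumes "automorphism P L f"
  shows "automorphism P L (inv_into P f)"
proof -
  have b: "bij_betw f P P" using assms by (simp add: automorphism_def)
  have "inv_into P f ` l \<in> L" if "l \<in> L" for l
  proof -
    obtain m where m: "m \<in> L" "l = f ` m"
      using automorphism_lineE[OF assms \<open>l \<in> L\<close>] .
    then have "inv_into P f ` l = m"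
      using b line_sub by (simp add: bij_betw_def inv_into_image_cancel)
    then show ?thesis using m by simp
  qed
  then show ?thesis using b by (simp add: automorphism_def bij_betw_inv_into)
qed

text \<open>The lines joining z to the points of A are distinct, and each of them has a third point, which
  lies outside C.\<close>

lemma card_le_outside:
  assumes H: "flat L H" "H \<subseteq> P" and z: "z \<in> H" "z \<notin> C" and sub: "A \<subseteq> C" "C \<subseteq> H"
    and one: "\<And>l a b. \<lbrakk>l \<in> L; z \<in> l; a \<in> l; a \<in> A; b \<in> l; b \<in> C\<rbrakk> \<Longrightarrow> a = b"
  shows "card A \<le> card (H - C)"
proof -
  have "\<exists>w. w \<in> H - C \<and> w \<noteq> z \<and> (\<exists>l\<in>L. z \<in> l \<and> a \<in> l \<and> w \<in> l)" if a: "a \<in> A" for a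
  proof -
    have az: "a \<noteq> z" "a \<in> H" using a z sub by auto
    then obtain l where l: "l \<in> L" "z \<in> l" "a \<in> l" using line_ex[of z a] z H(2) by blast
    obtain w where w: "w \<in> l" "w \<noteq> z" "w \<noteq> a" using line_third[OF l(1)] .
    have "l \<subseteq> H" using flatD[OF H(1) l(1,2) z(1) l(3)] az by blast
    moreover have "w \<notin> C" using one[OF l a w(1)] w(3) by blast
    ultimately show ?thesis using w l by blast
  qed
  then obtain h where h: "\<And>a. a \<in> A \<Longrightarrow> h a \<in> H - C \<and> h a \<noteq> z \<and> (\<exists>l\<in>L. z \<in> l \<and> a \<in> l \<and> h a \<in> l)"
    by metis
  have "inj_on h A"
  proof (rule inj_onI)
    fix a b assume ab: "a \<in> A" "b \<in> A" "h a = h b"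
    obtain l where l: "l \<in> L" "z \<in> l" "a \<in> l" "h a \<in> l" using h ab(1) by blast
    obtain m where m: "m \<in> L" "z \<in> m" "b \<in> m" "h b \<in> m" using h ab(2) by blast
    have "l = m" using line_unique[OF l(1) m(1) l(2) l(4) m(2)] m(4) ab(3) h[OF ab(1)] by force
    then show "a = b" using one[OF l(1-3) ab(1), of b] m(3) ab(2) sub by blast
  qed
  moreover have "h ` A \<subseteq> H - C" using h by blast
  ultimately show ?thesis
    using finite_points H(2) by (meson card_inj_on_le finite_Diff finite_subset)
qed

text \<open>A line through a point outside the subspace \<open>A\<close> meets \<open>A\<close> at
  most once. Projection from such a point of \<open>H\<close> shows that a proper subspace holds at
  most half of the points.\<close>

lemma flat_eqI:
  assumes "flat L A" "flat L H" "A \<subseteq> H" "H \<subseteq> P" "card (H - A) < card A"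
  shows "A = H"
proof (rule ccontr)
  assume "A \<noteq> H"
  then obtain z where z: "z \<in> H" "z \<notin> A" using assms(3) by blast
  have "card A \<le> card (H - A)"
  proof (rule card_le_outside[OF assms(2,4) z order_refl assms(3)])
    show "a = b" if "l \<in> L" "z \<in> l" "a \<in> l" "a \<in> A" "b \<in> l" "b \<in> A" for l a b
      using flatD[OF assms(1) that(1,3,4,5,6)] that(2) z(2) by blast
  qed
  then show False using assms(5) by simp
qed

text \<open>A line with two fixed points is invariant; if it passes through a moved point
  \<open>z\<close>, it also contains \<open>f z\<close>. So at most one line through
  \<open>z\<close> has two fixed points. The lines joining \<open>z\<close> to the fixed points off
  that line are distinct, and each carries a further moved point, whence \<open>card H\<close> is at
  most \<open>k\<close> plus twice the number of moved points.\<close>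

lemma few_moved_imp_id:
  assumes "flat L H" "H \<subseteq> P" "bij_betw f H H" "\<And>l. l \<in> L \<Longrightarrow> l \<subseteq> H \<Longrightarrow> f ` l \<in> L"
    and "k + 2 * card (moved f H) < card H" and "z \<in> H"
  shows "f z = z"
proof (rule ccontr)
  assume nz: "f z \<noteq> z"
  define F where "F = {x\<in>H. f x = x}"
  define Y where "Y = {x\<in>H. f x \<noteq> x}"
  have fin: "finite H" using finite_points assms(2) by (meson finite_subset)
  have HFY: "H = F \<union> Y" "F \<inter> Y = {}" by (auto simp: F_def Y_def)
  then have cH: "card H = card F + card Y" using fin by (metis card_Un_disjoint finite_Un)
  have fixline: "f ` l = l" if "l \<in> L" "a \<in> l" "b \<in> l" "a \<noteq> b" "a \<in> F" "b \<in> F" for l a b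
  proof -
    have "l \<subseteq> H" using flatD[OF assms(1)] that by (auto simp: F_def)
    then have "f ` l \<in> L" using assms(4) that by blast
    moreover have "a \<in> f ` l" "b \<in> f ` l"
      using that by (auto simp: F_def intro: rev_image_eqI)
    ultimately show ?thesis
      using line_unique[of "f ` l" l a b] that by blast
  qed
  have uniq: "l = m" if "l \<in> L" "a \<in> l" "b \<in> l" "a \<noteq> b" "a \<in> F" "b \<in> F" "z \<in> l"
     "m \<in> L" "c \<in> m" "d \<in> m" "c \<noteq> d" "c \<in> F" "d \<in> F" "z \<in> m" for l a b m c d
  proof -
    have "f z \<in> l" using fixline[of l a b] that by blast
    moreover have "f z \<in> m" using fixline[of m c d] that by blast
    ultimately show ?thesis using line_unique[of l m z "f z"] that nz by metis
  qed
  \<comment> \<open>\<open>m0\<close> is the exceptional line through \<open>z\<close>, or empty if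
    there is none.\<close>
  obtain m0 where m0: "card m0 \<le> k" "finite m0" "\<And>l a b. \<lbrakk>l \<in> L; a \<in> l; b \<in> l; a \<noteq> b; a \<in> F; b \<in> F;
      z \<in> l\<rbrakk> \<Longrightarrow> l \<subseteq> m0"
  proof (cases "\<exists>l a b. l \<in> L \<and> a \<in> l \<and> b \<in> l \<and> a \<noteq> b \<and> a \<in> F \<and> b \<in> F \<and> z \<in> l")
    case True
    then obtain l a b where l: "l \<in> L" "a \<in> l" "b \<in> l" "a \<noteq> b" "a \<in> F" "b \<in> F" "z \<in> l" by blast
    show thesis
    proof (rule that[of l])
      show "card l \<le> k" "finite l" using l line_card finite_line by auto
      show "m \<subseteq> l" if "m \<in> L" "c \<in> m" "d \<in> m" "c \<noteq> d" "c \<in> F" "d \<in> F" "z \<in> m" for m c d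
        using uniq[OF l that] by simp
    qed
  next
    case False
    show thesis by (rule that[of "{}"]) (use False in auto)
  qed
  have "card (F - m0) \<le> card (H - F)"
  proof (rule card_le_outside[OF assms(1,2,6)])
    show "z \<notin> F" using nz by (simp add: F_def)
    show "a = b" if "l \<in> L" "z \<in> l" "a \<in> l" "a \<in> F - m0" "b \<in> l" "b \<in> F" for l a b
      using m0(3)[of l a b] that by blast
  qed (use HFY in auto)
  moreover have "H - F = Y" using HFY by blast
  ultimately have "card (F - m0) \<le> card Y" by simp
  moreover have "card F \<le> card (F - m0) + card m0"
  proof -
    have "card F \<le> card ((F - m0) \<union> m0)"
      using m0(2) fin HFY(1) by (intro card_mono) auto
    then show ?thesis using card_Un_le[of "F - m0" m0] by linarith
  qed
  ultimately show False using assms(5) cH m0(1) unfolding Y_def by linarith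
qed

end

text \<open>The part of the axioms of projective and affine geometry that the reconstruction uses.
  \<open>plane_transversal\<close> says that two intersecting lines generate their plane in one
  step; in an affine plane this requires that not every line through \<open>p\<close> is parallel to
  one of them or passes through \<open>z\<close>.\<close>

locale planar_space = linear_space P L k
  for P :: "'p set" and L :: "'p set set" and k :: nat +
  fixes Pl :: "'p set set" and kap :: nat
  assumes plane_sub: "E \<in> Pl \<Longrightarrow> E \<subseteq> P"
    and plane_card: "E \<in> Pl \<Longrightarrow> card E = kap"
    and plane_flat: "E \<in> Pl \<Longrightarrow> flat L E"
    and plane_ex: "\<lbrakk>l \<in> L; p \<in> P; p \<notin> l\<rbrakk> \<Longrightarrow> \<exists>E\<in>Pl. l \<subseteq> E \<and> p \<in> E"
    and plane_unique: "\<lbrakk>E \<in> Pl; E' \<in> Pl; l \<in> L; l \<subseteq> E; l \<subseteq> E'; p \<in> E; p \<in> E';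
      p \<notin> l\<rbrakk> \<Longrightarrow> E = E'"
    and plane_transversal: "\<lbrakk>E \<in> Pl; l \<in> L; l' \<in> L; l \<subseteq> E; l' \<subseteq> E; l \<noteq> l'; z \<in> l; z \<in> l';
      p \<in> E; p \<notin> l;
      p \<notin> l'\<rbrakk> \<Longrightarrow> \<exists>m\<in>L. p \<in> m \<and> (\<exists>a b. a \<in> m \<and> a \<in> l \<and> a \<noteq> z \<and> b \<in> m \<and> b \<in> l' \<and> b \<noteq> z)"
begin

text \<open>The images of two good lines span a plane containing the image of E.\<close>

lemma plane_one_bad_line:
  assumes f: "inj_on f P" "f ` P \<subseteq> P" and E: "E \<in> Pl" and l: "l \<in> L" "l \<subseteq> E" and o: "z \<in> E" "z \<notin> l"
    and good: "\<And>m. \<lbrakk>m \<in> L; m \<subseteq> E; m \<noteq> l\<rbrakk> \<Longrightarrow> f ` m \<in> L"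
  shows "f ` l \<in> L"
proof -
  note EP = plane_sub[OF E] and flE = plane_flat[OF E]
  have inj: "f x = f y \<longleftrightarrow> x = y" if "x \<in> E" "y \<in> E" for x y
    using that EP f(1) by (meson inj_onD subsetD)
  have join: "\<exists>m\<in>L. x \<in> m \<and> y \<in> m \<and> m \<subseteq> E" if "x \<in> E" "y \<in> E" "x \<noteq> y" for x y
    using line_ex[of x y] that EP flatD[OF flE] by (meson subsetD)
  have img: "f x \<in> f ` m" if "x \<in> m" for x m using that by simp
  obtain a where a: "a \<in> l" using line_third[OF l(1)] by metis
  obtain b where b: "b \<in> l" "b \<noteq> a" using line_third[OF l(1)] by metis
  have aE: "a \<in> E" and bE: "b \<in> E" using a b l by auto
  obtain l1 where l1: "l1 \<in> L" "z \<in> l1" "a \<in> l1" "l1 \<subseteq> E" using join[OF o(1) aE] o a by blast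
  obtain l2 where l2: "l2 \<in> L" "z \<in> l2" "b \<in> l2" "l2 \<subseteq> E" using join[OF o(1) bE] o b by blast
  have l1l: "l1 \<noteq> l" "l2 \<noteq> l" using l1 l2 o by auto
  have l12: "l1 \<noteq> l2" using line_unique[OF l1(1) l(1), of a b] l1 l2 a b l1l by blast
  have f1: "f ` l1 \<in> L" and f2: "f ` l2 \<in> L" using good l1 l2 l1l by auto
  have "f b \<notin> f ` l1"
  proof
    assume "f b \<in> f ` l1"
    then have "b \<in> l1" using inj bE l1(4) by (metis imageE subsetD)
    then show False using line_unique[OF l1(1) l(1), of a b] l1 a b l1l by blast
  qed
  \<comment> \<open>\<open>E'\<close> is the plane spanned by the line \<open>f\<close>
    l1\<open>and the point\<close>f b\<open>; it also contains\<close>f \<open>l2\<close>, because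
    \<open>l2\<close> joins \<open>z\<close> to \<open>b\<close>.\<close>
  then obtain E' where E': "E' \<in> Pl" "f ` l1 \<subseteq> E'" "f b \<in> E'"
    using plane_ex[OF f1, of "f b"] f(2) bE EP by blast
  note flE' = plane_flat[OF E'(1)]
  have through: "f ` m \<subseteq> E'" if "m \<in> L" "m \<subseteq> E" "m \<noteq> l" "x \<in> m" "y \<in> m" "x \<noteq> y" "f x \<in> E'" "f y \<in> E'" for m x y
    using flatD[OF flE' good[OF that(1-3)], of "f x" "f y"] that inj[of x y] by blast
  have f2E: "f ` l2 \<subseteq> E'"
    using through[of l2 z b] l2 l1l E' l1(2) o b by blast
  \<comment> \<open>A point off \<open>l\<close> lies on a transversal of \<open>l1\<close> and
    \<open>l2\<close>, which is a good line with two image points in \<open>E'\<close>.\<close>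
  have off: "f p \<in> E'" if p: "p \<in> E" "p \<notin> l" for p
  proof (cases "p \<in> l1 \<or> p \<in> l2")
    case True
    then show ?thesis using E' f2E by blast
  next
    case False
    then obtain m c d where m: "m \<in> L" "p \<in> m" "c \<in> m" "c \<in> l1" "c \<noteq> z" "d \<in> m" "d \<in> l2" "d \<noteq> z"
      using plane_transversal[OF E l1(1) l2(1) l1(4) l2(4) l12 l1(2) l2(2) p(1)] by blast
    have cd: "c \<noteq> d" using line_unique[OF l1(1) l2(1), of z c] l1 l2 l12 m by blast
    have mE: "m \<subseteq> E" using flatD[OF flE m(1) m(3) _ m(6) _ cd] m l1 l2 by blast
    have "f c \<in> E'" "f d \<in> E'" using E' f2E m by auto
    then show ?thesis using through[OF m(1) mE _ m(3) m(6) cd] p m by blast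
  qed
  have all: "f p \<in> E'" if p: "p \<in> E" for p
  proof (cases "p \<in> l")
    case True
    then obtain m where m: "m \<in> L" "z \<in> m" "p \<in> m" "m \<subseteq> E" using join[OF o(1) p] o by blast
    obtain y where y: "y \<in> m" "y \<noteq> z" "y \<noteq> p" using line_third[OF m(1)] .
    have ml: "m \<noteq> l" using m o by blast
    have "y \<notin> l" using line_unique[OF m(1) l(1), of y p] True y m ml by blast
    then have "f y \<in> E'" "f z \<in> E'" using off y m o by auto
    then show ?thesis using through[OF m(1,4) ml m(2) y(1)] y m by blast
  qed (use off p in simp)
  have "f ` E = E'"
  proof (rule card_subset_eq)
    show "finite E'" using plane_sub[OF E'(1)] finite_points by (meson finite_subset)
    show "f ` E \<subseteq> E'" using all by blast
    show "card (f ` E) = card E'"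
      using plane_card E E'(1) inj by (metis card_image inj_onI)
  qed
  have fab: "f a \<noteq> f b" "f a \<in> E'" "f b \<in> E'" using inj[OF aE bE] b all aE bE by auto
  then obtain m' where m': "m' \<in> L" "f a \<in> m'" "f b \<in> m'" "m' \<subseteq> E'"
    using line_ex[of "f a" "f b"] plane_sub[OF E'(1)] flatD[OF flE'] by (meson subsetD)
  \<comment> \<open>A point of \<open>m'\<close> is some \<open>f c\<close>. Were \<open>c\<close>
    off \<open>l\<close>, the line \<open>n\<close> joining \<open>a\<close> and \<open>c\<close>
    would be good with image \<open>m'\<close>, so it would contain \<open>b\<close> and equal
    \<open>l\<close>.\<close>
  have "m' \<subseteq> f ` l"
  proof
    fix y assume y: "y \<in> m'"
    then obtain c where c: "c \<in> E" "y = f c" using m'(4) \<open>f ` E = E'\<close> by blast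
    show "y \<in> f ` l"
    proof (rule ccontr)
      assume "y \<notin> f ` l"
      then have cl: "c \<notin> l" using c by blast
      then obtain n where n: "n \<in> L" "a \<in> n" "c \<in> n" "n \<subseteq> E" using join[OF aE c(1)] a by blast
      have "f ` n = m'"
        using line_unique[of "f ` n" m' "f a" "f c"] good[of n] n cl m' y c a inj aE by blast
      then have "b \<in> n" using m' inj bE n(4) by (metis imageE subsetD)
      then show False using line_unique[OF n(1) l(1), of a b] n a b cl by blast
    qed
  qed
  moreover have "card (f ` l) = card m'"
    using l m' line_card f(1) EP by (metis card_image inj_on_subset)
  ultimately have "m' = f ` l"
    by (intro card_subset_eq) (use finite_line[OF l(1)] in auto)
  then show ?thesis using m' by simp
qed

text \<open>Planes through \<open>l\<close> meet only in \<open>l\<close>, so each point of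
  \<open>T\<close> off \<open>l\<close> spoils exactly one of them. The spoiled planes and
  \<open>l\<close> are too small to cover \<open>P\<close>, and any point \<open>z\<close> left over
  spans with \<open>l\<close> the required plane.\<close>

lemma plane_avoiding:
  assumes "l \<in> L" "T \<subseteq> P" "k + card T * kap < card P"
  obtains E z where "E \<in> Pl" "l \<subseteq> E" "z \<in> E" "z \<notin> l" "E \<inter> T \<subseteq> l"
proof -
  have finT: "finite T" using assms(2) finite_points by (meson finite_subset)
  obtain e where e: "\<And>p. p \<in> P \<Longrightarrow> p \<notin> l \<Longrightarrow> e p \<in> Pl \<and> l \<subseteq> e p \<and> p \<in> e p"
    using plane_ex[OF assms(1)] by metis
  have "card (\<Union>t\<in>T - l. e t) \<le> (\<Sum>t\<in>T - l. card (e t))"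
    using finT by (intro card_UN_le) auto
  also have "\<dots> \<le> (\<Sum>t\<in>T - l. kap)"
    using e assms(2) plane_card by (intro sum_mono) (metis Diff_iff eq_refl subsetD)
  also have "\<dots> \<le> card T * kap"
    using finT by (simp add: card_mono mult_le_mono1)
  finally have "card (l \<union> (\<Union>t\<in>T - l. e t)) < card P"
    using assms(3) line_card[OF assms(1)] card_Un_le[of l "\<Union>t\<in>T - l. e t"] by linarith
  moreover have "finite (l \<union> (\<Union>t\<in>T - l. e t))"
    using finT finite_line[OF assms(1)] e assms(2) finite_subset[OF plane_sub finite_points]
    by (intro finite_UnI finite_UN_I) blast+
  ultimately have "\<not> P \<subseteq> l \<union> (\<Union>t\<in>T - l. e t)"
    by (meson card_mono leD)
  then obtain z where z: "z \<in> P" "z \<notin> l" "\<And>t. t \<in> T - l \<Longrightarrow> z \<notin> e t" by blast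
  show thesis
  proof (rule that[of "e z" z])
    show "e z \<inter> T \<subseteq> l"
    proof (rule subsetI, rule ccontr)
      fix t assume t: "t \<in> e z \<inter> T" "t \<notin> l"
      then have "e t = e z"
        using plane_unique[of "e t" "e z" l t] e[of z] e[of t] z assms by blast
      then show False using z(3)[of t] e[of z] z t by auto
    qed
  qed (use e z in auto)
qed

text \<open>The set T of points at which f might misbehave is small, so that every line lies in a plane
  all of whose other lines have a point outside T.\<close>

theorem automorphism_of_perturbation:
  assumes D: "linear_space P D k" and agree: "\<And>l. \<not> l \<subseteq> S \<Longrightarrow> l \<in> D \<longleftrightarrow> l \<in> L"
    and S: "S \<subseteq> P" "k + 2 * card S * kap < card P"
    and f: "automorphism P D f"
  shows "automorphism P L f"
proof -
  interpret D: linear_space P D k by fact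
  have bij: "bij_betw f P P" using f by (simp add: automorphism_def)
  \<comment> \<open>A line is safe if neither it nor its image lies inside \<open>S\<close>: then it
    passes from \<open>L\<close> to \<open>D\<close>, is mapped by \<open>f\<close>, and returns to
    \<open>L\<close>. The preimage of \<open>S\<close> accounts for the factor 2 in the bound on
    \<open>card S\<close>.\<close>
  define T where "T = S \<union> {x\<in>P. f x \<in> S}"
  have finS: "finite S" using S finite_points by (meson finite_subset)
  have "card {x\<in>P. f x \<in> S} \<le> card S"
    using bij finS by (intro card_inj_on_le[of f]) (auto simp: bij_betw_def intro: inj_on_subset)
  then have "card T \<le> 2 * card S"
    unfolding T_def using card_Un_le[of S "{x\<in>P. f x \<in> S}"] by linarith
  then have cT: "k + card T * kap < card P"
    using S(2) by (meson add_le_cancel_left le_less_trans mult_le_mono1)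
  have TP: "T \<subseteq> P" using S by (auto simp: T_def)
  have good: "f ` l \<in> L" if l: "l \<in> L" "\<not> l \<subseteq> S" "\<not> l \<subseteq> {x\<in>P. f x \<in> S}" for l
  proof -
    have "f ` l \<in> D" using f agree l by (auto simp: automorphism_def)
    moreover have "\<not> f ` l \<subseteq> S" using l line_sub by blast
    ultimately show ?thesis using agree by blast
  qed
  have "f ` l \<in> L" if l: "l \<in> L" for l
  proof -
    obtain E z where E: "E \<in> Pl" "l \<subseteq> E" "z \<in> E" "z \<notin> l" "E \<inter> T \<subseteq> l"
      using plane_avoiding[OF l TP cT] .
    show ?thesis
    proof (rule plane_one_bad_line[OF _ _ E(1) l E(2-4)])
      show "inj_on f P" "f ` P \<subseteq> P" using bij by (auto simp: bij_betw_def)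
      fix m assume m: "m \<in> L" "m \<subseteq> E" "m \<noteq> l"
      have "\<not> m \<subseteq> T"
      proof
        assume "m \<subseteq> T"
        then have "m \<subseteq> l" using E m by blast
        then show False using line_eqI m l by blast
      qed
      then show "f ` m \<in> L" using good[OF m(1)] by (auto simp: T_def)
    qed
  qed
  then show ?thesis using bij by (simp add: automorphism_def)
qed

end

section \<open>Permuting the lines inside a family of subspaces\<close>

locale perturbed_space = planar_space P L k Pl kap
  for P :: "'p set" and L k Pl kap +
  fixes J :: "'j set" and H :: "'j \<Rightarrow> 'p set" and \<pi> :: "'j \<Rightarrow> 'p \<Rightarrow> 'p"
  assumes H_sub: "j \<in> J \<Longrightarrow> H j \<subseteq> P"
    and H_flat: "j \<in> J \<Longrightarrow> flat L (H j)"
    and H_meet: "\<lbrakk>i \<in> J; j \<in> J; i \<noteq> j; x \<in> H i; x \<in> H j; y \<in> H i; y \<in> H j\<rbrakk> \<Longrightarrow> x = y"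
    and \<pi>_bij: "j \<in> J \<Longrightarrow> bij_betw (\<pi> j) (H j) (H j)"
begin

definition D :: "'p set set" where
  "D = {l \<in> L. \<forall>j\<in>J. \<not> l \<subseteq> H j} \<union> {\<pi> j ` l | j l. j \<in> J \<and> l \<in> L \<and> l \<subseteq> H j}"

abbreviation S :: "'j \<Rightarrow> 'p set" where
  "S j \<equiv> moved (\<pi> j) (H j)"

lemma \<pi>_image: "j \<in> J \<Longrightarrow> l \<subseteq> H j \<Longrightarrow> \<pi> j ` l \<subseteq> H j"
  using \<pi>_bij by (auto simp: bij_betw_def)

lemma \<pi>_inj: "j \<in> J \<Longrightarrow> inj_on (\<pi> j) (H j)"
  using \<pi>_bij by (auto simp: bij_betw_def)

lemma D_cases:
  assumes "d \<in> D"
  obtains "d \<in> L" "\<And>j. j \<in> J \<Longrightarrow> \<not> d \<subseteq> H j"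
  | j l where "j \<in> J" "l \<in> L" "l \<subseteq> H j" "d = \<pi> j ` l"
  using assms unfolding D_def by blast

lemma D_sub_card: "d \<in> D \<Longrightarrow> d \<subseteq> P \<and> card d = k"
proof (elim D_cases)
  fix j l assume *: "j \<in> J" "l \<in> L" "l \<subseteq> H j" "d = \<pi> j ` l"
  then show ?thesis
    using \<pi>_image H_sub \<pi>_inj line_card by (metis card_image inj_on_subset subset_trans)
qed (use line_sub line_card in auto)

text \<open>Since two of the subspaces share at most one point, a line lies in at most one of them;
  this keeps the replacements independent of each other.\<close>

lemma two_points_index:
  assumes "i \<in> J" "j \<in> J" "A \<subseteq> H i" "A \<subseteq> H j" "card A = k"
  shows "i = j"
proof (rule ccontr)
  assume "i \<noteq> j"
  have "\<exists>x y. x \<in> A \<and> y \<in> A \<and> x \<noteq> y"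
    using assms(5) three_le card_le_Suc0_iff_eq[of A] card.infinite[of A] by fastforce
  then show False using H_meet[OF assms(1,2) \<open>i \<noteq> j\<close>] assms(3,4) by blast
qed

lemma D_in_H_iff:
  assumes "j \<in> J" "d \<subseteq> H j"
  shows "d \<in> D \<longleftrightarrow> (\<exists>l\<in>L. l \<subseteq> H j \<and> d = \<pi> j ` l)"
proof
  assume d: "d \<in> D"
  then show "\<exists>l\<in>L. l \<subseteq> H j \<and> d = \<pi> j ` l"
  proof (cases rule: D_cases)
    case (2 i l)
    then have "i = j"
      using two_points_index[OF 2(1) assms(1) _ assms(2)] \<pi>_image[OF 2(1,3)] D_sub_card[OF d] by auto
    then show ?thesis using 2 by blast
  qed (use assms in blast)
qed (use assms in \<open>auto simp: D_def\<close>)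

lemma D_agree:
  assumes "\<not> l \<subseteq> (\<Union>j\<in>J. H j)"
  shows "l \<in> D \<longleftrightarrow> l \<in> L"
proof
  assume "l \<in> D"
  then show "l \<in> L"
    using assms \<pi>_image by (elim D_cases) blast+
qed (use assms in \<open>auto simp: D_def\<close>)

lemma L_not_D:
  assumes "l \<in> L" "l \<notin> D" obtains j where "j \<in> J" "l \<subseteq> H j"
  using assms unfolding D_def by blast

lemma D_line_ex:
  assumes xy: "x \<in> P" "y \<in> P" "x \<noteq> y"
  shows "\<exists>d\<in>D. x \<in> d \<and> y \<in> d"
proof (cases "\<exists>j\<in>J. x \<in> H j \<and> y \<in> H j")
  case True
  then obtain j where j: "j \<in> J" "x \<in> H j" "y \<in> H j" by blast
  have im: "\<pi> j ` H j = H j" using \<pi>_bij[OF j(1)] by (simp add: bij_betw_def)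
  then obtain a b where ab: "a \<in> H j" "b \<in> H j" "x = \<pi> j a" "y = \<pi> j b" using j by (metis imageE)
  then have "a \<noteq> b" using xy by blast
  moreover have "a \<in> P" "b \<in> P" using ab H_sub[OF j(1)] by auto
  ultimately obtain l where l: "l \<in> L" "a \<in> l" "b \<in> l" using line_ex by blast
  then have "l \<subseteq> H j" using flatD[OF H_flat[OF j(1)]] ab \<open>a \<noteq> b\<close> by blast
  then have "\<pi> j ` l \<in> D" using D_in_H_iff[OF j(1) \<pi>_image[OF j(1)], of l] l by metis
  then show ?thesis using ab l by blast
next
  case False
  obtain l where l: "l \<in> L" "x \<in> l" "y \<in> l" using line_ex[OF xy] by blast
  then have "l \<in> D" using False by (auto simp: D_def)
  then show ?thesis using l by blast
qed

text \<open>For two points of a common \<open>H j\<close> both lines lie in \<open>H j\<close> and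
  can be pulled back along \<open>\<pi> j\<close>; for any other pair both lines belong to
  \<open>L\<close>.\<close>

lemma D_line_unique:
  assumes d: "d \<in> D" "d' \<in> D" and xy: "x \<in> d" "y \<in> d" "x \<in> d'" "y \<in> d'" "x \<noteq> y"
  shows "d = d'"
proof -
  have inH: "d \<subseteq> H j" if "d \<in> D" "x \<in> d" "y \<in> d" "j \<in> J" "x \<in> H j" "y \<in> H j" for d j
    using that(1)
  proof (cases rule: D_cases)
    case 1
    then show ?thesis using flatD[OF H_flat[OF that(4)]] that xy(5) by blast
  next
    case (2 i l)
    then have "i = j"
      using H_meet[OF 2(1) that(4)] that \<pi>_image[OF 2(1,3)] xy(5) by blast
    then show ?thesis using \<pi>_image 2 by blast
  qed
  show ?thesis
  proof (cases "\<exists>j\<in>J. x \<in> H j \<and> y \<in> H j")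
    case True
    then obtain j where j: "j \<in> J" "x \<in> H j" "y \<in> H j" by blast
    obtain l where l: "l \<in> L" "l \<subseteq> H j" "d = \<pi> j ` l"
      using D_in_H_iff[OF j(1) inH[OF d(1) xy(1,2) j]] d by blast
    obtain l' where l': "l' \<in> L" "l' \<subseteq> H j" "d' = \<pi> j ` l'"
      using D_in_H_iff[OF j(1) inH[OF d(2) xy(3,4) j]] d by blast
    obtain a b where ab: "a \<in> l" "b \<in> l" "x = \<pi> j a" "y = \<pi> j b" using l xy by blast
    obtain a' b' where ab': "a' \<in> l'" "b' \<in> l'" "x = \<pi> j a'" "y = \<pi> j b'" using l' xy by blast
    have "a = a'" "b = b'"
      using \<pi>_inj[OF j(1)] ab ab' l(2) l'(2) by (metis inj_onD subsetD)+
    then have "l = l'" using line_unique[OF l(1) l'(1) ab(1,2)] ab ab' xy by blast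
    then show ?thesis using l l' by simp
  next
    case False
    have "d \<in> L" if "d \<in> D" "x \<in> d" "y \<in> d" for d
      using that(1) by (cases rule: D_cases) (use False that \<pi>_image in blast)+
    then show ?thesis using line_unique d xy by metis
  qed
qed

sublocale D: linear_space P D k
  using finite_points D_sub_card D_line_ex D_line_unique three_le
  by unfold_locales blast+

end

text \<open>\<open>S_collinear\<close> and \<open>shared_not_collinear\<close> together give a moved
  point whose image lies in at most one chosen subspace. The product \<open>k * card (S j)\<close>
  in \<open>S_small\<close> bounds the points on the lines that join a fixed point of view to the
  moved points; the factor 2 makes the remaining points a majority.\<close>

locale recognizable_space = perturbed_space +
  assumes S_small: "j \<in> J \<Longrightarrow> k + 2 * k * card (S j) < card (H j)"
    and S_collinear: "j \<in> J \<Longrightarrow> contains_triple (S j)"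
    and shared_not_collinear: "\<lbrakk>l \<in> L; {a, b, c} \<subseteq> l; a \<noteq> b; a \<noteq> c;
      b \<noteq> c\<rbrakk> \<Longrightarrow> \<exists>x\<in>{a, b, c}. \<forall>i\<in>J. \<forall>j\<in>J. x \<in> H i \<longrightarrow> x \<in> H j \<longrightarrow> i = j"
    and P_large: "k + 2 * card (\<Union>j\<in>J. H j) * kap < card P"
begin

lemma automorphism_L: "automorphism P D f \<Longrightarrow> automorphism P L f"
  using automorphism_of_perturbation[OF D.linear_space_axioms D_agree _ P_large] H_sub by blast

text \<open>Let \<open>s\<close> be moved, say \<open>s = \<pi> j t\<close>. Most lines of
  \<open>L\<close> through \<open>s\<close> inside \<open>H j\<close> are not in \<open>D\<close>;
  their images are again in \<open>L\<close> but not in \<open>D\<close>, so each lies in a chosen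
  subspace containing \<open>f s\<close>. If \<open>f s\<close> is in only one \<open>H i\<close>,
  then most of \<open>H j\<close> is mapped into \<open>H i\<close>, and a subspace containing a
  majority of \<open>H j\<close> is all of it.\<close>

lemma image_H_sub:
  assumes f: "automorphism P D f" and j: "j \<in> J"
  shows "\<exists>i\<in>J. f ` H j \<subseteq> H i"
proof -
  have fL: "automorphism P L f" using automorphism_L[OF f] .
  have inj: "inj_on f P" and fP: "f ` P \<subseteq> P" using f by (auto simp: automorphism_def bij_betw_def)
  have finH: "finite (H j)" using H_sub[OF j] finite_points by (meson finite_subset)
  \<comment> \<open>A collinear triple of moved points has a collinear image, so the images cannot
    all three be shared by several subspaces; this provides \<open>s\<close>.\<close>
  obtain l a b c where lab: "l \<in> L" "{a, b, c} \<subseteq> l \<inter> S j" "a \<noteq> b" "a \<noteq> c" "b \<noteq> c"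
    using S_collinear[OF j] unfolding contains_triple_def by blast
  have "f ` l \<in> L" using fL lab by (simp add: automorphism_def)
  moreover have "f x \<noteq> f y" if "x \<in> {a, b, c}" "y \<in> {a, b, c}" "x \<noteq> y" for x y
    using that inj lab H_sub[OF j] by (auto dest!: inj_onD)
  ultimately have "\<exists>x\<in>{f a, f b, f c}. \<forall>i\<in>J. \<forall>j\<in>J. x \<in> H i \<longrightarrow> x \<in> H j \<longrightarrow> i = j"
    using lab by (intro shared_not_collinear[of "f ` l"]) auto
  then obtain s where s: "s \<in> S j" "\<And>i i'. \<lbrakk>i \<in> J; i' \<in> J; f s \<in> H i; f s \<in> H i'\<rbrakk> \<Longrightarrow> i = i'"
    using lab(2) by blast
  obtain t where t: "t \<in> H j" "s = \<pi> j t" using s(1) \<pi>_bij[OF j] unfolding bij_betw_def by (metis (no_types, lifting) CollectD imageE)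
  have ts: "t \<noteq> s" using s t \<pi>_inj[OF j] by auto
  have tS: "t \<in> S j" using t ts by auto
  define lin where "lin x = (SOME l. l \<in> L \<and> t \<in> l \<and> x \<in> l)" for x
  have lin: "lin x \<in> L \<and> t \<in> lin x \<and> x \<in> lin x" if "x \<in> H j" "x \<noteq> t" for x
    using someI_ex[of "\<lambda>l. l \<in> L \<and> t \<in> l \<and> x \<in> l"] line_ex[of t x] that t H_sub[OF j]
    unfolding lin_def by blast
  \<comment> \<open>\<open>Y\<close> consists of the images of the lines through \<open>t\<close>
    that carry another moved point. For \<open>z\<close> outside \<open>Y\<close> the line joining
    \<open>s\<close> and \<open>z\<close> will turn out not to be in \<open>D\<close>.\<close>
  define Y where "Y = (\<Union>x\<in>S j - {t}. \<pi> j ` lin x)"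
  have finS: "finite (S j)" using finH by simp
  have "card Y \<le> (\<Sum>x\<in>S j - {t}. card (\<pi> j ` lin x))"
    unfolding Y_def using finS by (intro card_UN_le) auto
  also have "\<dots> \<le> (\<Sum>x\<in>S j - {t}. k)"
    using lin by (intro sum_mono) (metis (no_types, lifting) CollectD DiffD1 DiffD2 card_image_le finite_line insertI1 line_card)
  also have "\<dots> \<le> k * card (S j)" using finS by (simp add: card_mono)
  finally have cY: "card Y \<le> k * card (S j)" .
  have finY: "finite Y" unfolding Y_def using finS lin finite_line by (intro finite_UN_I finite_imageI) auto
  have "card (insert s Y) < card (H j)"
    using S_small[OF j] cY three_le card_insert_le_m1[of "Suc (card Y)" Y s] by simp
  then have "\<not> H j \<subseteq> insert s Y" using finY by (meson card_mono finite.insertI leD)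
  then obtain z0 where z0: "z0 \<in> H j" "z0 \<noteq> s" "z0 \<notin> Y" by blast
  have key: "\<exists>i\<in>J. f s \<in> H i \<and> f z \<in> H i" if z: "z \<in> H j" "z \<noteq> s" "z \<notin> Y" for z
  proof -
    obtain m where m: "m \<in> L" "s \<in> m" "z \<in> m"
      using line_ex[of s z] z s H_sub[OF j] by blast
    have mH: "m \<subseteq> H j" using flatD[OF H_flat[OF j] m(1,2) _ m(3)] z s by blast
    \<comment> \<open>If \<open>m\<close> were the image of \<open>l'\<close>, then \<open>t\<close>
      would be the only moved point of \<open>l'\<close>, because \<open>z\<close> is not in
      \<open>Y\<close>. The lines \<open>m\<close> and \<open>l'\<close> would share two fixed
      points and coincide, but \<open>m\<close> contains \<open>s\<close>, which is moved and
      different from \<open>t\<close>.\<close>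
    have "m \<notin> D"
    proof
      assume "m \<in> D"
      then obtain l' where l': "l' \<in> L" "l' \<subseteq> H j" "m = \<pi> j ` l'" using D_in_H_iff[OF j mH] by blast
      have "t \<in> l'" using \<pi>_inj[OF j] l' t m(2) by (metis inj_on_image_mem_iff)
      have noS: "x \<notin> S j" if "x \<in> l'" "x \<noteq> t" for x
      proof
        assume x: "x \<in> S j"
        then have "lin x = l'" using line_unique[of "lin x" l' t x] lin[of x] that l' \<open>t \<in> l'\<close> by blast
        then show False using z(3) x that m(3) l'(3) by (auto simp: Y_def)
      qed
      obtain u where u: "u \<in> l'" "u \<noteq> t" using line_third[OF l'(1)] by metis
      obtain v where v: "v \<in> l'" "v \<noteq> t" "v \<noteq> u" using line_third[OF l'(1)] .
      have "\<pi> j u = u" "\<pi> j v = v" using noS u v l' by auto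
      then have "u \<in> m" "v \<in> m" using u v l' by force+
      then have "m = l'" using line_unique[OF m(1) l'(1)] u v by metis
      then show False using noS[of s] s m ts by blast
    qed
    then have "f ` m \<notin> D" using D.automorphism_image_iff[OF f] mH H_sub[OF j] by auto
    moreover have "f ` m \<in> L" using fL m by (simp add: automorphism_def)
    ultimately obtain i where "i \<in> J" "f ` m \<subseteq> H i" using L_not_D by metis
    then show ?thesis using m by blast
  qed
  obtain i where i: "i \<in> J" "f s \<in> H i" using key[OF z0] by blast
  define A where "A = {z \<in> H j. f z \<in> H i}"
  have "A = H j"
  proof (rule flat_eqI)
    show "flat L A"
    proof (rule flatI)
      fix l x y assume l: "l \<in> L" "x \<in> l" "x \<in> A" "y \<in> l" "y \<in> A" "x \<noteq> y"
      have "l \<subseteq> H j" using flatD[OF H_flat[OF j]] l by (auto simp: A_def)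
      moreover have "f x \<noteq> f y" using l inj H_sub[OF j] by (auto simp: A_def dest!: inj_onD)
      then have "f ` l \<subseteq> H i"
        using flatD[OF H_flat[OF i(1)], of "f ` l" "f x" "f y"] fL l by (auto simp: A_def automorphism_def)
      ultimately show "l \<subseteq> A" by (auto simp: A_def)
    qed
    show "card (H j - A) < card A"
    proof -
      have "H j - A \<subseteq> Y"
      proof
        fix z assume z: "z \<in> H j - A"
        then have "z \<noteq> s" using i by (auto simp: A_def)
        then show "z \<in> Y" using key[of z] s(2)[OF _ i(1) _ i(2)] z by (auto simp: A_def)
      qed
      then have "card (H j - A) \<le> card Y" using finY by (simp add: card_mono)
      moreover have "A \<subseteq> H j" by (auto simp: A_def)
      then have "card A + card (H j - A) = card (H j)"
        using finH by (metis card_Diff_subset card_mono finite_subset le_add_diff_inverse)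
      ultimately show ?thesis using cY S_small[OF j] by linarith
    qed
  qed (use H_flat H_sub j in \<open>auto simp: A_def\<close>)
  then show ?thesis using i by (auto simp: A_def)
qed

text \<open>The inclusion is applied to \<open>f\<close> and to its inverse: \<open>H j\<close>
  returns into some \<open>H i'\<close>, and \<open>H j\<close> is too large to lie in any chosen
  subspace but itself.\<close>

lemma image_H:
  assumes f: "automorphism P D f" and j: "j \<in> J"
  obtains i where "i \<in> J" "f ` H j = H i"
proof -
  have inj: "inj_on f P" using f by (auto simp: automorphism_def bij_betw_def)
  obtain i where i: "i \<in> J" "f ` H j \<subseteq> H i" using image_H_sub[OF f j] by blast
  obtain i' where i': "i' \<in> J" "inv_into P f ` H i \<subseteq> H i'"
    using image_H_sub[OF D.automorphism_inv[OF f] i(1)] by blast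
  have "inv_into P f ` f ` H j = H j"
    using inj H_sub[OF j] by (simp add: inv_into_image_cancel)
  then have sub: "H j \<subseteq> H i'" using i i' by blast
  have "k \<le> card (H j)" using S_small[OF j] by simp
  then obtain A where "A \<subseteq> H j" "card A = k" by (meson obtain_subset_with_card_n)
  then have "i' = j" using two_points_index[OF i'(1) j] sub by blast
  have "H i \<subseteq> f ` H j"
  proof
    fix x assume x: "x \<in> H i"
    then have "inv_into P f x \<in> H j" using i' \<open>i' = j\<close> by blast
    moreover have "f (inv_into P f x) = x"
      using x H_sub[OF i(1)] f by (auto simp: automorphism_def bij_betw_def intro!: f_inv_into_f)
    ultimately show "x \<in> f ` H j" by (metis imageI)
  qed
  then show thesis using that i by blast
qed

text \<open>The commutator of f and the permutation preserves the lines of L inside H j and moves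
  few points.\<close>

lemma commutes:
  assumes f: "automorphism P D f" and j: "j \<in> J" and fH: "f ` H j = H j" and x: "x \<in> H j"
  shows "f (\<pi> j x) = \<pi> j (f x)"
proof -
  have inj: "inj_on f P" using f by (auto simp: automorphism_def bij_betw_def)
  have injH: "inj_on f (H j)" using inj H_sub[OF j] by (meson inj_on_subset)
  have bf: "bij_betw f (H j) (H j)" using injH fH by (simp add: bij_betw_def)
  have bp: "bij_betw (\<pi> j) (H j) (H j)" using \<pi>_bij[OF j] .
  have fL: "automorphism P L f" using automorphism_L[OF f] .
  define p where "p = inv_into (H j) (\<pi> j)"
  define g where "g = inv_into (H j) f"
  have bpi: "bij_betw p (H j) (H j)" unfolding p_def using bp by (rule bij_betw_inv_into)
  have bg: "bij_betw g (H j) (H j)" unfolding g_def using bf by (rule bij_betw_inv_into)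
  have ff: "f (g y) = y" "\<pi> j (p y) = y" if "y \<in> H j" for y
    using that bf bp by (auto simp: g_def p_def bij_betw_def intro!: f_inv_into_f)
  have gf: "g (f y) = y" "p (\<pi> j y) = y" if "y \<in> H j" for y
    using that bf bp by (auto simp: g_def p_def bij_betw_def)
  have mem: "f y \<in> H j" "\<pi> j y \<in> H j" "p y \<in> H j" "g y \<in> H j" if "y \<in> H j" for y
    using that bf bp bpi bg by (meson bij_betwE)+
  define c where "c y = g (p (f (\<pi> j y)))" for y
  have "c x = x"
  proof (rule few_moved_imp_id[OF H_flat[OF j] H_sub[OF j] _ _ _ x])
    have "bij_betw (g \<circ> (p \<circ> (f \<circ> \<pi> j))) (H j) (H j)"
      using bp bf bpi bg by (intro bij_betw_trans)
    then show "bij_betw c (H j) (H j)" by (simp add: c_def[abs_def] comp_def)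
    show "c ` l \<in> L" if l: "l \<in> L" "l \<subseteq> H j" for l
    proof -
      have "\<pi> j ` l \<in> D" using D_in_H_iff[OF j \<pi>_image[OF j l(2)]] l by blast
      then have "f ` \<pi> j ` l \<in> D" using f by (simp add: automorphism_def)
      moreover have "f ` \<pi> j ` l \<subseteq> H j" using \<pi>_image[OF j l(2)] fH by blast
      ultimately obtain m where m: "m \<in> L" "m \<subseteq> H j" "f ` \<pi> j ` l = \<pi> j ` m"
        using D_in_H_iff[OF j, of "f ` \<pi> j ` l"] by metis
      have "p ` f ` \<pi> j ` l = m" using m(2,3) gf(2) by (simp add: image_image subset_iff cong: image_cong)
      then have cl: "c ` l = g ` m" by (auto simp: c_def image_image)
      have "f ` g ` m = m" using m(2) ff(1) by (simp add: image_image subset_iff cong: image_cong)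
      moreover have "g ` m \<subseteq> P" using m mem(4) H_sub[OF j] by blast
      ultimately show ?thesis using automorphism_image_iff[OF fL, of "g ` m"] m cl by simp
    qed
    have finS: "finite (S j)" using H_sub[OF j] finite_points by (auto intro: finite_subset)
    \<comment> \<open>The commutator moves \<open>y\<close> only if \<open>y\<close> or
      \<open>f y\<close> is in \<open>S j\<close>, so it moves at most \<open>2 * card (S j)\<close>
      points. With \<open>3 \<le> k\<close> this is well within \<open>S_small\<close>.\<close>
    have "moved c (H j) \<subseteq> S j \<union> {y \<in> H j. f y \<in> S j}"
    proof
      fix y assume y: "y \<in> moved c (H j)"
      show "y \<in> S j \<union> {y \<in> H j. f y \<in> S j}"
      proof (rule ccontr)
        assume n: "y \<notin> S j \<union> {y \<in> H j. f y \<in> S j}"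
        then have "\<pi> j y = y" "\<pi> j (f y) = f y" using y mem by auto
        then have "c y = y" using gf(1)[of y] gf(2)[of "f y"] y mem by (simp add: c_def)
        then show False using y by simp
      qed
    qed
    moreover have "card {y \<in> H j. f y \<in> S j} \<le> card (S j)"
      using finS injH by (intro card_inj_on_le[of f]) (auto intro: inj_on_subset)
    moreover have "finite {y \<in> H j. f y \<in> S j}"
      using H_sub[OF j] finite_points by (auto intro: finite_subset)
    ultimately have "card (moved c (H j)) \<le> card (S j \<union> {y \<in> H j. f y \<in> S j})"
      "card (S j \<union> {y \<in> H j. f y \<in> S j}) \<le> 2 * card (S j)"
      using finS card_Un_le[of "S j" "{y \<in> H j. f y \<in> S j}"] by (auto intro!: card_mono)
    moreover have "3 * card (S j) \<le> k * card (S j)" using three_le by (rule mult_le_mono1)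
    ultimately show "k + 2 * card (moved c (H j)) < card (H j)"
      using S_small[OF j] by linarith
  qed
  then have "g (p (f (\<pi> j x))) = x" by (simp add: c_def)
  then have "p (f (\<pi> j x)) = f x" using ff(1) mem x by metis
  then show ?thesis using ff(2) mem x by metis
qed

end

section \<open>Coordinate frames and rigid permutations\<close>

locale framed_space = planar_space P L k Pl kap
  for P :: "'p set" and L k Pl kap +
  fixes B :: "'b set" and Sp :: "'b set \<Rightarrow> 'p set" and q :: nat
  assumes finite_B: "finite B"
    and Sp_sub: "A \<subseteq> B \<Longrightarrow> Sp A \<subseteq> P"
    and Sp_flat: "A \<subseteq> B \<Longrightarrow> flat L (Sp A)"
    and Sp_Int: "A \<subseteq> B \<Longrightarrow> C \<subseteq> B \<Longrightarrow> Sp A \<inter> Sp C = Sp (A \<inter> C)"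
    and Sp_empty: "Sp {} = {}"
    and Sp_single: "b \<in> B \<Longrightarrow> \<exists>x. Sp {b} = {x}"
    and Sp_pair: "\<lbrakk>b \<in> B; c \<in> B; b \<noteq> c\<rbrakk> \<Longrightarrow> Sp {b, c} \<in> L"
    and Sp_full: "Sp B = P"
    and Sp_card_ge: "A \<subseteq> B \<Longrightarrow> A \<noteq> {} \<Longrightarrow> q ^ (card A - 1) \<le> card (Sp A)"
    and Sp_card_le: "A \<subseteq> B \<Longrightarrow> card (Sp A) \<le> q ^ card A"
    and Sp_card_less: "\<lbrakk>A \<subseteq> B; C \<subseteq> B; card A < card C\<rbrakk> \<Longrightarrow> card (Sp A) < card (Sp C)"
    and Sp_transversal: "\<lbrakk>A \<subseteq> B; C \<subseteq> B; A \<inter> C \<noteq> {}; p \<in> Sp (A \<union> C); p \<notin> Sp A;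
      p \<notin> Sp C\<rbrakk> \<Longrightarrow> \<exists>m\<in>L. \<exists>m'\<in>L. m \<noteq> m' \<and> p \<in> m \<and> p \<in> m' \<and> (\<exists>x y. {x, y} \<subseteq> m \<inter> (Sp A \<union> Sp C) \<and> x \<noteq> y) \<and> (\<exists>x y. {x, y} \<subseteq> m' \<inter> (Sp A \<union> Sp C) \<and> x \<noteq> y)"
    and q_bounds: "2 \<le> q" "k \<le> q + 1" "kap \<le> q ^ 3"
begin

lemma Sp_mono: "A \<subseteq> C \<Longrightarrow> C \<subseteq> B \<Longrightarrow> Sp A \<subseteq> Sp C"
  using Sp_Int[of A C] by (metis Int_absorb2 Int_lower2 order_trans)

text \<open>A line with two fixed points is invariant, and \<open>p\<close> is the intersection of
  two such lines; for this reason \<open>Sp_transversal\<close> supplies two lines and not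
  one.\<close>

lemma fixes_Un:
  assumes f: "automorphism P L f" and AC: "A \<subseteq> B" "C \<subseteq> B" "A \<inter> C \<noteq> {}"
    and fixA: "\<And>x. x \<in> Sp A \<Longrightarrow> f x = x" and fixC: "\<And>x. x \<in> Sp C \<Longrightarrow> f x = x"
    and p: "p \<in> Sp (A \<union> C)"
  shows "f p = p"
proof (cases "p \<in> Sp A \<or> p \<in> Sp C")
  case False
  then obtain m m' where m: "m \<in> L" "m' \<in> L" "m \<noteq> m'" "p \<in> m" "p \<in> m'"
    and xy: "\<exists>x y. {x, y} \<subseteq> m \<inter> (Sp A \<union> Sp C) \<and> x \<noteq> y" "\<exists>x y. {x, y} \<subseteq> m' \<inter> (Sp A \<union> Sp C) \<and> x \<noteq> y"
    using Sp_transversal[OF AC p] by blast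
  have "f ` n = n" if n: "n \<in> L" "\<exists>x y. {x, y} \<subseteq> n \<inter> (Sp A \<union> Sp C) \<and> x \<noteq> y" for n
  proof -
    obtain x y where xy: "x \<in> n" "y \<in> n" "x \<noteq> y" "f x = x" "f y = y"
      using n(2) fixA fixC by auto
    have "x \<in> f ` n" "y \<in> f ` n" using xy by (auto intro: rev_image_eqI)
    then show ?thesis using line_unique[of "f ` n" n x y] f n xy by (auto simp: automorphism_def)
  qed
  then have "f p \<in> m" "f p \<in> m'" using m xy by blast+
  then show ?thesis using line_unique[OF m(1,2), of p "f p"] m by metis
qed (use fixA fixC in auto)

text \<open>The common base point \<open>b\<close> keeps the intersection nonempty at each step of
  the induction.\<close>

lemma fixes_UN:
  assumes f: "automorphism P L f" and fin: "finite I" and sub: "\<And>i. i \<in> I \<Longrightarrow> A i \<subseteq> B" "\<And>i. i \<in> I \<Longrightarrow> b \<in> A i"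
    and fixA: "\<And>i x. i \<in> I \<Longrightarrow> x \<in> Sp (A i) \<Longrightarrow> f x = x"
    and p: "p \<in> Sp (\<Union>i\<in>I. A i)"
  shows "f p = p"
  using fin sub fixA p
proof (induction I arbitrary: p rule: finite_induct)
  case empty
  then show ?case by (simp add: Sp_empty)
next
  case (insert i I)
  show ?case
  proof (cases "I = {}")
    case False
    show ?thesis
    proof (rule fixes_Un[OF f, of "A i" "\<Union>i\<in>I. A i"])
      obtain j where "j \<in> I" using False by blast
      then have "b \<in> A i" "b \<in> (\<Union>i\<in>I. A i)" using insert.prems(2) by auto
      then show "A i \<inter> (\<Union>i\<in>I. A i) \<noteq> {}" by blast
      show "f x = x" if "x \<in> Sp (\<Union>i\<in>I. A i)" for x
        using insert.IH insert.prems(1-3) that by blast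
      show "p \<in> Sp (A i \<union> (\<Union>i\<in>I. A i))" using insert.prems(4) by simp
      show "A i \<subseteq> B" "(\<Union>i\<in>I. A i) \<subseteq> B" using insert.prems(1) by auto
      show "f x = x" if "x \<in> Sp (A i)" for x using insert.prems(3) that by blast
    qed
  qed (use insert.prems(3)[of i p] insert.prems(4) in simp)
qed

text \<open>The number of moved points is linear in \<open>card A\<close> whereas
  \<open>Sp A\<close> has exponential size, which gives \<open>S_small\<close> for large
  \<open>A\<close>. The collinear triple is there for \<open>S_collinear\<close>, and the last
  clause will be applied to conjugates of automorphisms of the design.\<close>

definition rigid :: "'b set \<Rightarrow> ('p \<Rightarrow> 'p) \<Rightarrow> bool" where
  "rigid A \<pi> \<longleftrightarrow> bij_betw \<pi> (Sp A) (Sp A) \<and> card (moved \<pi> (Sp A)) \<le> k * card A \<and> contains_triple (moved \<pi> (Sp A)) \<and>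
    (\<forall>f x. automorphism P L f \<longrightarrow> f ` Sp A = Sp A \<longrightarrow> (\<forall>x\<in>Sp A. f (\<pi> x) = \<pi> (f x)) \<longrightarrow> x \<in> Sp A \<longrightarrow> f x = x)"

text \<open>The points of the lines through a base point, other than that point, are arranged in a cycle
  such that consecutive triples are not collinear; inserting one further point creates exactly one
  collinear triple and destroys the rotational symmetry of the cycle.\<close>

lemma rigid_permutation:
  assumes A: "A \<subseteq> B" "4 \<le> card A"
  shows "\<exists>\<pi>. rigid A \<pi>"
proof -
  define d where "d = card A"
  define d' where "d' = d - 1"
  have d': "3 \<le> d'" "d = Suc d'" using A(2) by (auto simp: d'_def d_def)
  have finA: "finite A" using A finite_B by (meson finite_subset)
  obtain a where a: "bij_betw a {..<d} A"
    using ex_bij_betw_nat_finite[OF finA] by (auto simp: d_def atLeast0LessThan)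
  have aA: "a i \<in> A" if "i < d" for i using a that by (auto simp: bij_betw_def)
  then have aB: "a i \<in> B" if "i < d" for i using that A by blast
  have a_eq: "a i = a j \<longleftrightarrow> i = j" if "i < d" "j < d" for i j
    using a that by (auto simp: bij_betw_def inj_on_def)
  have d0: "0 < d" using d' by simp
  obtain e where e: "Sp {a 0} = {e}" using Sp_single aB d0 by blast
  have eP: "e \<in> P" using e Sp_sub[of "{a 0}"] aB d0 by auto
  define N where "N i = Sp {a 0, a i}" for i
  define Y where "Y i = N i - {e}" for i
  have NL: "N i \<in> L" if "0 < i" "i < d" for i
    unfolding N_def using that by (intro Sp_pair aB d0) (auto simp: a_eq d0)
  have eN: "e \<in> N i" if "i < d" for i
    unfolding N_def using Sp_mono[of "{a 0}" "{a 0, a i}"] aB d0 that e by auto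
  have cY: "card (Y i) = k - 1" "finite (Y i)" if "0 < i" "i < d" for i
    unfolding Y_def using line_card[OF NL[OF that]] eN finite_line[OF NL[OF that]] that by auto
  have "\<exists>y. bij_betw y {..<k - 1} (Y i)" if "0 < i" "i < d" for i
    using ex_bij_betw_nat_finite[OF cY(2)[OF that]] cY(1)[OF that] by (simp add: atLeast0LessThan)
  then obtain y where y: "\<And>i. 0 < i \<Longrightarrow> i < d \<Longrightarrow> bij_betw (y i) {..<k - 1} (Y i)" by metis
  have N_sub: "N i \<subseteq> Sp A" if "i < d" for i
    unfolding N_def using that aA d0 A by (intro Sp_mono) auto
  \<comment> \<open>The line through \<open>u\<close> and \<open>v\<close> lies in the span of the
    base points \<open>0\<close>, \<open>i\<close> and \<open>i'\<close>, and this span meets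
    \<open>N i''\<close> only in \<open>e\<close>.\<close>
  have Y_line: "z \<notin> l" if "l \<in> L" "u \<in> l" "v \<in> l" "u \<in> Y i" "v \<in> Y i'" "z \<in> Y i''" "u \<noteq> v"
      "0 < i" "i < d" "0 < i'" "i' < d" "0 < i''" "i'' < d" "i'' \<noteq> i" "i'' \<noteq> i'" for l u v z i i' i''
  proof
    assume "z \<in> l"
    let ?C = "{a 0, a i, a i'}"
    have C: "?C \<subseteq> B" using aB d0 that by auto
    have "u \<in> Sp ?C" "v \<in> Sp ?C"
      using that Sp_mono[OF _ C, of "{a 0, a i}"] Sp_mono[OF _ C, of "{a 0, a i'}"] by (auto simp: Y_def N_def)
    then have "z \<in> Sp ?C"
      using flatD[OF Sp_flat[OF C] that(1)] that \<open>z \<in> l\<close> by blast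
    then have "z \<in> Sp (?C \<inter> {a 0, a i''})"
      using Sp_Int[OF C, of "{a 0, a i''}"] aB d0 that by (auto simp: Y_def N_def)
    moreover have "?C \<inter> {a 0, a i''} = {a 0}" using that a_eq d0 by auto
    ultimately have "z \<in> Sp {a 0}" by (simp only:)
    then show False using e that by (auto simp: Y_def)
  qed
  have Y_disj: "i = j" if "z \<in> Y i" "z \<in> Y j" "0 < i" "i < d" "0 < j" "j < d" for z i j
  proof (rule ccontr)
    assume "i \<noteq> j"
    have "z \<in> Sp ({a 0, a i} \<inter> {a 0, a j})"
      using Sp_Int[of "{a 0, a i}" "{a 0, a j}"] aB d0 that by (auto simp: Y_def N_def)
    moreover have "{a 0, a i} \<inter> {a 0, a j} = {a 0}" using that \<open>i \<noteq> j\<close> a_eq d0 by auto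
    ultimately have "z \<in> Sp {a 0}" by (simp only:)
    then show False using e that by (auto simp: Y_def)
  qed
  define M where "M = (k - 1) * d'"
  have M6: "6 \<le> M" using mult_le_mono[of 2 "k - 1" 3 d'] three_le d' by (simp add: M_def)
  \<comment> \<open>The cycle runs through the \<open>d'\<close> lines \<open>N i\<close> in turn
    and starts again after each round. Since \<open>3 \<le> d'\<close>, three consecutive points lie
    on three different lines through \<open>e\<close>.\<close>
  define ix where "ix n = Suc (n mod d')" for n
  define x0 where "x0 n = y (ix n) (n div d')" for n
  have ix: "0 < ix n" "ix n < d" for n using d' by (auto simp: ix_def)
  have x0Y: "x0 n \<in> Y (ix n)" if "n < M" for n
  proof -
    have "n div d' < k - 1" using that d' by (simp add: M_def less_mult_imp_div_less)
    then show ?thesis using y[OF ix] by (auto simp: x0_def bij_betw_def)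
  qed
  have x0_inj: "n = n'" if "n < M" "n' < M" "x0 n = x0 n'" for n n'
  proof -
    have i: "ix n = ix n'" using Y_disj x0Y that ix by metis
    have "n div d' < k - 1" "n' div d' < k - 1" using that d' by (simp_all add: M_def less_mult_imp_div_less)
    then have "n div d' = n' div d'"
      using y[OF ix[of n]] that(3) i by (auto simp: x0_def bij_betw_def inj_on_def)
    then show ?thesis using i by (metis Suc_inject div_mod_decomp ix_def)
  qed
  have x0_cover: "\<exists>n<M. z = x0 n" if z: "z \<in> Y i" "0 < i" "i < d" for z i
  proof -
    obtain j where j: "j < k - 1" "z = y i j" using y[OF z(2,3)] z(1) by (auto simp: bij_betw_def)
    define n where "n = j * d' + (i - 1)"
    have i1: "i - 1 < d'" using z d' by simp
    then have "n mod d' = i - 1" "n div d' = j" by (auto simp: n_def)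
    then have "x0 n = z" using j z by (simp add: x0_def ix_def)
    moreover have "n < (j + 1) * d'" using i1 by (simp add: n_def)
    then have "n < M" using j mult_le_mono1[of "j + 1" "k - 1" d'] unfolding M_def by linarith
    ultimately show ?thesis by blast
  qed
  have ix_Suc: "ix (Suc n) = (if ix n = d' then 1 else Suc (ix n))" for n
    using d' by (auto simp: ix_def mod_Suc)
  have ix0: "ix 0 = 1" using d' by (simp add: ix_def)
  have ix1: "ix 1 = 2" using d' by (simp add: ix_def)
  have ixM1: "ix (M - 1) = d'"
  proof -
    have "Suc (M - 1) = (k - 1) * d'" using M6 by (simp only: M_def)
    then have "Suc (M - 1) mod d' = 0" by simp
    then show ?thesis using mod_Suc[of "M - 1" d'] d' by (auto simp: ix_def split: if_splits)
  qed
  have ixM2: "ix (M - 2) = d' - 1"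
    using ix_Suc[of "M - 2"] ixM1 M6 d' by (auto simp: Suc_diff_Suc numeral_2_eq_2 split: if_splits)
  have x0P: "x0 n \<in> P" if "n < M" for n
    using x0Y[OF that] N_sub[OF ix(2)] Sp_sub[OF A(1)] by (auto simp: Y_def)
  have "x0 0 \<noteq> x0 (M - 1)" using x0_inj[of 0 "M - 1"] M6 by auto
  then obtain l0 where l0: "l0 \<in> L" "x0 0 \<in> l0" "x0 (M - 1) \<in> l0"
    using line_ex[of "x0 0" "x0 (M - 1)"] x0P M6 by auto
  \<comment> \<open>\<open>w\<close> is the inserted point: it will stand between the last and the
    first point of the cycle, on the line \<open>l0\<close> joining them.\<close>
  obtain w where w: "w \<in> l0" "w \<noteq> x0 0" "w \<noteq> x0 (M - 1)" using line_third[OF l0(1)] .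
  note first_last = \<open>x0 0 \<noteq> x0 (M - 1)\<close>
  have l0Y: "x0 n \<notin> l0" if "n < M" "ix n \<noteq> 1" "ix n \<noteq> d'" for n
    using Y_line[OF l0(1-3) x0Y x0Y x0Y first_last] that ix ix0 ixM1 M6 by auto
  have w_new: "x0 n \<noteq> w" if n: "n < M" for n
  proof
    assume eq: "x0 n = w"
    have "ix n = 1 \<or> ix n = d'" using l0Y[OF n] eq w by auto
    then have "\<exists>n'\<in>{0, M - 1}. ix n = ix n'" using ix0 ixM1 by simp
    then obtain n' where n': "n' \<in> {0, M - 1}" "ix n = ix n'" by blast
    have "n' < M" using n' M6 by auto
    have "x0 n \<in> N (ix n)" "x0 n' \<in> N (ix n)" using x0Y[OF n] x0Y[OF \<open>n' < M\<close>] n' by (auto simp: Y_def)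
    moreover have "x0 n \<noteq> x0 n'" "x0 n' \<in> l0" "x0 n \<in> l0" using eq w n' l0 by auto
    ultimately have "l0 = N (ix n)" using line_unique[OF l0(1) NL[OF ix]] by blast
    then have "x0 0 \<in> Y (ix n)" "x0 (M - 1) \<in> Y (ix n)"
      using l0 x0Y[of 0] x0Y[of "M - 1"] M6 by (auto simp: Y_def)
    then have "ix 0 = ix (M - 1)" using Y_disj[OF _ x0Y ix ix] M6 by (metis diff_less less_numeral_extra(1) order_less_le_trans zero_less_numeral)
    then show False using ix0 ixM1 d' by simp
  qed
  define m where "m = Suc M"
  define x where "x n = (if n < M then x0 n else w)" for n
  have x_inj: "x n = x n' \<longleftrightarrow> n = n'" if "n < m" "n' < m" for n n'
    using that x0_inj w_new w_new[symmetric] by (auto simp: x_def m_def less_Suc_eq)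
  define T where "T n \<longleftrightarrow> (\<exists>l\<in>L. x n \<in> l \<and> x (Suc n mod m) \<in> l \<and> x (Suc (Suc n) mod m) \<in> l)" for n
  have Mm: "M - 1 < m" "M < m" "0 < m" using M6 by (auto simp: m_def)
  have T_last: "T (M - 1)"
  proof -
    have "Suc (M - 1) mod m = M" "Suc (Suc (M - 1)) mod m = 0" using M6 by (auto simp: m_def)
    then show ?thesis unfolding T_def using l0 w M6 by (auto simp: x_def)
  qed
  have T_only: "n = M - 1" if n: "n < m" "T n" for n
  proof (rule ccontr)
    assume nM: "n \<noteq> M - 1"
    obtain l where l: "l \<in> L" "x n \<in> l" "x (Suc n mod m) \<in> l" "x (Suc (Suc n) mod m) \<in> l"
      using n(2) by (auto simp: T_def)
    have l_l0: "l = l0" if "w \<in> l" "u \<in> l" "u \<in> {x0 0, x0 (M - 1)}" for u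
      using line_unique[OF l(1) l0(1), of w u] that w l0 by auto
    \<comment> \<open>Either the triple avoids \<open>w\<close>, or it is one of the two other
      triples through \<open>w\<close>. In the latter case the line must be \<open>l0\<close>, but
      the remaining point lies on the line \<open>N i\<close> with \<open>i = d' - 1\<close> or
      \<open>i = 2\<close>, and by \<open>l0Y\<close> it is off \<open>l0\<close>.\<close>
    consider "n + 2 < M" | "n = M - 2" | "n = M" using n(1) nM by (fastforce simp: m_def)
    then show False
    proof cases
      case 1
      then have in_l: "x0 n \<in> l" "x0 (Suc n) \<in> l" "x0 (Suc (Suc n)) \<in> l" using l by (auto simp: x_def m_def)
      have "ix (Suc (Suc n)) \<noteq> ix n" "ix (Suc (Suc n)) \<noteq> ix (Suc n)" using ix_Suc[of n] ix_Suc[of "Suc n"] d' by auto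
      moreover have "x0 n \<noteq> x0 (Suc n)" using x0_inj[of n "Suc n"] 1 by auto
      ultimately show False
        using Y_line[OF l(1) in_l(1,2) x0Y x0Y x0Y] in_l(3) ix 1 by auto
    next
      case 2
      then have "x0 (M - 2) \<in> l" "x0 (M - 1) \<in> l" "w \<in> l"
        using l M6 by (auto simp: x_def m_def Suc_diff_Suc numeral_2_eq_2)
      then show False using l_l0[of "x0 (M - 1)"] l0Y[of "M - 2"] ixM2 d' M6 by auto
    next
      case 3
      have "Suc (Suc M) mod Suc M = 1" using M6 by (simp add: mod_Suc)
      then have "w \<in> l" "x0 0 \<in> l" "x0 1 \<in> l" using 3 l M6 by (auto simp: x_def m_def)
      then show False using l_l0[of "x0 0"] l0Y[of 1] ix1 d' M6 by auto
    qed
  qed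
  define XX where "XX = x ` {..<m}"
  define \<pi> where "\<pi> z = (if z \<in> XX then x (Suc (inv_into {..<m} x z) mod m) else z)" for z
  have xinjon: "inj_on x {..<m}" using x_inj by (auto simp: inj_on_def)
  have \<pi>x: "\<pi> (x n) = x (Suc n mod m)" if "n < m" for n
    using that xinjon by (simp add: \<pi>_def XX_def)
  have XX_sub: "XX \<subseteq> Sp A"
  proof -
    have "x0 n \<in> Sp A" if "n < M" for n using x0Y[OF that] N_sub[OF ix(2)] by (auto simp: Y_def)
    moreover have "l0 \<subseteq> Sp A"
      using flatD[OF Sp_flat[OF A(1)] l0(1,2) _ l0(3) _ first_last] calculation M6 by auto
    ultimately show ?thesis using w by (auto simp: XX_def x_def)
  qed
  have \<pi>XX: "\<pi> z \<in> XX" if "z \<in> XX" for z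
    using that Mm by (auto simp: \<pi>_def XX_def)
  have moved: "\<pi> z \<noteq> z \<longleftrightarrow> z \<in> XX" for z
  proof
    assume "z \<in> XX"
    then obtain n where n: "n < m" "z = x n" by (auto simp: XX_def)
    have "Suc n mod m \<noteq> n" using n M6 by (cases "Suc n = m") (auto simp: m_def)
    then show "\<pi> z \<noteq> z" using \<pi>x[OF n(1)] x_inj[of "Suc n mod m" n] n Mm by simp
  qed (metis \<pi>_def)
  have finSp: "finite (Sp A)" using Sp_sub[OF A(1)] finite_points by (meson finite_subset)
  have \<pi>_inj: "inj_on \<pi> (Sp A)"
  proof (rule inj_onI)
    fix u v assume uv: "u \<in> Sp A" "v \<in> Sp A" "\<pi> u = \<pi> v"
    have "u \<in> XX \<longleftrightarrow> v \<in> XX" using uv \<pi>XX moved by metis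
    then consider "u \<notin> XX" "v \<notin> XX" | "u \<in> XX" "v \<in> XX" by blast
    then show "u = v"
    proof cases
      case 1
      then show ?thesis using uv moved by metis
    next
      case 2
      then obtain n n' where n: "n < m" "u = x n" "n' < m" "v = x n'" by (auto simp: XX_def)
      then have "Suc n mod m = Suc n' mod m"
        using \<pi>x[of n] \<pi>x[of n'] uv x_inj[of "Suc n mod m" "Suc n' mod m"] Mm by simp
      then show ?thesis using n by (cases "Suc n = m"; cases "Suc n' = m") auto
    qed
  qed
  have "\<pi> ` Sp A \<subseteq> Sp A" using \<pi>XX XX_sub by (auto simp: \<pi>_def)
  then have bij: "bij_betw \<pi> (Sp A) (Sp A)"
    using \<pi>_inj finSp by (simp add: bij_betw_def endo_inj_surj)
  have X_eq: "{z \<in> Sp A. \<pi> z \<noteq> z} = XX" using moved XX_sub by auto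
  have "rigid A \<pi>"
    unfolding rigid_def
  proof (intro conjI allI impI)
    show "bij_betw \<pi> (Sp A) (Sp A)" by (rule bij)
    have "card XX \<le> m" unfolding XX_def by (metis card_image_le card_lessThan finite_lessThan)
    also have "m \<le> k * card A"
    proof -
      have "(k - 1) * d' + 1 \<le> k * d'" using three_le d' by (cases k) auto
      then show ?thesis using d' by (simp add: m_def M_def d_def[symmetric])
    qed
    finally show "card (moved \<pi> (Sp A)) \<le> k * card A" by (simp add: X_eq)
    show "contains_triple (moved \<pi> (Sp A))"
      unfolding contains_triple_def
    proof (intro bexI exI conjI)
      have "x0 0 \<in> XX" "x0 (M - 1) \<in> XX" "w \<in> XX"
        unfolding XX_def using M6 by (auto simp: x_def m_def image_iff intro: bexI[of _ 0] bexI[of _ "M - 1"] bexI[of _ M])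
      then show "{x0 0, x0 (M - 1), w} \<subseteq> l0 \<inter> moved \<pi> (Sp A)" using l0 w X_eq by auto
    qed (use l0 w first_last in auto)
  next
    fix f z assume f: "automorphism P L f" "f ` Sp A = Sp A" "\<forall>x\<in>Sp A. f (\<pi> x) = \<pi> (f x)" and z: "z \<in> Sp A"
    have injf: "inj_on f P" using f by (auto simp: automorphism_def bij_betw_def)
    have xA: "x n \<in> Sp A" if "n < m" for n using that XX_sub by (auto simp: XX_def)
    have m1: "1 < m" using M6 by (simp add: m_def)
    then have "x 0 \<noteq> x 1" "x 0 \<in> P" "x 1 \<in> P" using x_inj[of 0 1] Mm xA Sp_sub[OF A(1)] by auto
    then have "f (x 0) \<noteq> f (x 1)" using injf by (auto dest: inj_onD)
    then have "\<pi> (f (x 0)) \<noteq> f (x 0)" using bspec[OF f(3) xA[of 0]] \<pi>x[of 0] Mm M6 by (auto simp: m_def)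
    then obtain r where r: "r < m" "f (x 0) = x r" using moved by (auto simp: XX_def)
    \<comment> \<open>Commuting with the cycle, \<open>f\<close> rotates it by \<open>r\<close>
      places; as a collineation it preserves the position of the only collinear triple, which forces
      \<open>r = 0\<close>.\<close>
    have rot: "f (x n) = x ((n + r) mod m)" if "n < m" for n
      using that
    proof (induction n)
      case (Suc n)
      then have "f (x (Suc n)) = f (\<pi> (x n))" using \<pi>x[of n] by simp
      also have "\<dots> = \<pi> (x ((n + r) mod m))" using f(3) xA Suc by simp
      also have "\<dots> = x (Suc ((n + r) mod m) mod m)" using \<pi>x Mm by simp
      finally show ?case by (simp add: mod_Suc_eq)
    qed (use r in simp)
    have "T ((M - 1 + r) mod m)"
    proof -
      obtain l where l: "l \<in> L" "x (M - 1) \<in> l" "x (Suc (M - 1) mod m) \<in> l" "x (Suc (Suc (M - 1)) mod m) \<in> l"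
        using T_last by (auto simp: T_def)
      have "f ` l \<in> L" using f l by (simp add: automorphism_def)
      moreover have "f (x (M - 1)) \<in> f ` l" "f (x (Suc (M - 1) mod m)) \<in> f ` l" "f (x (Suc (Suc (M - 1)) mod m)) \<in> f ` l"
        using l by auto
      moreover have "(Suc (M - 1) mod m + r) mod m = Suc ((M - 1 + r) mod m) mod m"
        by (simp add: mod_simps)
      moreover have "(Suc (Suc (M - 1)) mod m + r) mod m = Suc (Suc ((M - 1 + r) mod m)) mod m"
        by (metis add_Suc mod_Suc_Suc_eq mod_add_left_eq)
      ultimately show ?thesis unfolding T_def using rot Mm by (metis mod_less_divisor)
    qed
    then have "(M - 1 + r) mod m = M - 1" using T_only Mm by simp
    then have "r = 0" using r M6 by (auto simp: m_def mod_if split: if_splits)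
    then have fixX: "f z = z" if "z \<in> XX" for z using rot that by (auto simp: XX_def)
    have fixY: "f z = z" if z: "z \<in> Y i" "0 < i" "i < d" for z i
    proof (rule fixX)
      obtain n where "n < M" "z = x0 n" using x0_cover[OF z] by blast
      then show "z \<in> XX" by (auto simp: XX_def x_def m_def intro!: image_eqI[of _ _ n])
    qed
    have fixN: "f z = z" if z: "z \<in> N i" "0 < i" "i < d" for z i
    proof (cases "z = e")
      case True
      have "2 \<le> card (Y i)" using cY z three_le by simp
      then obtain u v where uv: "u \<in> Y i" "v \<in> Y i" "u \<noteq> v"
        using card_le_Suc0_iff_eq[OF cY(2)[OF z(2,3)]] by force
      have "u \<in> f ` N i" "v \<in> f ` N i" using uv fixY[OF _ that(2,3)] by (auto simp: Y_def intro: rev_image_eqI)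
      then have "f ` N i = N i"
        using line_unique[of "f ` N i" "N i" u v] f(1) NL[OF that(2,3)] uv by (auto simp: automorphism_def Y_def)
      then have "f e \<in> N i" using that True by blast
      \<comment> \<open>If \<open>f e\<close> were another point of \<open>N i\<close>, it would be
        fixed, and injectivity would give \<open>f e = e\<close> all the same.\<close>
      then have "f (f e) = f e \<or> f e = e" using fixY[OF _ that(2,3), of "f e"] by (auto simp: Y_def)
      then show ?thesis
        using injf eP True f(1) by (metis automorphism_def bij_betwE inj_on_eq_iff)
    qed (use fixY that in \<open>auto simp: Y_def\<close>)
    have "(\<Union>i\<in>{0<..<d}. {a 0, a i}) = A"
    proof
      show "A \<subseteq> (\<Union>i\<in>{0<..<d}. {a 0, a i})"
      proof
        fix b assume "b \<in> A"
        then obtain i where "i < d" "b = a i" using a by (auto simp: bij_betw_def)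
        then have "(if i = 0 then 1 else i) \<in> {0<..<d}" "b \<in> {a 0, a (if i = 0 then 1 else i)}" using d' by auto
        then show "b \<in> (\<Union>i\<in>{0<..<d}. {a 0, a i})" by (rule UN_I)
      qed
    qed (use aA d0 in auto)
    then show "f z = z"
      using fixes_UN[OF f(1), of "{0<..<d}" "\<lambda>i. {a 0, a i}" "a 0" z] z aB d0 fixN by (auto simp: N_def)
  qed
  then show ?thesis by blast
qed

end

section \<open>Designs with a prescribed automorphism group\<close>

locale symmetric_framed_space = framed_space P L k Pl kap B Sp q
  for P :: "'p set" and L k Pl kap and B :: "'b set" and Sp q +
  fixes act :: "('b \<Rightarrow> 'b) \<Rightarrow> 'p \<Rightarrow> 'p"
  assumes act_automorphism: "bij_betw u B B \<Longrightarrow> automorphism P L (act u)"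
    and act_Sp: "bij_betw u B B \<Longrightarrow> A \<subseteq> B \<Longrightarrow> act u ` Sp A = Sp (u ` A)"
    and act_comp: "\<lbrakk>bij_betw u B B; bij_betw v B B; (\<And>b. b \<in> B \<Longrightarrow> w b = u (v b));
      x \<in> P\<rbrakk> \<Longrightarrow> act u (act v x) = act w x"
    and act_id: "(\<And>b. b \<in> B \<Longrightarrow> u b = b) \<Longrightarrow> x \<in> P \<Longrightarrow> act u x = x"

section \<open>Blocks of indices encoding the multiplication of a finite group\<close>

definition translate :: "('a, 'm) monoid_scheme \<Rightarrow> 'a \<Rightarrow> 'a \<times> nat \<times> nat \<Rightarrow> 'a \<times> nat \<times> nat" where
  "translate G g = (\<lambda>(x, i, j). (g \<otimes>\<^bsub>G\<^esub> x, i, j))"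

text \<open>For t > 0 the blocks of type t record multiplication by h t: the translate by g joins the
  index (g, 0, 0) to (g * h t, 0, 1). The remaining indices are private to the block, and their
  number makes t visible in the size.\<close>

definition base_block :: "('a, 'm) monoid_scheme \<Rightarrow> (nat \<Rightarrow> 'a) \<Rightarrow> nat \<Rightarrow> nat \<Rightarrow> ('a \<times> nat \<times> nat) set" where
  "base_block G h d t = insert (\<one>\<^bsub>G\<^esub>, 0, 0) ((if t = 0 then {} else {(h t, 0, 1)}) \<union>
     (\<lambda>j. (\<one>\<^bsub>G\<^esub>, Suc t, j)) ` {..<d + t})"

definition block :: "('a, 'm) monoid_scheme \<Rightarrow> (nat \<Rightarrow> 'a) \<Rightarrow> nat \<Rightarrow> 'a \<times> nat \<Rightarrow> ('a \<times> nat \<times> nat) set" where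
  "block G h d = (\<lambda>(g, t). translate G g ` base_block G h d t)"

definition block_points :: "('a, 'm) monoid_scheme \<Rightarrow> (nat \<Rightarrow> 'a) \<Rightarrow> nat \<Rightarrow> ('a \<times> nat \<times> nat) set" where
  "block_points G h d = (\<Union>j\<in>carrier G \<times> {..card (carrier G)}. block G h d j)"

locale enumerated_group = group G for G :: "('a, 'm) monoid_scheme" (structure) +
  fixes h :: "nat \<Rightarrow> 'a" and d :: nat
  assumes finite_carrier: "finite (carrier G)"
    and h_bij: "bij_betw h {1..card (carrier G)} (carrier G)"
begin

abbreviation n :: nat where "n \<equiv> card (carrier G)"
abbreviation blk :: "'a \<times> nat \<Rightarrow> ('a \<times> nat \<times> nat) set" where "blk \<equiv> block G h d"
abbreviation J :: "('a \<times> nat) set" where "J \<equiv> carrier G \<times> {..n}"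
abbreviation tr where "tr \<equiv> translate G"
abbreviation bb where "bb \<equiv> base_block G h d"
abbreviation BB where "BB \<equiv> block_points G h d"

lemma h_carrier: "t \<noteq> 0 \<Longrightarrow> t \<le> n \<Longrightarrow> h t \<in> carrier G"
  using h_bij by (auto simp: bij_betw_def)

lemma h_inj: "\<lbrakk>t \<noteq> 0; t \<le> n; t' \<noteq> 0; t' \<le> n; h t = h t'\<rbrakk> \<Longrightarrow> t = t'"
  using h_bij unfolding bij_betw_def by (metis One_nat_def Suc_leI atLeastAtMost_iff inj_onD neq0_conv)

lemma h_surj: "x \<in> carrier G \<Longrightarrow> \<exists>t. t \<noteq> 0 \<and> t \<le> n \<and> h t = x"
proof -
  assume "x \<in> carrier G"
  then have "x \<in> h ` {1..n}" using h_bij by (simp add: bij_betw_def)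
  then obtain t where "t \<in> {1..n}" "x = h t" by (rule imageE)
  then show ?thesis by (intro exI[of _ t]) auto
qed

lemma bb_carrier: "t \<le> n \<Longrightarrow> b \<in> bb t \<Longrightarrow> fst b \<in> carrier G"
  using h_carrier by (auto simp: base_block_def split: if_splits)

lemma BB_carrier: "b \<in> BB \<Longrightarrow> fst b \<in> carrier G"
  using bb_carrier by (force simp: block_points_def block_def translate_def)

lemma tr_tr: "\<lbrakk>g \<in> carrier G; g' \<in> carrier G;
      fst b \<in> carrier G\<rbrakk> \<Longrightarrow> tr g (tr g' b) = tr (g \<otimes> g') b"
  by (auto simp: translate_def m_assoc split: prod.splits)

lemma tr_one: "fst b \<in> carrier G \<Longrightarrow> tr \<one> b = b"
  by (auto simp: translate_def split: prod.splits)

lemma block_eq: "blk (g, t) = tr g ` bb t"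
  by (simp add: block_def)

lemma tr_block:
  assumes "g \<in> carrier G" "g' \<in> carrier G" "t \<le> n"
  shows "tr g ` blk (g', t) = blk (g \<otimes> g', t)"
  unfolding block_eq image_image using assms bb_carrier tr_tr by (intro image_cong) auto

lemma block_sub: "j \<in> J \<Longrightarrow> blk j \<subseteq> BB"
  by (auto simp: block_points_def)

lemma bb_eq_block: "t \<le> n \<Longrightarrow> bb t = blk (\<one>, t)"
proof -
  assume "t \<le> n"
  then have "tr \<one> ` bb t = (\<lambda>b. b) ` bb t" using bb_carrier tr_one by (intro image_cong) auto
  then show ?thesis by (simp add: block_eq)
qed

lemma bb_sub: "t \<le> n \<Longrightarrow> bb t \<subseteq> BB"
  using block_sub[of "(\<one>, t)"] bb_eq_block by simp

lemma finite_bb: "finite (bb t)"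
  by (simp add: base_block_def)

lemma finite_BB: "finite BB"
  using finite_carrier finite_bb by (auto simp: block_points_def block_def)

lemma tr_BB_sub: "g \<in> carrier G \<Longrightarrow> tr g ` BB \<subseteq> BB"
proof -
  assume g: "g \<in> carrier G"
  have "tr g ` blk j \<subseteq> BB" if "j \<in> J" for j
    using that g tr_block[of g "fst j" "snd j"] block_sub[of "(g \<otimes> fst j, snd j)"] by (cases j) auto
  then show ?thesis unfolding block_points_def image_UN by blast
qed

lemma tr_bij:
  assumes "g \<in> carrier G" shows "bij_betw (tr g) BB BB"
proof (rule bij_betw_byWitness[where f' = "tr (inv g)"])
  show "\<forall>a\<in>BB. tr (inv g) (tr g a) = a" "\<forall>a\<in>BB. tr g (tr (inv g) a) = a"
    using assms BB_carrier by (simp_all add: tr_tr tr_one)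
qed (use assms tr_BB_sub in auto)

lemma card_bb: "card (bb t) = (if t = 0 then d + 1 else d + t + 2)"
proof -
  have "card ((\<lambda>j. (\<one>, Suc t, j)) ` {..<d + t}) = d + t"
    by (subst card_image) (auto simp: inj_on_def)
  moreover have "(h t, 0, 1) \<notin> (\<lambda>j. (\<one>, Suc t, j)) ` {..<d + t}" by auto
  moreover have "(\<one>, 0, 0) \<notin> insert (h t, 0, 1) ((\<lambda>j. (\<one>, Suc t, j)) ` {..<d + t})" by auto
  ultimately show ?thesis by (auto simp: base_block_def)
qed

lemma inj_tr: "g \<in> carrier G \<Longrightarrow> A \<subseteq> BB \<Longrightarrow> inj_on (tr g) A"
  using tr_bij by (meson bij_betw_def inj_on_subset)

lemma card_block: "g \<in> carrier G \<Longrightarrow> t \<le> n \<Longrightarrow> card (blk (g, t)) = (if t = 0 then d + 1 else d + t + 2)"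
  using inj_tr[OF _ bb_sub] card_bb by (simp add: block_eq card_image)

lemma block_cases:
  assumes "b \<in> blk (g, t)" "g \<in> carrier G"
  obtains "b = (g, 0, 0)" | "t \<noteq> 0" "b = (g \<otimes> h t, 0, 1)" | j where "b = (g, Suc t, j)" "j < d + t"
  using assms by (auto simp: block_eq base_block_def translate_def split: if_splits)

lemma block_mem:
  assumes "g \<in> carrier G"
  shows "(g, 0, 0) \<in> blk (g, t)" "t \<noteq> 0 \<Longrightarrow> (g \<otimes> h t, 0, 1) \<in> blk (g, t)"
proof -
  have "tr g (\<one>, 0, 0) \<in> blk (g, t)" by (simp add: block_eq base_block_def)
  then show "(g, 0, 0) \<in> blk (g, t)" using assms by (simp add: translate_def)
  have "tr g (h t, 0, 1) \<in> blk (g, t)" if "t \<noteq> 0" using that by (simp add: block_eq base_block_def)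
  then show "(g \<otimes> h t, 0, 1) \<in> blk (g, t)" if "t \<noteq> 0" using that by (simp add: translate_def)
qed

text \<open>A common index is either \<open>(g, 0, 0)\<close> with \<open>g = g'\<close>, or of the
  form \<open>(x, 0, 1)\<close> with \<open>x = g \<otimes> h t = g' \<otimes> h t'\<close>. If both
  kinds were shared, cancelling \<open>g\<close> would give \<open>h t = h t'\<close> and
  \<open>t = t'\<close>.\<close>

lemma block_meet:
  assumes j: "(g, t) \<in> J" "(g', t') \<in> J" "(g, t) \<noteq> (g', t')"
    and x: "x \<in> blk (g, t)" "x \<in> blk (g', t')"
    and y: "y \<in> blk (g, t)" "y \<in> blk (g', t')"
  shows "x = y"
proof -
  have g: "g \<in> carrier G" "g' \<in> carrier G" using j by auto
  have eq: "t = t'" if "g \<otimes> h t = g \<otimes> h t'" "t \<noteq> 0" "t' \<noteq> 0" "g = g'"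
    using that j h_inj h_carrier g by (metis SigmaD2 atMost_iff Units_eq Units_l_cancel)
  have both: "b = (g, 0, 0) \<and> g = g' \<or> t \<noteq> 0 \<and> t' \<noteq> 0 \<and> b = (g \<otimes> h t, 0, 1) \<and> g \<otimes> h t = g' \<otimes> h t'"
    if b: "b \<in> blk (g, t)" "b \<in> blk (g', t')" for b
    by (rule block_cases[OF b(1) g(1)]; rule block_cases[OF b(2) g(2)]) (use assms(3) in simp_all)
  show ?thesis using both[OF x] both[OF y] eq j(3) by metis
qed

text \<open>Types \<open>0\<close> and \<open>n\<close> differ even for the trivial group. Their
  private indices alone make the frame exceed every single block by at least \<open>d - 2\<close>
  indices.\<close>

lemma card_BB: "d + d + n \<le> card BB"
proof -
  let ?A = "(\<lambda>j. (\<one>, 1::nat, j)) ` {..<d} \<union> (\<lambda>j. (\<one>, Suc n, j)) ` {..<d + n}"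
  have n: "0 < n" using finite_carrier one_closed by (auto simp: card_gt_0_iff)
  have "?A \<subseteq> bb 0 \<union> bb n" by (auto simp: base_block_def)
  then have "card ?A \<le> card BB"
    using bb_sub[of 0] bb_sub[of n] finite_BB by (intro card_mono) auto
  moreover have "card ?A = d + (d + n)"
    by (subst card_Un_disjoint) (use n in \<open>auto simp: card_image inj_on_def\<close>)
  ultimately show ?thesis by simp
qed

end

text \<open>In \<open>d_small\<close>, \<open>c\<close> stands for the size of a block, with at most
  \<open>k * c\<close> moved points and at least \<open>q ^ (c - 1)\<close> points in its subspace.
  In \<open>d_large\<close>, \<open>n * Suc n\<close> counts the blocks and
  \<open>q ^ (d + n + 2)\<close> bounds each of their subspaces.\<close>

locale group_space = symmetric_framed_space P L k Pl kap "block_points G h d" Sp q act + enumerated_group G h d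
  for P :: "'p set" and L k Pl kap and G :: "('a, 'm) monoid_scheme" (structure) and h d and Sp q act +
  assumes d_ge: "4 \<le> d"
    and d_small: "\<And>c. d \<le> c \<Longrightarrow> k + 2 * k * (k * c) < q ^ (c - 1)"
    and d_large: "k + 2 * (n * Suc n * q ^ (d + n + 2)) * kap
        < q ^ (d + d + n - 1)"
begin

abbreviation A where "A g \<equiv> act (tr g)"

definition H :: "'a \<times> nat \<Rightarrow> 'p set" where "H j = Sp (blk j)"

lemma A_automorphism: "g \<in> carrier G \<Longrightarrow> automorphism P L (A g)"
  using act_automorphism tr_bij by blast

lemma A_A: "\<lbrakk>g \<in> carrier G; g' \<in> carrier G; x \<in> P\<rbrakk> \<Longrightarrow> A g (A g' x) = A (g \<otimes> g') x"
  by (rule act_comp) (use tr_bij tr_tr BB_carrier in auto)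

lemma A_one: "x \<in> P \<Longrightarrow> A \<one> x = x"
  by (rule act_id) (use tr_one BB_carrier in auto)

lemma A_P: "g \<in> carrier G \<Longrightarrow> x \<in> P \<Longrightarrow> A g x \<in> P"
  using A_automorphism by (auto simp: automorphism_def bij_betw_def)

lemma H_P: "j \<in> J \<Longrightarrow> H j \<subseteq> P"
  unfolding H_def using Sp_sub block_sub by blast

lemma A_H: "\<lbrakk>g \<in> carrier G; g' \<in> carrier G; t \<le> n\<rbrakk> \<Longrightarrow> A g ` H (g', t) = H (g \<otimes> g', t)"
  unfolding H_def using act_Sp[OF tr_bij block_sub] tr_block by auto

definition \<rho> :: "nat \<Rightarrow> 'p \<Rightarrow> 'p" where "\<rho> t = (SOME p. rigid (bb t) p)"

lemma rigid: "t \<le> n \<Longrightarrow> rigid (bb t) (\<rho> t)"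
proof -
  assume t: "t \<le> n"
  have "4 \<le> card (bb t)" using card_bb d_ge by simp
  then show ?thesis unfolding \<rho>_def by (rule someI_ex[OF rigid_permutation[OF bb_sub[OF t]]])
qed

text \<open>One rigid permutation is chosen for each type and transported by conjugation with the
  left translations, so that these permute the modified subspaces and remain automorphisms.\<close>

definition \<pi> :: "'a \<times> nat \<Rightarrow> 'p \<Rightarrow> 'p" where
  "\<pi> = (\<lambda>(g, t) x. A g (\<rho> t (A (inv g) x)))"

lemma H_base: "t \<le> n \<Longrightarrow> Sp (bb t) = H (\<one>, t)"
  by (simp add: H_def bb_eq_block[symmetric])

lemma A_inv_H: "g \<in> carrier G \<Longrightarrow> t \<le> n \<Longrightarrow> A (inv g) ` H (g, t) = Sp (bb t)"
  using A_H[of "inv g" g t] H_base by simp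

lemma A_H_base: "g \<in> carrier G \<Longrightarrow> t \<le> n \<Longrightarrow> A g ` Sp (bb t) = H (g, t)"
  using A_H[of g "\<one>" t] H_base by simp

lemma A_inj: "\<lbrakk>g \<in> carrier G; x \<in> P; y \<in> P\<rbrakk> \<Longrightarrow> A g x = A g y \<longleftrightarrow> x = y"
  using A_automorphism by (auto simp: automorphism_def bij_betw_def inj_on_def)

lemma Sp_bb_P: "t \<le> n \<Longrightarrow> Sp (bb t) \<subseteq> P"
  using Sp_sub bb_sub by blast

lemma \<rho>_mem: "t \<le> n \<Longrightarrow> x \<in> Sp (bb t) \<Longrightarrow> \<rho> t x \<in> Sp (bb t)"
  using rigid[of t] by (auto simp: rigid_def bij_betw_def)

lemma \<pi>_A:
  assumes "g \<in> carrier G" "t \<le> n" "x \<in> Sp (bb t)"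
  shows "\<pi> (g, t) (A g x) = A g (\<rho> t x)"
  using assms A_A[of "inv g" g x] A_one Sp_bb_P[of t] by (auto simp: \<pi>_def)

lemma \<pi>_equivariant:
  assumes "g \<in> carrier G" "g' \<in> carrier G" "t \<le> n" "x \<in> H (g', t)"
  shows "\<pi> (g \<otimes> g', t) (A g x) = A g (\<pi> (g', t) x)"
proof -
  obtain y where y: "y \<in> Sp (bb t)" "x = A g' y" using assms A_H_base by blast
  have "y \<in> P" "\<rho> t y \<in> P" using y \<rho>_mem[of t y] assms Sp_bb_P by auto
  then show ?thesis using y assms \<pi>_A[of "g \<otimes> g'" t y] \<pi>_A[of g' t y] by (simp add: A_A)
qed

lemma moved_eq:
  assumes "g \<in> carrier G" "t \<le> n"
  shows "moved (\<pi> (g, t)) (H (g, t)) = A g ` moved (\<rho> t) (Sp (bb t))"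
proof -
  have "\<pi> (g, t) (A g y) \<noteq> A g y \<longleftrightarrow> \<rho> t y \<noteq> y" if "y \<in> Sp (bb t)" for y
    using that assms \<pi>_A[OF assms that] A_inj[OF assms(1)] \<rho>_mem[OF assms(2) that] Sp_bb_P[OF assms(2)] by auto
  then show ?thesis unfolding A_H_base[OF assms, symmetric] by blast
qed

lemma card_H_le: "j \<in> J \<Longrightarrow> card (H j) \<le> q ^ (d + n + 2)"
proof -
  assume j: "j \<in> J"
  have "card (H j) \<le> q ^ card (blk j)"
    unfolding H_def using Sp_card_le block_sub j by blast
  also have "\<dots> \<le> q ^ (d + n + 2)"
    using j q_bounds card_block[of "fst j" "snd j"] by (intro power_increasing) auto
  finally show ?thesis .
qed

sublocale recognizable_space P L k Pl kap J H \<pi>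
proof
  show "H j \<subseteq> P" if "j \<in> J" for j using H_P that .
  show "flat L (H j)" if "j \<in> J" for j unfolding H_def using Sp_flat block_sub that by blast
  have meet: "\<exists>b\<in>BB. H i \<inter> H j \<subseteq> Sp {b}" if ij: "i \<in> J" "j \<in> J" "i \<noteq> j" for i j
  proof -
    let ?C = "blk i \<inter> blk j"
    have C: "H i \<inter> H j = Sp ?C" unfolding H_def using Sp_Int block_sub ij by blast
    have eq: "x = y" if "x \<in> ?C" "y \<in> ?C" for x y
      using block_meet[of "fst i" "snd i" "fst j" "snd j" x y] ij that by simp
    have "\<exists>b\<in>BB. ?C \<subseteq> {b}"
    proof (cases "?C = {}")
      case True
      then show ?thesis using block_sub[OF ij(1)] block_mem(1)[of "fst i" "snd i"] ij by (cases i) auto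
    next
      case False
      then obtain b where "b \<in> ?C" by blast
      then show ?thesis using eq block_sub[OF ij(1)] by blast
    qed
    then obtain b where "b \<in> BB" "?C \<subseteq> {b}" by blast
    moreover from this have "Sp ?C \<subseteq> Sp {b}" by (intro Sp_mono) auto
    ultimately show ?thesis using C by auto
  qed
  show "x = y" if ij: "i \<in> J" "j \<in> J" "i \<noteq> j" and xy: "x \<in> H i" "x \<in> H j" "y \<in> H i" "y \<in> H j" for i j x y
  proof -
    obtain b where b: "b \<in> BB" "H i \<inter> H j \<subseteq> Sp {b}" using meet[OF ij] by blast
    obtain z where "Sp {b} = {z}" using Sp_single[OF b(1)] by blast
    then have "H i \<inter> H j \<subseteq> {z}" using b(2) by simp
    then show ?thesis using xy by blast
  qed
  show "bij_betw (\<pi> j) (H j) (H j)" if "j \<in> J" for j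
  proof -
    obtain g t where j: "j = (g, t)" "g \<in> carrier G" "t \<le> n" using \<open>j \<in> J\<close> by auto
    have 1: "bij_betw (A (inv g)) (H j) (Sp (bb t))" "bij_betw (A g) (Sp (bb t)) (H j)"
      using j A_inv_H A_H_base A_inj H_P that Sp_bb_P
      by (auto simp: bij_betw_def inj_on_def subset_iff)
    have "bij_betw (A g \<circ> (\<rho> t \<circ> A (inv g))) (H j) (H j)"
      using 1 rigid[OF j(3)] unfolding rigid_def by (meson bij_betw_trans)
    then show ?thesis using j by (simp add: \<pi>_def comp_def)
  qed
  show "k + 2 * k * card (moved (\<pi> j) (H j)) < card (H j)" if "j \<in> J" for j
  proof -
    obtain g t where j: "j = (g, t)" "g \<in> carrier G" "t \<le> n" using \<open>j \<in> J\<close> by auto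
    have fin: "finite (moved (\<rho> t) (Sp (bb t)))"
      using Sp_bb_P[OF j(3)] finite_points by (auto intro: finite_subset)
    have "card (moved (\<pi> j) (H j)) \<le> card (moved (\<rho> t) (Sp (bb t)))"
      unfolding j(1) moved_eq[OF j(2,3)] by (rule card_image_le[OF fin])
    also have "\<dots> \<le> k * card (bb t)" using rigid[OF j(3)] by (simp add: rigid_def)
    finally have "2 * k * card (moved (\<pi> j) (H j)) \<le> 2 * k * (k * card (bb t))" by (rule mult_le_mono2)
    moreover have "k + 2 * k * (k * card (bb t)) < q ^ (card (bb t) - 1)"
      using d_small card_bb by simp
    moreover have "q ^ (card (bb t) - 1) \<le> card (H j)"
    proof -
      have "card (blk j) = card (bb t)" using card_block[OF j(2,3)] card_bb j(1) by simp
      moreover have "blk j \<noteq> {}" using block_mem(1)[OF j(2)] j(1) by auto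
      ultimately show ?thesis using Sp_card_ge[OF block_sub[OF that]] by (simp add: H_def)
    qed
    ultimately show ?thesis by linarith
  qed
  show "contains_triple (moved (\<pi> j) (H j))" if "j \<in> J" for j
  proof -
    obtain g t where j: "j = (g, t)" "g \<in> carrier G" "t \<le> n" using \<open>j \<in> J\<close> by auto
    have "contains_triple (moved (\<rho> t) (Sp (bb t)))" using rigid[OF j(3)] by (simp add: rigid_def)
    then obtain l a b c where l: "l \<in> L" "{a, b, c} \<subseteq> l \<inter> moved (\<rho> t) (Sp (bb t))" "a \<noteq> b" "a \<noteq> c" "b \<noteq> c"
      unfolding contains_triple_def by blast
    have "A g ` l \<in> L" using A_automorphism j l by (auto simp: automorphism_def)
    moreover have "{A g a, A g b, A g c} \<subseteq> A g ` l \<inter> moved (\<pi> j) (H j)"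
      unfolding j(1) moved_eq[OF j(2,3)] using l(2) by auto
    moreover have "a \<in> P" "b \<in> P" "c \<in> P" using l line_sub by auto
    then have "A g a \<noteq> A g b" "A g a \<noteq> A g c" "A g b \<noteq> A g c" using l(3-5) A_inj[OF j(2)] by auto
    ultimately show ?thesis unfolding contains_triple_def by blast
  qed
  \<comment> \<open>A point in two chosen subspaces is a base point, and a line contains at most two
    base points because the span of two of them misses all others.\<close>
  show "\<exists>x\<in>{a, b, c}. \<forall>i\<in>J. \<forall>j\<in>J. x \<in> H i \<longrightarrow> x \<in> H j \<longrightarrow> i = j"
    if l: "l \<in> L" "{a, b, c} \<subseteq> l" "a \<noteq> b" "a \<noteq> c" "b \<noteq> c" for l a b c
  proof (rule ccontr)
    assume n: "\<not> ?thesis"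
    have ex: "\<exists>u\<in>BB. x \<in> Sp {u}" if x: "x \<in> {a, b, c}" for x
    proof -
      obtain i j where "i \<in> J" "j \<in> J" "x \<in> H i" "x \<in> H j" "i \<noteq> j"
        using n x by meson
      then show ?thesis using meet[of i j] by blast
    qed
    obtain u where u: "u \<in> BB" "a \<in> Sp {u}" using ex[of a] by auto
    obtain v where v: "v \<in> BB" "b \<in> Sp {v}" using ex[of b] by auto
    obtain w where w: "w \<in> BB" "c \<in> Sp {w}" using ex[of c] by auto
    note uvw = u v w
    have "u \<noteq> w" "v \<noteq> w" using uvw Sp_single l by (metis singletonD)+
    have "a \<in> Sp {u, v}" "b \<in> Sp {u, v}"
      using uvw Sp_mono[of "{u}" "{u, v}"] Sp_mono[of "{v}" "{u, v}"] by auto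
    then have "c \<in> Sp {u, v}" using flatD[OF Sp_flat, of "{u, v}" l a b] l uvw by auto
    then have "c \<in> Sp ({u, v} \<inter> {w})" using Sp_Int[of "{u, v}" "{w}"] uvw by auto
    then show False using \<open>u \<noteq> w\<close> \<open>v \<noteq> w\<close> Sp_empty by auto
  qed
  show "k + 2 * card (\<Union>j\<in>J. H j) * kap < card P"
  proof -
    have "card (\<Union>j\<in>J. H j) \<le> (\<Sum>j\<in>J. card (H j))"
      using finite_carrier by (intro card_UN_le) auto
    also have "\<dots> \<le> (\<Sum>j\<in>J. q ^ (d + n + 2))"
      using card_H_le by (rule sum_mono)
    also have "\<dots> = n * Suc n * q ^ (d + n + 2)"
      by (simp add: card_cartesian_product)
    finally have "k + 2 * card (\<Union>j\<in>J. H j) * kap < q ^ (d + d + n - 1)"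
      using d_large by (meson add_le_mono le_less_trans mult_le_mono mult_le_mono1 mult_le_mono2 order_refl)
    also have "\<dots> \<le> q ^ (card BB - 1)"
      using q_bounds card_BB by (intro power_increasing) auto
    also have "\<dots> \<le> card P"
    proof -
      have "BB \<noteq> {}" using card_BB d_ge by auto
      then show ?thesis using Sp_card_ge[of BB] Sp_full by simp
    qed
    finally show ?thesis .
  qed
qed

lemma A_D:
  assumes g: "g \<in> carrier G" shows "automorphism P D (A g)"
proof -
  have "A g ` e \<in> D" if "e \<in> D" for e
    using that
  proof (rule D_cases)
    assume e: "e \<in> L" "\<And>j. j \<in> J \<Longrightarrow> \<not> e \<subseteq> H j"
    have "\<not> A g ` e \<subseteq> H j" if j: "j \<in> J" for j
    proof
      obtain g' t where gt: "j = (g', t)" "g' \<in> carrier G" "t \<le> n" using j by auto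
      assume "A g ` e \<subseteq> H j"
      then have "A (inv g) ` A g ` e \<subseteq> H (inv g \<otimes> g', t)"
        using A_H[of "inv g" g' t] gt g by blast
      moreover have "A (inv g) (A g x) = x" if "x \<in> e" for x
        using that line_sub[OF e(1)] g A_A A_one by auto
      ultimately have "e \<subseteq> H (inv g \<otimes> g', t)" by (auto simp: image_image)
      then show False using e(2) gt g by auto
    qed
    moreover have "A g ` e \<in> L" using A_automorphism[OF g] e by (simp add: automorphism_def)
    ultimately show ?thesis by (auto simp: D_def)
  next
    fix j l assume j: "j \<in> J" "l \<in> L" "l \<subseteq> H j" "e = \<pi> j ` l"
    obtain g' t where gt: "j = (g', t)" "g' \<in> carrier G" "t \<le> n" using j by auto
    have "A g ` e = (\<lambda>x. \<pi> (g \<otimes> g', t) (A g x)) ` l"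
      unfolding j(4) image_image using \<pi>_equivariant[OF g gt(2,3)] j(3) gt(1) by (intro image_cong) auto
    also have "\<dots> = \<pi> (g \<otimes> g', t) ` (A g ` l)" by (simp add: image_image)
    finally have "A g ` e = \<pi> (g \<otimes> g', t) ` (A g ` l)" .
    moreover have "A g ` l \<subseteq> H (g \<otimes> g', t)" using A_H[OF g gt(2,3)] j gt by blast
    moreover have "A g ` l \<in> L" using A_automorphism[OF g] j by (simp add: automorphism_def)
    moreover have "(g \<otimes> g', t) \<in> J" using g gt by simp
    ultimately show ?thesis unfolding D_def by blast
  qed
  then show ?thesis using A_automorphism[OF g] by (simp add: automorphism_def)
qed

text \<open>Conjugation by \<open>A g\<close> reduces to the block of the unit element, where
  \<open>commutes\<close> becomes commutation with \<open>\<rho> t\<close> and rigidity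
  applies.\<close>

lemma H_fixed:
  assumes f: "automorphism P D f" and j: "j \<in> J" and fH: "f ` H j = H j" and x: "x \<in> H j"
  shows "f x = x"
proof -
  obtain g t where gt: "j = (g, t)" "g \<in> carrier G" "t \<le> n" using j by auto
  define f' where "f' = A (inv g) \<circ> (f \<circ> A g)"
  have f': "automorphism P D f'"
    unfolding f'_def using f A_D gt by (intro automorphism_compose) auto
  have f'S: "f' ` Sp (bb t) = Sp (bb t)"
    unfolding f'_def image_comp[symmetric] using A_H_base[OF gt(2,3)] A_inv_H[OF gt(2,3)] fH gt(1) by simp
  have fP: "f y \<in> P" if "y \<in> P" for y using f that by (auto simp: automorphism_def bij_betw_def)
  have Af': "A g (f' y) = f (A g y)" if "y \<in> P" for y
    using that gt A_A[of g "inv g" "f (A g y)"] A_one A_P fP by (simp add: f'_def)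
  have comm: "f' (\<rho> t y) = \<rho> t (f' y)" if y: "y \<in> Sp (bb t)" for y
  proof -
    have yP: "y \<in> P" "\<rho> t y \<in> P" "f' y \<in> Sp (bb t)" using y \<rho>_mem[OF gt(3)] Sp_bb_P[OF gt(3)] f'S by auto
    have "A g y \<in> H j" using A_H_base[OF gt(2,3)] gt(1) y by blast
    then have "f (\<pi> j (A g y)) = \<pi> j (f (A g y))" by (rule commutes[OF f j fH])
    then have "f (A g (\<rho> t y)) = A g (\<rho> t (f' y))"
      using \<pi>_A[OF gt(2,3)] y yP Af'[of y] gt(1) by metis
    then have "A g (f' (\<rho> t y)) = A g (\<rho> t (f' y))" using Af' yP by simp
    moreover have "f' (\<rho> t y) \<in> P" "\<rho> t (f' y) \<in> P"
      using yP \<rho>_mem[OF gt(3)] Sp_bb_P[OF gt(3)] f' by (auto simp: automorphism_def bij_betw_def)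
    ultimately show ?thesis using A_inj[OF gt(2)] by blast
  qed
  have f'_id: "f' y = y" if "y \<in> Sp (bb t)" for y
    using rigid[OF gt(3)] automorphism_L[OF f'] f'S comm that unfolding rigid_def by blast
  obtain y where y: "y \<in> Sp (bb t)" "x = A g y" using A_H_base[OF gt(2,3)] gt(1) x by blast
  then show ?thesis using f'_id[OF y(1)] Af'[of y] Sp_bb_P[OF gt(3)] by auto
qed

text \<open>The number of points of \<open>Sp\<close> determines the size of the index set, and the
  sizes \<open>d + 1\<close> and \<open>d + t + 2\<close> are different for different types.\<close>

lemma image_H_type:
  assumes f: "automorphism P D f" and gt: "g \<in> carrier G" "t \<le> n"
  shows "\<exists>g'\<in>carrier G. f ` H (g, t) = H (g', t)"
proof -
  have j: "(g, t) \<in> J" using gt by simp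
  obtain i where i: "i \<in> J" "f ` H (g, t) = H i" using image_H[OF f j] .
  obtain g' t' where gt': "i = (g', t')" "g' \<in> carrier G" "t' \<le> n" using i by auto
  have "inj_on f (H (g, t))"
    using f H_P[OF j] by (auto simp: automorphism_def bij_betw_def intro: inj_on_subset)
  then have "card (H i) = card (H (g, t))" using i by (metis card_image)
  then have "\<not> card (blk i) < card (blk (g, t))" "\<not> card (blk (g, t)) < card (blk i)"
    using Sp_card_less block_sub[OF i(1)] block_sub[OF j] unfolding H_def by (metis less_irrefl)+
  then have "t = t'"
    using card_block[OF gt] card_block[OF gt'(2,3)] gt'(1) by (simp split: if_splits)
  then show ?thesis using i gt' by auto
qed

lemma Sp_single_inj: "\<lbrakk>b \<in> BB; c \<in> BB; Sp {b} = Sp {c}\<rbrakk> \<Longrightarrow> b = c"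
proof (rule ccontr)
  assume bc: "b \<in> BB" "c \<in> BB" "Sp {b} = Sp {c}" "b \<noteq> c"
  have "Sp {b} \<inter> Sp {c} = Sp ({b} \<inter> {c})" using bc by (intro Sp_Int) auto
  then show False using bc Sp_empty Sp_single[OF bc(1)] by auto
qed

text \<open>An automorphism permutes the blocks of each type, hence acts on indices by a map s; the blocks
  of type t > 0 force s (g * h t) = s g * h t, so that s is a left translation.\<close>

lemma automorphism_eq_A:
  assumes f: "automorphism P D f"
  obtains g where "g \<in> carrier G" "\<And>x. x \<in> P \<Longrightarrow> f x = A g x"
proof -
  obtain \<sigma> where \<sigma>: "\<And>g t. g \<in> carrier G \<Longrightarrow> t \<le> n \<Longrightarrow> \<sigma> g t \<in> carrier G \<and> f ` H (g, t) = H (\<sigma> g t, t)"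
    using image_H_type[OF f] by metis
  have fP: "f y \<in> P" if "y \<in> P" for y using f that by (auto simp: automorphism_def bij_betw_def)
  \<comment> \<open>The translation by \<open>c\<close> has the same effect on
    \<open>H (g, t)\<close> as a set; undoing it leaves an automorphism that fixes this subspace as
    a set and so pointwise.\<close>
  have on_H: "f x = A (\<sigma> g t \<otimes> inv g) x" if gt: "g \<in> carrier G" "t \<le> n" and x: "x \<in> H (g, t)" for g t x
  proof -
    define c where "c = \<sigma> g t \<otimes> inv g"
    have c: "c \<in> carrier G" "inv c \<otimes> \<sigma> g t = g"
      using \<sigma>[OF gt] gt by (auto simp: c_def inv_mult_group m_assoc)
    have "automorphism P D (A (inv c) \<circ> f)" using f A_D c by (intro automorphism_compose) auto
    moreover have "(A (inv c) \<circ> f) ` H (g, t) = H (g, t)"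
      unfolding image_comp[symmetric] using \<sigma>[OF gt] A_H[of "inv c" "\<sigma> g t" t] c gt by simp
    ultimately have "A (inv c) (f x) = x" using H_fixed[of _ "(g, t)" x] gt x by force
    then have "A c x = A c (A (inv c) (f x))" by simp
    also have "\<dots> = f x" using A_A[of c "inv c" "f x"] A_one c fP x H_P[of "(g, t)"] gt by auto
    finally show ?thesis by (simp add: c_def)
  qed
  have single: "f ` Sp {b} = Sp {tr (\<sigma> g t \<otimes> inv g) b}"
    if gt: "g \<in> carrier G" "t \<le> n" and b: "b \<in> blk (g, t)" for g t b
  proof -
    have j: "(g, t) \<in> J" using gt by simp
    have "Sp {b} \<subseteq> H (g, t)" unfolding H_def using b block_sub[OF j] by (intro Sp_mono) auto
    then have "f ` Sp {b} = A (\<sigma> g t \<otimes> inv g) ` Sp {b}" using on_H[OF gt] by (intro image_cong) auto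
    also have "\<dots> = Sp {tr (\<sigma> g t \<otimes> inv g) b}"
      using act_Sp[OF tr_bij, of "\<sigma> g t \<otimes> inv g" "{b}"] \<sigma>[OF gt] gt b block_sub[OF j] by auto
    finally show ?thesis .
  qed
  have mem0: "(x, 0, 0) \<in> BB" if "x \<in> carrier G" for x
    using block_mem(1)[OF that, of 0] block_sub[of "(x, 0)"] that by auto
  \<comment> \<open>With \<open>h t1\<close> the unit, the block \<open>(x, t1)\<close> contains
    \<open>(x, 0, 1)\<close>, which is therefore sent to \<open>(s x, 0, 1)\<close>. For
    \<open>x = g \<otimes> h t\<close> this is compared with the image obtained from the block
    \<open>(g, t)\<close>.\<close>
  obtain t1 where t1: "t1 \<noteq> 0" "t1 \<le> n" "h t1 = \<one>" using h_surj[OF one_closed] by blast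
  have mem1: "(x, 0, 1) \<in> BB" if "x \<in> carrier G" for x
    using block_mem(2)[OF that t1(1)] block_sub[of "(x, t1)"] that t1 by auto
  define s where "s g = \<sigma> g 0" for g
  have s: "s g \<in> carrier G" if "g \<in> carrier G" for g using \<sigma> that by (simp add: s_def)
  have f0: "f ` Sp {(g, 0, 0)} = Sp {(\<sigma> g t, 0, 0)}" if "g \<in> carrier G" "t \<le> n" for g t
    using single[OF that block_mem(1)[OF that(1)]] \<sigma>[OF that] that by (simp add: translate_def m_assoc)
  \<comment> \<open>All blocks \<open>(g, t)\<close> share the index \<open>(g, 0, 0)\<close>, whose
    image cannot depend on \<open>t\<close>.\<close>
  have \<sigma>s: "\<sigma> g t = s g" if "g \<in> carrier G" "t \<le> n" for g t
  proof -
    have "Sp {(\<sigma> g t, 0, 0)} = Sp {(s g, 0, 0)}" using f0[OF that] f0[of g 0] that by (simp add: s_def)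
    then show ?thesis using Sp_single_inj mem0 \<sigma>[OF that] s[OF that(1)] by blast
  qed
  have f1: "f ` Sp {(g \<otimes> h t, 0, 1)} = Sp {(s g \<otimes> h t, 0, 1)}" if "g \<in> carrier G" "t \<le> n" "t \<noteq> 0" for g t
    using single[OF that(1,2) block_mem(2)[OF that(1,3)]] \<sigma>s[OF that(1,2)] s[OF that(1)] that h_carrier
    by (simp add: translate_def m_assoc inv_solve_left' l_inv_ex m_assoc[symmetric])
  have s_mult: "s (g \<otimes> h t) = s g \<otimes> h t" if gt: "g \<in> carrier G" "t \<le> n" "t \<noteq> 0" for g t
  proof -
    have c: "g \<otimes> h t \<in> carrier G" "s g \<otimes> h t \<in> carrier G" using gt h_carrier s by auto
    have "f ` Sp {(g \<otimes> h t, 0, 1)} = Sp {(s (g \<otimes> h t), 0, 1)}"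
      using f1[OF c(1) t1(2,1)] t1(3) c(1) s by simp
    then have "Sp {(s (g \<otimes> h t), 0, 1)} = Sp {(s g \<otimes> h t, 0, 1)}" using f1[OF gt] by simp
    then show ?thesis using Sp_single_inj mem1 c s by blast
  qed
  have s_eq: "s x = s \<one> \<otimes> x" if x: "x \<in> carrier G" for x
  proof -
    obtain t where t: "t \<noteq> 0" "t \<le> n" "h t = x" using h_surj[OF x] by blast
    then show ?thesis using s_mult[OF one_closed t(2,1)] x by simp
  qed
  define c where "c = s \<one>"
  have c: "c \<in> carrier G" using s by (simp add: c_def)
  define f' where "f' = A (inv c) \<circ> f"
  have f'L: "automorphism P L f'"
    unfolding f'_def using automorphism_L[OF f] A_automorphism c by (intro automorphism_compose) auto
  have fixH: "f' x = x" if that: "j \<in> J" "x \<in> H j" for j x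
  proof -
    obtain g t where gt: "j = (g, t)" "g \<in> carrier G" "t \<le> n" using \<open>j \<in> J\<close> by auto
    have "\<sigma> g t \<otimes> inv g = c" using \<sigma>s[OF gt(2,3)] s_eq[OF gt(2)] gt(2) c by (simp add: c_def m_assoc)
    then have "f x = A c x" using on_H[OF gt(2,3)] that gt by simp
    then show ?thesis using A_A[of "inv c" c x] A_one c H_P[OF that(1)] that(2) by (auto simp: f'_def)
  qed
  \<comment> \<open>Spanning takes two rounds, each with a common base point: the blocks of the star
    \<open>St g\<close> share \<open>(g, 0, 0)\<close>, and all stars share
    \<open>(\<one>, 0, 1)\<close>, because some \<open>t\<close> has
    \<open>h t = inv g\<close>.\<close>
  define St where "St g = (\<Union>t\<in>{..n}. blk (g, t))" for g
  have fix_St: "f' x = x" if g: "g \<in> carrier G" and x: "x \<in> Sp (St g)" for g x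
    by (rule fixes_UN[OF f'L, of "{..n}" "\<lambda>t. blk (g, t)" "(g, 0, 0)"])
      (use g x fixH block_sub block_mem(1) in \<open>auto simp: St_def H_def\<close>)
  have St_mem: "(\<one>, 0, 1) \<in> St g" if g: "g \<in> carrier G" for g
  proof -
    obtain t where t: "t \<noteq> 0" "t \<le> n" "h t = inv g" using h_surj[of "inv g"] g by auto
    then show ?thesis using block_mem(2)[OF g t(1)] g by (auto simp: St_def)
  qed
  have f'_id: "f' x = x" if "x \<in> P" for x
  proof (rule fixes_UN[OF f'L finite_carrier])
    show "St g \<subseteq> BB" if "g \<in> carrier G" for g using block_sub that by (auto simp: St_def)
    have "BB = (\<Union>g\<in>carrier G. St g)" by (auto simp: block_points_def St_def)
    then show "x \<in> Sp (\<Union>g\<in>carrier G. St g)" using that Sp_full by simp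
  qed (use St_mem fix_St in auto)
  show thesis
  proof (rule that[OF c])
    fix x assume x: "x \<in> P"
    have "A c x = A c (A (inv c) (f x))" using f'_id[OF x] by (simp add: f'_def)
    then show "f x = A c x" using A_A[of c "inv c" "f x"] A_one c fP[OF x] by simp
  qed
qed

lemma design_Aut_iso: "design_Aut P D \<cong> G"
proof -
  define F where "F g = restrict (A g) P" for g
  have F_aut: "F g \<in> design_automorphisms P D" if "g \<in> carrier G" for g
  proof -
    have "automorphism P D (F g)"
      by (rule automorphism_cong[OF A_D[OF that]]) (use D.line_sub in \<open>auto simp: F_def\<close>)
    then show ?thesis by (auto simp: design_automorphisms_def automorphism_def Bij_def F_def)
  qed
  have "F \<in> iso G (design_Aut P D)"
  proof (rule isoI)
    show "F \<in> hom G (design_Aut P D)"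
    proof (rule homI)
      show "F g \<in> carrier (design_Aut P D)" if "g \<in> carrier G" for g
        using F_aut[OF that] by (simp add: design_Aut_def)
      show "F (g \<otimes> g') = F g \<otimes>\<^bsub>design_Aut P D\<^esub> F g'" if "g \<in> carrier G" "g' \<in> carrier G" for g g'
      proof -
        have "F (g \<otimes> g') = compose P (F g) (F g')"
          using that A_A A_P by (auto simp: F_def compose_def fun_eq_iff restrict_def)
        moreover have "F g \<in> Bij P" "F g' \<in> Bij P" using F_aut that by (auto simp: design_automorphisms_def)
        ultimately show ?thesis by (simp add: design_Aut_def BijGroup_def)
      qed
    qed
    show "bij_betw F (carrier G) (carrier (design_Aut P D))"
    proof (intro bij_betw_imageI)
      show "inj_on F (carrier G)"
      proof (rule inj_onI)
        fix g g' assume g: "g \<in> carrier G" "g' \<in> carrier G" "F g = F g'"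
        have b: "(\<one>, 0, 0) \<in> BB" using block_mem(1)[OF one_closed, of 0] block_sub[of "(\<one>, 0)"] by auto
        have img: "A u ` Sp {(\<one>, 0, 0)} = Sp {(u, 0, 0)}" if "u \<in> carrier G" for u
          using act_Sp[OF tr_bij[OF that], of "{(\<one>, 0, 0)}"] b that by (simp add: translate_def)
        have "A g x = A g' x" if "x \<in> P" for x using fun_cong[OF g(3), of x] that by (simp add: F_def)
        then have "A g ` Sp {(\<one>, 0, 0)} = A g' ` Sp {(\<one>, 0, 0)}"
          using Sp_sub[of "{(\<one>, 0, 0)}"] b by (intro image_cong) auto
        then have "Sp {(g, 0, 0)} = Sp {(g', 0, 0)}" using img g by simp
        moreover have "(u, 0, 0) \<in> BB" if "u \<in> carrier G" for u
          using block_mem(1)[OF that, of 0] block_sub[of "(u, 0)"] that by auto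
        ultimately show "g = g'" using Sp_single_inj g by blast
      qed
      show "F ` carrier G = carrier (design_Aut P D)"
      proof
        show "F ` carrier G \<subseteq> carrier (design_Aut P D)" using F_aut by (auto simp: design_Aut_def)
        show "carrier (design_Aut P D) \<subseteq> F ` carrier G"
        proof
          fix f assume "f \<in> carrier (design_Aut P D)"
          then have f: "f \<in> extensional P" "automorphism P D f"
            by (auto simp: design_Aut_def design_automorphisms_def automorphism_def Bij_def)
          obtain g where g: "g \<in> carrier G" "\<And>x. x \<in> P \<Longrightarrow> f x = A g x" using automorphism_eq_A[OF f(2)] by metis
          then have "f = F g" using f(1) by (auto simp: F_def fun_eq_iff extensional_def)
          then show "f \<in> F ` carrier G" using g by blast
        qed
      qed
    qed
  qed
  then have "G \<cong> design_Aut P D" by (auto simp: is_iso_def)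
  then show ?thesis by (rule iso_sym)
qed

end

section \<open>Projective and affine spaces over a finite field\<close>

text \<open>\<open>K\<close> is a field with \<open>q\<close> elements inside an ambient ring. Its
  unit element is called \<open>e\<close>, since it need not be a unit element of the ring. The
  bound \<open>4 \<le> q\<close> is what \<open>two_transversals\<close> requires in affine
  space.\<close>

locale coordinate_space =
  fixes K :: "'r::comm_ring set" and e :: 'r and q :: nat and B :: "'b set" and affine :: bool
  assumes K_closed: "0 \<in> K" "e \<in> K" "a \<in> K \<Longrightarrow> b \<in> K \<Longrightarrow> a + b \<in> K" "a \<in> K \<Longrightarrow> - a \<in> K" "a \<in> K \<Longrightarrow> b \<in> K \<Longrightarrow> a * b \<in> K"
    and K_one: "a \<in> K \<Longrightarrow> e * a = a" "e \<noteq> 0"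
    and K_inverse: "a \<in> K \<Longrightarrow> a \<noteq> 0 \<Longrightarrow> \<exists>b\<in>K. b * a = e"
    and K_finite: "finite K" and K_card: "card K = q"
    and B_finite: "finite B"
    and q_ge: "2 \<le> q" "affine \<Longrightarrow> 4 \<le> q"
begin

definition scale :: "'r \<Rightarrow> ('b \<Rightarrow> 'r) \<Rightarrow> 'b \<Rightarrow> 'r" (infixr "\<odot>" 75) where
  "c \<odot> w = (\<lambda>b. c * w b)"

definition supported :: "'b set \<Rightarrow> ('b \<Rightarrow> 'r) set" where
  "supported A = {w. \<forall>b. w b \<in> K \<and> (b \<notin> A \<longrightarrow> w b = 0)}"

abbreviation W where "W \<equiv> supported B"

text \<open>Z is the subspace at infinity: the points are the one-dimensional subspaces of W outside Z.\<close>

definition Z :: "('b \<Rightarrow> 'r) set" where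
  "Z = (if affine then {w \<in> W. sum w B = 0} else {0})"

definition subsp :: "('b \<Rightarrow> 'r) set \<Rightarrow> bool" where
  "subsp U \<longleftrightarrow> U \<subseteq> W \<and> 0 \<in> U \<and> (\<forall>u\<in>U. \<forall>v\<in>U. u + v \<in> U) \<and> (\<forall>c\<in>K. \<forall>u\<in>U. c \<odot> u \<in> U)"

definition ext :: "('b \<Rightarrow> 'r) set \<Rightarrow> ('b \<Rightarrow> 'r) \<Rightarrow> ('b \<Rightarrow> 'r) set" where
  "ext U w = {u + c \<odot> w | u c. u \<in> U \<and> c \<in> K}"

abbreviation ray where "ray w \<equiv> ext {0} w"

definition pts :: "('b \<Rightarrow> 'r) set \<Rightarrow> ('b \<Rightarrow> 'r) set set" where
  "pts T = {ray w | w. w \<in> T \<and> w \<notin> Z}"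

text \<open>The index is the vector space dimension, so lines are \<open>flats 2\<close> and planes
  \<open>flats 3\<close>. Recording it by the cardinality \<open>q ^ n\<close> replaces dimension
  theory by counting.\<close>

definition flats :: "nat \<Rightarrow> ('b \<Rightarrow> 'r) set set set" where
  "flats n = {pts T | T. subsp T \<and> card T = q ^ n \<and> \<not> T \<subseteq> Z}"

lemma Z_affine: "affine \<Longrightarrow> Z = {w \<in> W. sum w B = 0}"
  unfolding Z_def by simp

lemma Z_projective: "\<not> affine \<Longrightarrow> Z = {0}"
  unfolding Z_def by simp

lemma scale_simps:
  "c \<odot> (u + v) = c \<odot> u + c \<odot> v" "(c + d) \<odot> u = c \<odot> u + d \<odot> u" "c \<odot> 0 = 0" "0 \<odot> u = 0"
  "c \<odot> (d \<odot> u) = (c * d) \<odot> u" "(- c) \<odot> u = - (c \<odot> u)" "c \<odot> (- u) = - (c \<odot> u)"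
  "c \<odot> (u - v) = c \<odot> u - c \<odot> v" "(c - d) \<odot> u = c \<odot> u - d \<odot> u"
  by (auto simp: scale_def fun_eq_iff algebra_simps)

lemma scale_one: "u \<in> W \<Longrightarrow> e \<odot> u = u"
  by (auto simp: scale_def supported_def K_one)

lemma K_diff: "a \<in> K \<Longrightarrow> b \<in> K \<Longrightarrow> a - b \<in> K"
  using K_closed(3)[of a "- b"] K_closed(4) by simp

lemma subspD:
  assumes "subsp U"
  shows "u \<in> U \<Longrightarrow> u \<in> W" "0 \<in> U" "u \<in> U \<Longrightarrow> v \<in> U \<Longrightarrow> u + v \<in> U" "c \<in> K \<Longrightarrow> u \<in> U \<Longrightarrow> c \<odot> u \<in> U"
  using assms by (auto simp: subsp_def)

lemma subsp_uminus: "subsp U \<Longrightarrow> u \<in> U \<Longrightarrow> - u \<in> U"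
proof -
  assume U: "subsp U" "u \<in> U"
  have "(- e) \<odot> u \<in> U" using U K_closed by (intro subspD(4)) auto
  then show ?thesis using U scale_one subspD(1) by (simp add: scale_simps)
qed

lemma subsp_diff: "\<lbrakk>subsp U; u \<in> U; v \<in> U\<rbrakk> \<Longrightarrow> u - v \<in> U"
  using subspD(3)[of U u "- v"] subsp_uminus by simp

lemma scale_cancel: "\<lbrakk>subsp U; c \<in> K; c \<noteq> 0; u \<in> W; c \<odot> u \<in> U\<rbrakk> \<Longrightarrow> u \<in> U"
proof -
  assume *: "subsp U" "c \<in> K" "c \<noteq> 0" "u \<in> W" "c \<odot> u \<in> U"
  obtain d where "d \<in> K" "d * c = e" using K_inverse * by blast
  then have "u = d \<odot> (c \<odot> u)" using * by (simp add: scale_simps scale_one)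
  then show ?thesis using subspD(4)[OF *(1) \<open>d \<in> K\<close> *(5)] by simp
qed

lemma K_sum: "(\<And>x. x \<in> A \<Longrightarrow> f x \<in> K) \<Longrightarrow> sum f A \<in> K"
  by (induction A rule: infinite_finite_induct) (auto simp: K_closed)

lemma subsp_supported: "A \<subseteq> B \<Longrightarrow> subsp (supported A)"
  by (auto simp: subsp_def supported_def scale_def K_closed)

lemma subsp_W: "subsp W" by (simp add: subsp_supported)

lemma subsp_Z: "subsp Z"
proof (cases affine)
  case True
  have "sum (c \<odot> w) B = c * sum w B" for c w by (simp add: scale_def sum_distrib_left)
  then show ?thesis using subsp_W unfolding Z_affine[OF True]
    by (auto simp: subsp_def sum.distrib)
next
  case False
  then show ?thesis unfolding Z_projective[OF False]
    by (auto simp: subsp_def supported_def scale_simps K_closed)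
qed

lemma subsp_Int: "subsp U \<Longrightarrow> subsp V \<Longrightarrow> subsp (U \<inter> V)"
  by (auto simp: subsp_def)

lemma subsp_zero: "subsp {0}"
  by (auto simp: subsp_def supported_def K_closed scale_simps)

lemma finite_W: "finite W"
proof -
  have "finite {w. \<forall>x. (x \<in> B \<longrightarrow> w x \<in> K) \<and> (x \<notin> B \<longrightarrow> w x = 0)}"
    using B_finite K_finite by (rule finite_set_of_finite_funs)
  then show ?thesis by (rule finite_subset[rotated]) (auto simp: supported_def)
qed

lemma finite_subsp: "subsp U \<Longrightarrow> finite U"
  using finite_W by (auto simp: subsp_def intro: finite_subset)

lemma subsp_ext:
  assumes "subsp U" "w \<in> W" shows "subsp (ext U w)"
  unfolding subsp_def
proof (intro conjI ballI)
  show "ext U w \<subseteq> W" using assms subspD[OF subsp_W] by (auto simp: ext_def subspD(1))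
  show "0 \<in> ext U w" using subspD(2)[OF assms(1)] K_closed(1) by (force simp: ext_def scale_simps)
  fix u assume "u \<in> ext U w"
  then obtain x c where u: "u = x + c \<odot> w" "x \<in> U" "c \<in> K" by (auto simp: ext_def)
  show "a \<odot> u \<in> ext U w" if "a \<in> K" for a
  proof -
    have "a \<odot> u = a \<odot> x + (a * c) \<odot> w" using u by (simp add: scale_simps)
    then show ?thesis using that u subspD(4)[OF assms(1)] K_closed(5) unfolding ext_def by blast
  qed
  fix v assume "v \<in> ext U w"
  then obtain y d where v: "v = y + d \<odot> w" "y \<in> U" "d \<in> K" by (auto simp: ext_def)
  have "u + v = (x + y) + (c + d) \<odot> w" using u v by (simp add: scale_simps)
  then show "u + v \<in> ext U w" using u v subspD(3)[OF assms(1)] K_closed(3) unfolding ext_def by blast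
qed

lemma ext_sub: "U \<subseteq> ext U w"
  using K_closed(1) by (force simp: ext_def scale_simps)

lemma ext_mem: "subsp U \<Longrightarrow> w \<in> W \<Longrightarrow> w \<in> ext U w"
  using subspD(2) K_closed(2) scale_one by (force simp: ext_def)

lemma ext_min: "\<lbrakk>subsp V; U \<subseteq> V; w \<in> V\<rbrakk> \<Longrightarrow> ext U w \<subseteq> V"
  by (auto simp: ext_def intro!: subspD(3,4))

lemma card_ext:
  assumes U: "subsp U" and w: "w \<in> W" "w \<notin> U"
  shows "card (ext U w) = q * card U"
proof -
  have "inj_on (\<lambda>(u, c). u + c \<odot> w) (U \<times> K)"
  proof (rule inj_onI, clarify)
    fix u c v d assume *: "u \<in> U" "c \<in> K" "v \<in> U" "d \<in> K" "u + c \<odot> w = v + d \<odot> w"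
    have "(c - d) \<odot> w = v - u" using *(5) by (simp add: scale_simps algebra_simps)
    then have "(c - d) \<odot> w \<in> U" using subsp_diff[OF U] * by simp
    then have "c - d = 0" using scale_cancel[OF U K_diff[OF *(2,4)] _ w(1)] w(2) by blast
    then show "u = v \<and> c = d" using *(5) by simp
  qed
  moreover have "ext U w = (\<lambda>(u, c). u + c \<odot> w) ` (U \<times> K)" by (auto simp: ext_def)
  ultimately show ?thesis by (simp add: card_image card_cartesian_product K_card)
qed

lemma ray_subsp: "w \<in> W \<Longrightarrow> subsp (ray w)" by (intro subsp_ext subsp_zero)

lemma ray_mem: "w \<in> W \<Longrightarrow> w \<in> ray w" by (intro ext_mem subsp_zero)

lemma card_ray: "w \<in> W \<Longrightarrow> w \<noteq> 0 \<Longrightarrow> card (ray w) = q"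
  using card_ext[OF subsp_zero, of w] by simp

lemma ray_sub: "subsp U \<Longrightarrow> w \<in> U \<Longrightarrow> ray w \<subseteq> U"
  by (intro ext_min) (auto simp: subspD)

lemma subsp_eqI: "\<lbrakk>subsp V; U \<subseteq> V; card U = card V\<rbrakk> \<Longrightarrow> U = V"
  using finite_subsp by (metis card_subset_eq)

lemma zero_Z: "0 \<in> Z" using subsp_Z subspD(2) by blast

lemma ray_eq:
  assumes "w \<in> W" "v \<in> ray w" "v \<noteq> 0" shows "ray v = ray w"
proof -
  have v: "v \<in> W" using subspD(1)[OF ray_subsp] assms by blast
  have "w \<noteq> 0" using assms by (auto simp: ext_def scale_simps)
  then show ?thesis
    using ray_sub[OF ray_subsp] assms v card_ray by (intro subsp_eqI) (auto simp: ray_subsp)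
qed

lemma ray_in_pts:
  assumes "subsp T" "w \<in> W" "w \<notin> Z" shows "ray w \<in> pts T \<longleftrightarrow> w \<in> T"
proof
  assume "ray w \<in> pts T"
  then obtain v where v: "ray w = ray v" "v \<in> T" "v \<notin> Z" by (auto simp: pts_def)
  then show "w \<in> T" using ray_mem[OF assms(2)] ray_sub[OF assms(1) v(2)] by blast
qed (use assms in \<open>auto simp: pts_def\<close>)

lemma pts_mono: "T \<subseteq> U \<Longrightarrow> pts T \<subseteq> pts U"
  by (auto simp: pts_def)

lemma ptsE:
  assumes "x \<in> pts T" "subsp T" obtains w where "w \<in> T" "w \<in> W" "w \<notin> Z" "w \<noteq> 0" "x = ray w"
  using assms zero_Z subspD(1) unfolding pts_def by blast

lemma pts_Int: "subsp T \<Longrightarrow> subsp U \<Longrightarrow> pts T \<inter> pts U = pts (T \<inter> U)"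
proof -
  assume TU: "subsp T" "subsp U"
  have "x \<in> pts (T \<inter> U)" if x: "x \<in> pts T" "x \<in> pts U" for x
  proof -
    obtain w where w: "w \<in> T" "w \<in> W" "w \<notin> Z" "x = ray w" using x(1) TU(1) by (rule ptsE)
    then show ?thesis using ray_in_pts[OF TU(2) w(2,3)] x(2) by (auto simp: pts_def)
  qed
  then show ?thesis using pts_mono[of "T \<inter> U" T] pts_mono[of "T \<inter> U" U] by blast
qed

text \<open>The number of points of an \<open>n\<close>-dimensional subspace; in the projective case
  the sum is \<open>(q ^ n - 1) / (q - 1)\<close>.\<close>

definition N :: "nat \<Rightarrow> nat" where
  "N n = (if affine then q ^ (n - 1) else \<Sum>i<n. q ^ i)"

lemma N_eq: "0 < n \<Longrightarrow> N n * (q - 1) = q ^ n - (if affine then q ^ (n - 1) else 1)"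
proof -
  assume n: "0 < n"
  have "(\<Sum>i<n. q ^ i) * (q - 1) + 1 = q ^ n"
  proof (induction n)
    case (Suc n)
    have "q ^ n * (q - 1) + q ^ n = q ^ Suc n" using q_ge by (cases q) auto
    then show ?case using Suc by (simp add: algebra_simps)
  qed simp
  then show ?thesis using n by (cases n) (auto simp: N_def diff_mult_distrib2 mult.commute)
qed

text \<open>In the affine case the coordinate sum is a nonzero linear form on \<open>T\<close>, so
  \<open>T\<close> is its kernel extended by one vector \<open>u\<close>; in the projective case
  only the zero vector is at infinity.\<close>

lemma card_Int_Z:
  assumes "subsp T" "\<not> T \<subseteq> Z" "card T = q ^ n"
  shows "card (T \<inter> Z) = (if affine then q ^ (n - 1) else 1)" "0 < n"
proof -
  show n: "0 < n"
  proof (rule ccontr)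
    assume "\<not> 0 < n"
    then have "card T = 1" using assms by simp
    then obtain x where "T = {x}" by (rule card_1_singletonE)
    then have "T = {0}" using subspD(2)[OF assms(1)] by simp
    then show False using assms(2) zero_Z by simp
  qed
  show "card (T \<inter> Z) = (if affine then q ^ (n - 1) else 1)"
  proof (cases affine)
    case True
    obtain u where u: "u \<in> T" "u \<notin> Z" using assms by blast
    have uW: "u \<in> W" using u assms subspD(1) by blast
    have su: "sum u B \<in> K" "sum u B \<noteq> 0"
      using u uW unfolding Z_affine[OF True] by (auto simp: supported_def intro!: K_sum)
    obtain d where d: "d \<in> K" "d * sum u B = e" using K_inverse su by blast
    have sum_scale: "sum (c \<odot> w) B = c * sum w B" for c w by (simp add: scale_def sum_distrib_left)
    have "T = ext (T \<inter> Z) u"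
    proof
      show "T \<subseteq> ext (T \<inter> Z) u"
      proof
        fix w assume w: "w \<in> T"
        have wW: "w \<in> W" using w assms subspD(1) by blast
        have sw: "sum w B \<in> K" using wW by (intro K_sum) (auto simp: supported_def)
        define c where "c = sum w B * d"
        have c: "c \<in> K" using sw d K_closed by (simp add: c_def)
        have "c * sum u B = e * sum w B" using d(2) by (simp add: c_def mult.assoc mult.commute[of e])
        then have "c * sum u B = sum w B" using K_one(1)[OF sw] by simp
        then have "sum (w - c \<odot> u) B = 0" by (simp add: sum_subtractf sum_scale)
        moreover have "w - c \<odot> u \<in> T" using w u c assms subsp_diff subspD(4) by blast
        ultimately have "w - c \<odot> u \<in> T \<inter> Z"
          using subspD(1)[OF assms(1)] unfolding Z_affine[OF True] by auto
        moreover have "w = (w - c \<odot> u) + c \<odot> u" by simp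
        ultimately show "w \<in> ext (T \<inter> Z) u" using c unfolding ext_def by blast
      qed
    qed (use ext_min[OF assms(1)] u in auto)
    then have "q ^ n = q * card (T \<inter> Z)"
      using card_ext[OF subsp_Int[OF assms(1) subsp_Z] uW] u assms(3) by auto
    then have "q * q ^ (n - 1) = q * card (T \<inter> Z)" using n by (cases n) auto
    then show ?thesis using True q_ge by simp
  next
    case False
    then have "T \<inter> Z = {0}" using subspD(2)[OF assms(1)] Z_projective by blast
    then show ?thesis using False by simp
  qed
qed

text \<open>The vectors of \<open>T\<close> outside \<open>Z\<close> are partitioned by the points
  into punctured rays of \<open>q - 1\<close> vectors each.\<close>

lemma card_pts:
  assumes "subsp T" "\<not> T \<subseteq> Z" "card T = q ^ n"
  shows "card (pts T) = N n"
proof -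
  have fin: "finite T" "finite (pts T)" using finite_subsp[OF assms(1)] by (auto simp: pts_def)
  have sub: "p - {0} \<subseteq> T - Z" and cp: "card (p - {0}) = q - 1" if p: "p \<in> pts T" for p
  proof -
    obtain w where w: "w \<in> T" "w \<in> W" "w \<notin> Z" "w \<noteq> 0" "p = ray w" using ptsE[OF p assms(1)] .
    have "v \<notin> Z" if "v \<in> p" "v \<noteq> 0" for v
    proof
      assume "v \<in> Z"
      moreover have "ray v = ray w" using ray_eq w that by blast
      ultimately show False using ray_sub[OF subsp_Z, of v] ray_mem[OF w(2)] w(3) by blast
    qed
    then show "p - {0} \<subseteq> T - Z" using ray_sub[OF assms(1) w(1)] w by auto
    have "0 \<in> p" using subspD(2)[OF ray_subsp[OF w(2)]] w by simp
    then show "card (p - {0}) = q - 1" using card_ray w by simp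
  qed
  have "T - Z = (\<Union>p\<in>pts T. p - {0})"
  proof
    show "T - Z \<subseteq> (\<Union>p\<in>pts T. p - {0})"
    proof
      fix w assume w: "w \<in> T - Z"
      then have "w \<in> ray w - {0}" "ray w \<in> pts T"
        using zero_Z subspD(1)[OF assms(1)] by (auto simp: pts_def intro!: ray_mem)
      then show "w \<in> (\<Union>p\<in>pts T. p - {0})" by blast
    qed
  qed (use sub in blast)
  moreover have "card (\<Union>p\<in>pts T. p - {0}) = (\<Sum>p\<in>pts T. card (p - {0}))"
  proof (rule card_UN_disjoint)
    show "\<forall>p\<in>pts T. finite (p - {0})" using sub fin by (meson finite_Diff finite_subset)
    show "\<forall>p\<in>pts T. \<forall>r\<in>pts T. p \<noteq> r \<longrightarrow> (p - {0}) \<inter> (r - {0}) = {}"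
    proof (intro ballI impI, rule ccontr)
      fix p r assume pr: "p \<in> pts T" "r \<in> pts T" "p \<noteq> r" "(p - {0}) \<inter> (r - {0}) \<noteq> {}"
      obtain u where u: "u \<in> W" "p = ray u" using pr(1) assms(1) by (rule ptsE)
      obtain v where v: "v \<in> W" "r = ray v" using pr(2) assms(1) by (rule ptsE)
      obtain x where x: "x \<in> p" "x \<in> r" "x \<noteq> 0" using pr(4) by blast
      then show False using ray_eq[OF u(1), of x] ray_eq[OF v(1), of x] u v pr(3) by simp
    qed
  qed (use fin in simp)
  ultimately have "card (T - Z) = card (pts T) * (q - 1)" using cp by simp
  moreover have "card (T - Z) = q ^ n - card (T \<inter> Z)" using fin assms(3) by (simp add: card_Diff_subset_Int)
  ultimately have "card (pts T) * (q - 1) = N n * (q - 1)"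
    using card_Int_Z[OF assms] N_eq by simp
  then show ?thesis using q_ge by simp
qed

lemma N_values: "N 1 = 1" "N 2 = (if affine then q else q + 1)" "N 3 \<le> q ^ 3" "0 < n \<Longrightarrow> q ^ (n - 1) \<le> N n" "N n \<le> q ^ n"
proof -
  show "N 1 = 1" "N 2 = (if affine then q else q + 1)" by (auto simp: N_def numeral_2_eq_2)
  have le: "N n \<le> q ^ n" for n
  proof (cases "n = 0")
    case False
    then have "N n * 1 \<le> N n * (q - 1)" using q_ge by (intro mult_le_mono2) simp
    also have "\<dots> \<le> q ^ n" using N_eq[of n] False by simp
    finally show ?thesis by simp
  qed (auto simp: N_def)
  show "N 3 \<le> q ^ 3" "N n \<le> q ^ n" by (rule le)+
  show "0 < n \<Longrightarrow> q ^ (n - 1) \<le> N n"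
    by (cases n) (auto simp: N_def)
qed

lemma N_less: "0 < m \<Longrightarrow> m < n \<Longrightarrow> N m < N n"
proof -
  assume mn: "0 < m" "m < n"
  show "N m < N n"
  proof (cases affine)
    case True
    then have "N n = q ^ (n - 1)" for n unfolding N_def by simp
    then show ?thesis using mn q_ge by (auto intro!: power_strict_increasing)
  next
    case False
    have "(\<Sum>i<m. q ^ i) < (\<Sum>i<n. q ^ i)"
      using mn q_ge by (intro sum_strict_mono2) auto
    then show ?thesis unfolding N_def using False by simp
  qed
qed

lemma line_through:
  assumes "u \<in> W" "u \<notin> Z" "v \<in> W" "v \<notin> ray u"
  shows "subsp (ext (ray u) v)" "card (ext (ray u) v) = q ^ 2" "\<not> ext (ray u) v \<subseteq> Z" "pts (ext (ray u) v) \<in> flats 2"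
    "ray u \<in> pts (ext (ray u) v)" "v \<notin> Z \<Longrightarrow> ray v \<in> pts (ext (ray u) v)"
proof -
  have u0: "u \<noteq> 0" using assms zero_Z by auto
  show s: "subsp (ext (ray u) v)" using assms by (intro subsp_ext ray_subsp)
  show c: "card (ext (ray u) v) = q ^ 2"
    using card_ext[OF ray_subsp[OF assms(1)] assms(3,4)] card_ray[OF assms(1) u0] by (simp add: power2_eq_square)
  have uu: "u \<in> ext (ray u) v" using ext_sub ray_mem[OF assms(1)] by blast
  show z: "\<not> ext (ray u) v \<subseteq> Z" using uu assms by blast
  show "pts (ext (ray u) v) \<in> flats 2" using s c z by (auto simp: flats_def)
  show "ray u \<in> pts (ext (ray u) v)" using uu assms by (auto simp: pts_def)
  have "v \<in> ext (ray u) v" using assms ext_mem ray_subsp by blast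
  then show "ray v \<in> pts (ext (ray u) v)" if "v \<notin> Z" using that by (auto simp: pts_def)
qed

lemma line_span:
  assumes "subsp T" "card T = q ^ 2" "u \<in> T" "v \<in> T" "u \<notin> Z" "v \<notin> ray u"
  shows "T = ext (ray u) v"
  using assms line_through(2)[of u v] ext_min[OF assms(1) ray_sub[OF assms(1,3)] assms(4)] subspD(1)[OF assms(1)]
  by (metis subsp_eqI)

definition transversal :: "('b \<Rightarrow> 'r) set \<Rightarrow> ('b \<Rightarrow> 'r) set \<Rightarrow> ('b \<Rightarrow> 'r) \<Rightarrow> ('b \<Rightarrow> 'r) set set \<Rightarrow> bool" where
  "transversal U1 U2 z m \<longleftrightarrow> (\<exists>a\<in>m \<inter> pts U1. \<exists>b\<in>m \<inter> pts U2. a \<noteq> ray z \<and> b \<noteq> ray z \<and> a \<noteq> b)"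

text \<open>With c ranging over the scalars, the points t1 + c z and t2 - c z span different lines
  through w, and at most two values of c involve points at infinity.\<close>

lemma two_transversals:
  assumes U: "subsp U1" "subsp U2" and o: "z \<in> U1" "z \<in> U2" "z \<notin> Z"
    and t: "t1 \<in> U1" "t2 \<in> U2" "t1 + t2 \<notin> Z" "t1 + t2 \<notin> U1" "t1 + t2 \<notin> U2"
  obtains m m' where "m \<in> flats 2" "m' \<in> flats 2" "m \<noteq> m'" "ray (t1 + t2) \<in> m" "ray (t1 + t2) \<in> m'"
    "transversal U1 U2 z m" "transversal U1 U2 z m'"
proof -
  have W: "z \<in> W" "t1 \<in> W" "t2 \<in> W" using subspD(1)[OF U(1)] subspD(1)[OF U(2)] o t by auto
  have wW: "t1 + t2 \<in> W" using W subspD(3)[OF subsp_W] by blast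
  have t1U: "t1 \<notin> U2" using t U subspD(3) by blast
  have t2U: "t2 \<notin> U1" using t U subspD(3) by blast
  have zray: "ray z \<subseteq> U1" "ray z \<subseteq> U2" using ray_sub U o by auto
  define a b where "a c = t1 + c \<odot> z" and "b c = t2 - c \<odot> z" for c
  have aU: "a c \<in> U1" "a c \<in> W" "a c \<notin> U2" and bU: "b c \<in> U2" "b c \<in> W" "b c \<notin> U1" if c: "c \<in> K" for c
  proof -
    have cz: "c \<odot> z \<in> U1" "c \<odot> z \<in> U2" using subspD(4) U c o by auto
    show "a c \<in> U1" unfolding a_def using cz t U subspD(3) by blast
    then show "a c \<in> W" using subspD(1)[OF U(1)] by blast
    show "a c \<notin> U2" using subsp_diff[OF U(2) _ cz(2), of "a c"] t1U by (auto simp: a_def)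
    show "b c \<in> U2" unfolding b_def using cz t U subsp_diff by blast
    then show "b c \<in> W" using subspD(1)[OF U(2)] by blast
    show "b c \<notin> U1" using subspD(3)[OF U(1) _ cz(1), of "b c"] t2U by (auto simp: b_def)
  qed
  have b_ray: "b c \<notin> ray (a c)" if "c \<in> K" for c
    using aU(1)[OF that] bU(3)[OF that] ray_sub[OF U(1)] by blast
  define M where "M c = ext (ray (a c)) (b c)" for c
  define good where "good = {c \<in> K. a c \<notin> Z \<and> b c \<notin> Z}"
  have line: "subsp (M c)" "card (M c) = q ^ 2" "pts (M c) \<in> flats 2" "ray (a c) \<in> pts (M c)" "ray (b c) \<in> pts (M c)"
    "a c \<in> M c" "b c \<in> M c" "t1 + t2 \<in> M c" if c: "c \<in> good" for c
  proof -
    have c': "c \<in> K" "a c \<notin> Z" "b c \<notin> Z" using c by (auto simp: good_def)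
    note lt = line_through[OF aU(2)[OF c'(1)] c'(2) bU(2)[OF c'(1)] b_ray[OF c'(1)]]
    show s: "subsp (M c)" "card (M c) = q ^ 2" "pts (M c) \<in> flats 2" "ray (a c) \<in> pts (M c)" "ray (b c) \<in> pts (M c)"
      unfolding M_def using lt c' by auto
    show ab: "a c \<in> M c" "b c \<in> M c"
      using s(4,5) ray_in_pts[OF s(1)] aU(2)[OF c'(1)] bU(2)[OF c'(1)] c' by auto
    show "t1 + t2 \<in> M c" using subspD(3)[OF s(1) ab] by (simp add: a_def b_def)
  qed
  \<comment> \<open>Equal lines would contain \<open>(c - d) \<odot> z\<close>, hence
    \<open>z\<close> as well as \<open>a c\<close>. They would lie inside \<open>U1\<close>,
    although \<open>b c\<close> does not.\<close>
  have M_ne: "pts (M c) \<noteq> pts (M d)" if cd: "c \<in> good" "d \<in> good" "c \<noteq> d" for c d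
  proof
    assume eq: "pts (M c) = pts (M d)"
    have cdK: "c \<in> K" "d \<in> K" "a c \<notin> Z" "b c \<notin> Z" "a d \<notin> Z" using cd by (auto simp: good_def)
    have "a d \<in> M c" using line(4)[OF cd(2)] eq ray_in_pts[OF line(1)[OF cd(1)] aU(2)[OF cdK(2)] cdK(5)] by simp
    then have "a c - a d \<in> M c" using subsp_diff[OF line(1)[OF cd(1)] line(6)[OF cd(1)]] by simp
    then have "(c - d) \<odot> z \<in> M c" by (simp add: a_def scale_simps)
    then have zM: "z \<in> M c" using scale_cancel[OF line(1)[OF cd(1)] K_diff[OF cdK(1,2)]] cd(3) W by simp
    have "a c \<notin> ray z" using aU(3)[OF cdK(1)] zray by blast
    then have "M c = ext (ray z) (a c)"
      using line_span line(1,2,6)[OF cd(1)] zM o(3) by blast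
    also have "\<dots> \<subseteq> U1" using ext_min[OF U(1) zray(1) aU(1)[OF cdK(1)]] .
    finally show False using line(7)[OF cd(1)] bU(3)[OF cdK(1)] by blast
  qed
  have "2 \<le> card good"
  proof (cases affine)
    case False
    have "a c \<noteq> 0" "b c \<noteq> 0" if "c \<in> K" for c
      using aU(3)[OF that] bU(3)[OF that] subspD(2)[OF U(1)] subspD(2)[OF U(2)] by auto
    then have "good = K" unfolding good_def Z_projective[OF False] by auto
    then show ?thesis using K_card q_ge by simp
  next
    case True
    \<comment> \<open>Two such scalars would put a nonzero multiple of \<open>z\<close> at infinity.
      So \<open>a\<close> and \<open>b\<close> exclude at most one scalar each, and
      \<open>q - 2 \<ge> 2\<close> remain.\<close>
    have one: "card {c \<in> K. f c \<in> Z} \<le> 1" if f: "\<And>c d. f c - f d = (c - d) \<odot> z \<or> f c - f d = (d - c) \<odot> z" for f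
    proof -
      have "c = d" if cd: "c \<in> K" "d \<in> K" "f c \<in> Z" "f d \<in> Z" for c d
      proof (rule ccontr)
        assume "c \<noteq> d"
        have "f c - f d \<in> Z" using subsp_diff[OF subsp_Z] cd by blast
        then have "(c - d) \<odot> z \<in> Z \<or> (d - c) \<odot> z \<in> Z" using f[of c d] by auto
        then show False using scale_cancel[OF subsp_Z] K_diff cd W \<open>c \<noteq> d\<close> o(3) by (metis right_minus_eq)
      qed
      then show ?thesis using K_finite by (intro card_le_Suc0_iff_eq[THEN iffD2, unfolded One_nat_def[symmetric]]) auto
    qed
    have "card {c \<in> K. a c \<in> Z} \<le> 1" by (rule one) (auto simp: a_def scale_simps)
    moreover have "card {c \<in> K. b c \<in> Z} \<le> 1" by (rule one) (auto simp: b_def scale_simps)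
    moreover have "K = good \<union> ({c \<in> K. a c \<in> Z} \<union> {c \<in> K. b c \<in> Z})" by (auto simp: good_def)
    then have "card K \<le> card good + (card {c \<in> K. a c \<in> Z} + card {c \<in> K. b c \<in> Z})"
      by (metis (no_types, lifting) add_left_mono card_Un_le le_trans)
    ultimately show ?thesis using K_card q_ge(2)[OF True] by linarith
  qed
  moreover have "finite good" using K_finite by (simp add: good_def)
  ultimately obtain c d where cd: "c \<in> good" "d \<in> good" "c \<noteq> d"
    using card_le_Suc0_iff_eq[of good] by fastforce
  have props: "ray (t1 + t2) \<in> pts (M c)" "transversal U1 U2 z (pts (M c))" if c: "c \<in> good" for c
  proof -
    have c': "c \<in> K" "a c \<notin> Z" "b c \<notin> Z" using c by (auto simp: good_def)
    show "ray (t1 + t2) \<in> pts (M c)" using ray_in_pts[OF line(1)[OF c] wW t(3)] line(8)[OF c] by simp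
    have "ray (a c) \<in> pts U1" "ray (b c) \<in> pts U2" using aU bU c' by (auto simp: pts_def)
    moreover have "ray (a c) \<noteq> ray z" "ray (b c) \<noteq> ray z"
      using ray_mem[OF aU(2)[OF c'(1)]] ray_mem[OF bU(2)[OF c'(1)]] aU(3) bU(3) c' zray by blast+
    moreover have "ray (a c) \<noteq> ray (b c)" using b_ray[OF c'(1)] ray_mem[OF bU(2)[OF c'(1)]] by auto
    ultimately show "transversal U1 U2 z (pts (M c))" using line(4,5)[OF c] unfolding transversal_def by blast
  qed
  show thesis
    by (rule that[OF line(3)[OF cd(1)] line(3)[OF cd(2)] M_ne[OF cd] props(1)[OF cd(1)] props(1)[OF cd(2)]
          props(2)[OF cd(1)] props(2)[OF cd(2)]])
qed

lemma flatsI: "\<lbrakk>subsp T; card T = q ^ n; \<not> T \<subseteq> Z\<rbrakk> \<Longrightarrow> pts T \<in> flats n"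
  unfolding flats_def by blast

lemma flats_sub: "E \<in> flats n \<Longrightarrow> E \<subseteq> pts W"
proof -
  assume "E \<in> flats n"
  then obtain T where "subsp T" "E = pts T" by (auto simp: flats_def)
  then show ?thesis using pts_mono[of T W] by (simp add: subsp_def)
qed

lemma line_sub_of_two_points:
  assumes T: "subsp T" "card T = q ^ 2" and U: "subsp U"
    and xy: "x \<in> pts T" "y \<in> pts T" "x \<in> pts U" "y \<in> pts U" "x \<noteq> y"
  shows "T \<subseteq> U"
proof -
  obtain u where u: "u \<in> T" "u \<in> W" "u \<notin> Z" "x = ray u" using xy(1) T(1) by (rule ptsE)
  obtain v where v: "v \<in> T" "v \<in> W" "v \<notin> Z" "v \<noteq> 0" "y = ray v" using xy(2) T(1) by (rule ptsE)
  have "v \<notin> ray u" using ray_eq[OF u(2)] u v xy(5) by blast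
  then have "T = ext (ray u) v" using line_span[OF T] u v by blast
  moreover have "u \<in> U" "v \<in> U" using ray_in_pts[OF U] u v xy by blast+
  ultimately show ?thesis using ext_min[OF U ray_sub[OF U]] by blast
qed

lemma flats_linear_space: "linear_space (pts W) (flats 2) (N 2)"
proof
  show "finite (pts W)" using finite_W by (simp add: pts_def)
  show "3 \<le> N 2" using q_ge N_values(2) by auto
  show "l \<subseteq> pts W" if "l \<in> flats 2" for l
    using flats_sub that .
  show "card l = N 2" if "l \<in> flats 2" for l
    using that card_pts by (auto simp: flats_def)
  show "\<exists>l\<in>flats 2. x \<in> l \<and> y \<in> l" if xy: "x \<in> pts W" "y \<in> pts W" "x \<noteq> y" for x y
  proof -
    obtain u where u: "u \<in> W" "u \<notin> Z" "x = ray u" using xy(1) subsp_W by (rule ptsE)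
    obtain v where v: "v \<in> W" "v \<notin> Z" "v \<noteq> 0" "y = ray v" using xy(2) subsp_W by (rule ptsE)
    have "v \<notin> ray u" using ray_eq[OF u(1)] u v xy(3) by blast
    then show ?thesis using line_through[OF u(1,2) v(1)] u v by blast
  qed
  show "l = l'" if l: "l \<in> flats 2" "l' \<in> flats 2" "x \<in> l" "y \<in> l" "x \<in> l'" "y \<in> l'" "x \<noteq> y" for l l' x y
  proof -
    obtain T where T: "subsp T" "card T = q ^ 2" "l = pts T" using l by (auto simp: flats_def)
    obtain T' where T': "subsp T'" "card T' = q ^ 2" "l' = pts T'" using l by (auto simp: flats_def)
    have sub: "T \<subseteq> T'" using line_sub_of_two_points[OF T(1,2) T'(1)] l(3-7) unfolding T(3) T'(3) by blast
    then show ?thesis using subsp_eqI[OF T'(1) sub] T T' by simp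
  qed
qed

lemma pts_flat: "subsp U \<Longrightarrow> flat (flats 2) (pts U)"
proof (rule flatI)
  fix l x y assume U: "subsp U" and l: "l \<in> flats 2" "x \<in> l" "x \<in> pts U" "y \<in> l" "y \<in> pts U" "x \<noteq> y"
  obtain T where T: "subsp T" "card T = q ^ 2" "l = pts T" using l by (auto simp: flats_def)
  have "T \<subseteq> U" using line_sub_of_two_points[OF T(1,2) U] l(2-6) unfolding T(3) by blast
  then show "l \<subseteq> pts U" unfolding T(3) by (rule pts_mono)
qed

lemma line_in_subsp:
  assumes "subsp U" "subsp T" "card T = q ^ 2" "\<not> T \<subseteq> Z" "pts T \<subseteq> pts U"
  shows "T \<subseteq> U"
proof -
  interpret linear_space "pts W" "flats 2" "N 2" by (rule flats_linear_space)
  have l: "pts T \<in> flats 2" using assms by (intro flatsI)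
  obtain x where x: "x \<in> pts T" using line_third[OF l] by metis
  obtain y where y: "y \<in> pts T" "y \<noteq> x" using line_third[OF l] by metis
  then show ?thesis using line_sub_of_two_points[OF assms(2,3,1) x y(1)] x assms(5) by blast
qed

sublocale planar_space "pts W" "flats 2" "N 2" "flats 3" "N 3"
proof (rule planar_space.intro[OF flats_linear_space], unfold_locales)
  show "E \<subseteq> pts W" if "E \<in> flats 3" for E
    using flats_sub that .
  show "card E = N 3" if "E \<in> flats 3" for E
    using that card_pts by (auto simp: flats_def)
  show "flat (flats 2) E" if "E \<in> flats 3" for E
    using that pts_flat by (auto simp: flats_def)
  show "\<exists>E\<in>flats 3. l \<subseteq> E \<and> p \<in> E" if lp: "l \<in> flats 2" "p \<in> pts W" "p \<notin> l" for l p
  proof -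
    obtain T where T: "subsp T" "card T = q ^ 2" "\<not> T \<subseteq> Z" "l = pts T" using lp by (auto simp: flats_def)
    obtain w where w: "w \<in> W" "w \<notin> Z" "p = ray w" using lp(2) subsp_W by (rule ptsE)
    have "w \<notin> T" using lp(3) w T by (auto simp: pts_def)
    then have "card (ext T w) = q ^ 3" using card_ext[OF T(1) w(1)] T(2) by (simp add: power3_eq_cube power2_eq_square)
    moreover have "subsp (ext T w)" using T w by (intro subsp_ext)
    moreover have "\<not> ext T w \<subseteq> Z" using T(3) ext_sub by blast
    ultimately have "pts (ext T w) \<in> flats 3" by (intro flatsI)
    moreover have "p \<in> pts (ext T w)" using w ext_mem[OF T(1) w(1)] by (auto simp: pts_def)
    moreover have "l \<subseteq> pts (ext T w)" using T(4) pts_mono[OF ext_sub] by simp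
    ultimately show ?thesis by blast
  qed
  show "E = E'" if E: "E \<in> flats 3" "E' \<in> flats 3" "l \<in> flats 2" "l \<subseteq> E" "l \<subseteq> E'" "p \<in> E" "p \<in> E'" "p \<notin> l" for E E' l p
  proof -
    obtain T where T: "subsp T" "card T = q ^ 2" "\<not> T \<subseteq> Z" "l = pts T" using E by (auto simp: flats_def)
    have pW: "p \<in> pts W" using E(1,6) flats_sub by blast
    obtain w where w: "w \<in> W" "w \<notin> Z" "p = ray w" using pW subsp_W by (rule ptsE)
    have wT: "w \<notin> T" using E(8) w T by (auto simp: pts_def)
    have "V = ext T w" if V: "subsp V" "card V = q ^ 3" "l \<subseteq> pts V" "p \<in> pts V" for V
    proof -
      have "T \<subseteq> V" using line_in_subsp[OF V(1) T(1-3)] V T by simp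
      moreover have "w \<in> V" using ray_in_pts[OF V(1) w(1,2)] V w by simp
      ultimately have "ext T w \<subseteq> V" using ext_min V by blast
      moreover have "card (ext T w) = q ^ 3" using card_ext[OF T(1) w(1) wT] T(2) by (simp add: power3_eq_cube power2_eq_square)
      ultimately show ?thesis using subsp_eqI V by metis
    qed
    then show ?thesis using E by (auto simp: flats_def)
  qed
  fix E l l' z p assume E: "E \<in> flats 3" "l \<in> flats 2" "l' \<in> flats 2" "l \<subseteq> E" "l' \<subseteq> E" "l \<noteq> l'" "z \<in> l" "z \<in> l'"
    "p \<in> E" "p \<notin> l" "p \<notin> l'"
  obtain T where T: "subsp T" "card T = q ^ 2" "\<not> T \<subseteq> Z" "l = pts T" using E by (auto simp: flats_def)
  obtain T' where T': "subsp T'" "card T' = q ^ 2" "\<not> T' \<subseteq> Z" "l' = pts T'" using E by (auto simp: flats_def)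
  obtain V where V: "subsp V" "card V = q ^ 3" "E = pts V" using E by (auto simp: flats_def)
  have "z \<in> pts T" "p \<in> pts V" using E T V by auto
  obtain c0 where c0: "c0 \<in> T" "c0 \<in> W" "c0 \<notin> Z" "z = ray c0" using \<open>z \<in> pts T\<close> T(1) by (rule ptsE)
  obtain w where w: "w \<in> V" "w \<in> W" "w \<notin> Z" "p = ray w" using \<open>p \<in> pts V\<close> V(1) by (rule ptsE)
  have c0T': "c0 \<in> T'" using ray_in_pts[OF T'(1) c0(2,3)] c0 E T' by simp
  have TV: "T \<subseteq> V" "T' \<subseteq> V" using line_in_subsp[OF V(1)] T T' E V by auto
  have wT: "w \<notin> T" "w \<notin> T'" using E T T' w by (auto simp: pts_def)
  have "\<not> T' \<subseteq> T" using subsp_eqI[OF T(1)] T T' E(6) by metis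
  then obtain t' where t': "t' \<in> T'" "t' \<notin> T" by blast
  have t'W: "t' \<in> W" using t' T'(1) subspD(1) by blast
  have "card (ext T t') = q ^ 3" using card_ext[OF T(1) t'W t'(2)] T(2) by (simp add: power3_eq_cube power2_eq_square)
  moreover have "ext T t' \<subseteq> V" using ext_min[OF V(1) TV(1)] t' TV by blast
  ultimately have "V = ext T t'" using subsp_eqI V by metis
  \<comment> \<open>The plane is the sum of its two lines, so \<open>w\<close> splits into a vector
    of \<open>T\<close> and a vector of \<open>T'\<close>, as \<open>two_transversals\<close>
    demands.\<close>
  then obtain t1 c where t1: "t1 \<in> T" "c \<in> K" "w = t1 + c \<odot> t'" using w by (auto simp: ext_def)
  have ct: "c \<odot> t' \<in> T'" using subspD(4)[OF T'(1) t1(2) t'(1)] .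
  obtain m where "m \<in> flats 2" "ray (t1 + c \<odot> t') \<in> m" "transversal T T' c0 m"
    by (rule two_transversals[OF T(1) T'(1) c0(1) c0T' c0(3) t1(1) ct]) (use w wT t1(3) in auto)
  then show "\<exists>m\<in>flats 2. p \<in> m \<and> (\<exists>a b. a \<in> m \<and> a \<in> l \<and> a \<noteq> z \<and> b \<in> m \<and> b \<in> l' \<and> b \<noteq> z)"
    using w(4) t1(3) c0(4) T(4) T'(4) unfolding transversal_def by blast
qed

definition unit :: "'b \<Rightarrow> 'b \<Rightarrow> 'r" where "unit b = (\<lambda>x. if x = b then e else 0)"

lemma unit_supported: "b \<in> A \<Longrightarrow> unit b \<in> supported A"
  by (auto simp: unit_def supported_def K_closed)

lemma unit_not_Z: "b \<in> B \<Longrightarrow> unit b \<notin> Z"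
proof -
  assume b: "b \<in> B"
  have "sum (unit b) B = e" using b B_finite by (simp add: unit_def)
  moreover have "unit b \<noteq> 0" using K_one(2) by (auto simp: unit_def fun_eq_iff)
  ultimately show ?thesis using K_one(2) unfolding Z_def by auto
qed

lemma supported_insert: "b \<notin> A \<Longrightarrow> supported (insert b A) = ext (supported A) (unit b)"
proof
  assume b: "b \<notin> A"
  show "supported (insert b A) \<subseteq> ext (supported A) (unit b)"
  proof
    fix w assume w: "w \<in> supported (insert b A)"
    have "w = w(b := 0) + w b \<odot> unit b" using w K_one(1)[of "w b"]
      by (auto simp: fun_eq_iff scale_def unit_def supported_def mult.commute)
    moreover have "w(b := 0) \<in> supported A" "w b \<in> K" using w K_closed by (auto simp: supported_def)
    ultimately show "w \<in> ext (supported A) (unit b)" unfolding ext_def by blast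
  qed
  show "ext (supported A) (unit b) \<subseteq> supported (insert b A)"
    using K_closed by (auto simp: ext_def supported_def unit_def scale_def)
qed

lemma supported_empty: "supported {} = {0}"
  using K_closed by (auto simp: supported_def fun_eq_iff)

lemma card_supported: "A \<subseteq> B \<Longrightarrow> card (supported A) = q ^ card A"
proof -
  assume A: "A \<subseteq> B"
  have "finite A" using A B_finite by (rule finite_subset)
  then show ?thesis using A
  proof (induction A rule: finite_induct)
    case (insert b A)
    have "unit b \<notin> supported A" using insert(2) K_one(2) by (auto simp: supported_def unit_def)
    then show ?case
      using insert card_ext[OF subsp_supported, of A "unit b"] unit_supported[of b B] by (simp add: supported_insert)
  qed (simp add: supported_empty)
qed

lemma supported_not_Z: "A \<subseteq> B \<Longrightarrow> A \<noteq> {} \<Longrightarrow> \<not> supported A \<subseteq> Z"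
  using unit_supported unit_not_Z by blast

lemma card_Sp: "A \<subseteq> B \<Longrightarrow> A \<noteq> {} \<Longrightarrow> card (pts (supported A)) = N (card A)"
  using card_pts[OF subsp_supported supported_not_Z card_supported] by blast

lemma Sp_empty: "pts (supported {}) = {}"
  using zero_Z by (auto simp: pts_def supported_empty)

lemma card_pos: "A \<subseteq> B \<Longrightarrow> A \<noteq> {} \<Longrightarrow> 0 < card A"
  using B_finite by (meson card_gt_0_iff finite_subset)

sublocale framed_space "pts W" "flats 2" "N 2" "flats 3" "N 3" B "\<lambda>A. pts (supported A)" q
proof
  show "finite B" by (rule B_finite)
  show "pts (supported A) \<subseteq> pts W" if "A \<subseteq> B" for A
    using that by (intro pts_mono) (auto simp: supported_def)
  show "flat (flats 2) (pts (supported A))" if "A \<subseteq> B" for A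
    using pts_flat subsp_supported that by blast
  show "pts (supported A) \<inter> pts (supported C) = pts (supported (A \<inter> C))" if AC: "A \<subseteq> B" "C \<subseteq> B" for A C
  proof -
    have "supported A \<inter> supported C = supported (A \<inter> C)" by (auto simp: supported_def)
    then show ?thesis using pts_Int subsp_supported AC by simp
  qed
  show "pts (supported {}) = {}" by (rule Sp_empty)
  show "\<exists>x. pts (supported {b}) = {x}" if b: "b \<in> B" for b
    using card_Sp[of "{b}"] b N_values(1) by (simp add: card_1_singleton_iff)
  show "pts (supported {b, c}) \<in> flats 2" if bc: "b \<in> B" "c \<in> B" "b \<noteq> c" for b c
    using bc subsp_supported[of "{b, c}"] card_supported[of "{b, c}"] supported_not_Z[of "{b, c}"]
    by (intro flatsI) (auto simp: power2_eq_square)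
  show "q ^ (card A - 1) \<le> card (pts (supported A))" if A: "A \<subseteq> B" "A \<noteq> {}" for A
    using card_Sp[OF A] N_values(4)[of "card A"] card_pos[OF A] by simp
  show "card (pts (supported A)) \<le> q ^ card A" if A: "A \<subseteq> B" for A
    using card_Sp[OF A] N_values(5) Sp_empty by (cases "A = {}") auto
  show "card (pts (supported A)) < card (pts (supported C))" if A: "A \<subseteq> B" "C \<subseteq> B" "card A < card C" for A C
  proof -
    have C: "C \<noteq> {}" using A by auto
    have "1 \<le> card C" using A(3) by simp
    then have "0 < N (card C)" using N_less[of 1 "card C"] N_values(1) by (cases "card C = 1") auto
    then show ?thesis using card_Sp[OF A(2) C] card_Sp[OF A(1)] card_pos[OF A(1)] N_less A(3) Sp_empty
      by (cases "A = {}") auto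
  qed
  show "2 \<le> q" "N 3 \<le> q ^ 3" "N 2 \<le> q + 1" using q_ge N_values(2,3) by auto
  fix A C p assume AC: "A \<subseteq> B" "C \<subseteq> B" "A \<inter> C \<noteq> {}" and p: "p \<in> pts (supported (A \<union> C))" "p \<notin> pts (supported A)" "p \<notin> pts (supported C)"
  obtain b where b: "b \<in> A" "b \<in> C" using AC by blast
  have "subsp (supported (A \<union> C))" using AC by (intro subsp_supported) auto
  with p(1) obtain w where w: "w \<in> supported (A \<union> C)" "w \<in> W" "w \<notin> Z" "p = ray w" by (rule ptsE)
  \<comment> \<open>The vector is split by its coordinates inside and outside \<open>A\<close>; a
    common base point \<open>b\<close> takes the part of \<open>z\<close> in
    \<open>two_transversals\<close>.\<close>
  define t1 where "t1 = (\<lambda>x. if x \<in> A then w x else 0)"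
  define t2 where "t2 = (\<lambda>x. if x \<in> A then 0 else w x)"
  have t: "t1 \<in> supported A" "t2 \<in> supported C" "t1 + t2 = w"
    using w K_closed(1) by (auto simp: t1_def t2_def supported_def fun_eq_iff)
  have n: "w \<notin> supported A" "w \<notin> supported C" using p w by (auto simp: pts_def)
  obtain m m' where m: "m \<in> flats 2" "m' \<in> flats 2" "m \<noteq> m'" "ray (t1 + t2) \<in> m" "ray (t1 + t2) \<in> m'"
    "transversal (supported A) (supported C) (unit b) m" "transversal (supported A) (supported C) (unit b) m'"
    by (rule two_transversals[OF subsp_supported[OF AC(1)] subsp_supported[OF AC(2)] unit_supported[OF b(1)]
          unit_supported[OF b(2)] unit_not_Z t(1,2)]) (use t(3) w n AC b in auto)
  have two: "\<exists>x y. {x, y} \<subseteq> n \<inter> (pts (supported A) \<union> pts (supported C)) \<and> x \<noteq> y"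
    if "transversal (supported A) (supported C) (unit b) n" for n
    using that unfolding transversal_def by blast
  show "\<exists>m\<in>flats 2. \<exists>m'\<in>flats 2. m \<noteq> m' \<and> p \<in> m \<and> p \<in> m' \<and>
        (\<exists>x y. {x, y} \<subseteq> m \<inter> (pts (supported A) \<union> pts (supported C)) \<and> x \<noteq> y) \<and>
        (\<exists>x y. {x, y} \<subseteq> m' \<inter> (pts (supported A) \<union> pts (supported C)) \<and> x \<noteq> y)"
    by (intro bexI[of _ m] bexI[of _ m'] conjI) (use m two[OF m(6)] two[OF m(7)] w(4) t(3) in simp_all)
qed simp

text \<open>The inverse of \<open>u\<close> makes this a left action that takes the base point of
  \<open>b\<close> to that of \<open>u b\<close>.\<close>

definition mv :: "('b \<Rightarrow> 'b) \<Rightarrow> ('b \<Rightarrow> 'r) \<Rightarrow> 'b \<Rightarrow> 'r" where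
  "mv u w = (\<lambda>b. if b \<in> B then w (inv_into B u b) else 0)"

lemma mv_linear: "mv u (v + w) = mv u v + mv u w" "mv u (c \<odot> w) = c \<odot> mv u w" "mv u 0 = 0"
  by (auto simp: mv_def scale_def fun_eq_iff)

lemma mv_supported:
  assumes u: "bij_betw u B B" "A \<subseteq> B" "w \<in> supported A" shows "mv u w \<in> supported (u ` A)"
proof -
  have "w (inv_into B u b) = 0" if "b \<in> B" "b \<notin> u ` A" for b
  proof -
    have "u (inv_into B u b) = b" using that(1) u(1) by (simp add: bij_betw_inv_into_right)
    then have "inv_into B u b \<notin> A" using that(2) image_eqI[of b u "inv_into B u b" A] by auto
    then show ?thesis using u(3) by (simp add: supported_def)
  qed
  then show ?thesis using u K_closed(1) by (auto simp: mv_def supported_def bij_betw_def)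
qed

lemma mv_W: "bij_betw u B B \<Longrightarrow> w \<in> W \<Longrightarrow> mv u w \<in> W"
  using mv_supported[of u B w] by (simp add: bij_betw_def)

lemma mv_comp:
  assumes "bij_betw u B B" "bij_betw v B B" "\<And>b. b \<in> B \<Longrightarrow> w b = u (v b)"
  shows "mv u (mv v x) = mv w x"
proof -
  have "inv_into B v (inv_into B u b) = inv_into B w b" if b: "b \<in> B" for b
  proof -
    have "inv_into B u b \<in> B" "inv_into B v (inv_into B u b) \<in> B"
      using assms(1,2) b by (metis bij_betw_def inv_into_into)+
    moreover have "w (inv_into B v (inv_into B u b)) = b"
      using assms b calculation by (simp add: bij_betw_inv_into_right)
    moreover have "inj_on w B"
      using bij_betw_trans[OF assms(2,1)] assms(3) inj_on_cong[of B w "u \<circ> v"] by (simp add: bij_betw_def)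
    ultimately show ?thesis by (metis inv_into_f_f)
  qed
  moreover have "inv_into B u b \<in> B" if "b \<in> B" for b
    using assms(1) that by (metis bij_betw_def inv_into_into)
  ultimately show ?thesis by (auto simp: mv_def fun_eq_iff)
qed

lemma mv_id: "(\<And>b. b \<in> B \<Longrightarrow> u b = b) \<Longrightarrow> w \<in> W \<Longrightarrow> mv u w = w"
proof -
  assume u: "\<And>b. b \<in> B \<Longrightarrow> u b = b" and w: "w \<in> W"
  have "inv_into B u b = b" if "b \<in> B" for b
    using u that by (intro inv_into_f_eq) (auto simp: inj_on_def)
  then show ?thesis using w by (auto simp: mv_def supported_def fun_eq_iff)
qed

lemma mv_inverse:
  assumes u: "bij_betw u B B" "w \<in> W"
  shows "mv (inv_into B u) (mv u w) = w" "mv u (mv (inv_into B u) w) = w"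
proof -
  have v: "bij_betw (inv_into B u) B B" using u by (simp add: bij_betw_inv_into)
  have "mv (inv_into B u) (mv u w) = mv id w"
    using u v by (intro mv_comp) (auto simp: bij_betw_def)
  then show "mv (inv_into B u) (mv u w) = w" using mv_id u by simp
  have "mv u (mv (inv_into B u) w) = mv id w"
    using u v by (intro mv_comp) (auto simp: bij_betw_inv_into_right)
  then show "mv u (mv (inv_into B u) w) = w" using mv_id u by simp
qed

text \<open>Permuting coordinates does not change their sum. This is the reason for taking the sum
  as the equation of the hyperplane at infinity.\<close>

lemma mv_Z:
  assumes u: "bij_betw u B B" "w \<in> W" shows "mv u w \<in> Z \<longleftrightarrow> w \<in> Z"
proof -
  have "sum (mv u w) B = sum w B"
  proof -
    have "sum (mv u w) B = (\<Sum>b\<in>B. w (inv_into B u b))" by (simp add: mv_def)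
    also have "\<dots> = sum w B" using sum.reindex_bij_betw[OF bij_betw_inv_into[OF u(1)]] .
    finally show ?thesis .
  qed
  moreover have "mv u w = 0 \<longleftrightarrow> w = 0" using mv_inverse(1)[OF u] mv_linear(3) by metis
  ultimately show ?thesis using u mv_W unfolding Z_def by auto
qed

lemma mv_subsp: "bij_betw u B B \<Longrightarrow> subsp T \<Longrightarrow> subsp (mv u ` T)"
  unfolding subsp_def using mv_W mv_linear by (auto simp: image_iff subset_iff) metis+

lemma mv_ray: "mv u ` ray w = ray (mv u w)"
  by (auto simp: ext_def mv_linear image_iff) (metis mv_linear(2))

lemma mv_inj: "bij_betw u B B \<Longrightarrow> inj_on (mv u) W"
  using mv_inverse(1) by (metis inj_onI)

lemma mv_pts:
  assumes u: "bij_betw u B B" "subsp T" shows "image (mv u) ` pts T = pts (mv u ` T)"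
proof -
  have "mv u w \<notin> Z \<longleftrightarrow> w \<notin> Z" if "w \<in> T" for w using mv_Z[OF u(1)] subspD(1)[OF u(2) that] by blast
  then show ?thesis by (auto simp: pts_def mv_ray image_iff) (metis mv_ray)+
qed

lemma mv_image_supported:
  assumes u: "bij_betw u B B" "A \<subseteq> B" shows "mv u ` supported A = supported (u ` A)"
proof
  show "mv u ` supported A \<subseteq> supported (u ` A)" using mv_supported[OF u] by blast
  show "supported (u ` A) \<subseteq> mv u ` supported A"
  proof
    fix w assume w: "w \<in> supported (u ` A)"
    have uA: "u ` A \<subseteq> B" using u by (auto simp: bij_betw_def)
    have wW: "w \<in> W" using w uA by (auto simp: supported_def)
    have "inv_into B u ` u ` A = A" using u by (simp add: bij_betw_def inv_into_image_cancel)
    then have "mv (inv_into B u) w \<in> supported A"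
      using mv_supported[OF bij_betw_inv_into[OF u(1)] uA w] by simp
    then show "w \<in> mv u ` supported A" using mv_inverse(2)[OF u(1) wW] by (metis imageI)
  qed
qed

lemma mv_automorphism:
  assumes u: "bij_betw u B B" shows "automorphism (pts W) (flats 2) (image (mv u))"
proof -
  have "image (mv u) ` pts W = pts W"
    using mv_pts[OF u subsp_W] mv_image_supported[OF u order_refl] u by (simp add: bij_betw_def)
  moreover have "inj_on (image (mv u)) (pts W)"
  proof (rule inj_onI)
    fix x y assume xy: "x \<in> pts W" "y \<in> pts W" "mv u ` x = mv u ` y"
    have "x \<subseteq> W" "y \<subseteq> W" using xy ray_sub[OF subsp_W] by (auto simp: pts_def)
    then show "x = y" using xy(3) mv_inj[OF u] by (simp add: inj_on_image_eq_iff)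
  qed
  moreover have "image (mv u) ` l \<in> flats 2" if l: "l \<in> flats 2" for l
  proof -
    obtain T where T: "subsp T" "card T = q ^ 2" "\<not> T \<subseteq> Z" "l = pts T" using l by (auto simp: flats_def)
    have TW: "T \<subseteq> W" using T(1) by (simp add: subsp_def)
    have "card (mv u ` T) = q ^ 2" using T(2) mv_inj[OF u] TW by (metis card_image inj_on_subset)
    moreover have "\<not> mv u ` T \<subseteq> Z" using T(3) TW mv_Z[OF u] by blast
    ultimately show ?thesis using flatsI[OF mv_subsp[OF u T(1)]] mv_pts[OF u T(1)] T(4) by simp
  qed
  ultimately show ?thesis by (simp add: automorphism_def bij_betw_def)
qed

sublocale symmetric_framed_space "pts W" "flats 2" "N 2" "flats 3" "N 3" B "\<lambda>A. pts (supported A)" q "\<lambda>u. image (mv u)"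
proof
  show "automorphism (pts W) (flats 2) (image (mv u))" if "bij_betw u B B" for u
    using mv_automorphism that .
  show "image (mv u) ` pts (supported A) = pts (supported (u ` A))" if "bij_betw u B B" "A \<subseteq> B" for u A
    using mv_pts[OF that(1) subsp_supported[OF that(2)]] mv_image_supported[OF that] by simp
  show "mv u ` mv v ` x = mv w ` x" if "bij_betw u B B" "bij_betw v B B" "\<And>b. b \<in> B \<Longrightarrow> w b = u (v b)" for u v w x
    using mv_comp[OF that(1,2), of w] that(3) by (simp add: image_image)
  show "mv u ` x = x" if "\<And>b. b \<in> B \<Longrightarrow> u b = b" "x \<in> pts W" for u x
  proof -
    have "x \<subseteq> W" using that ray_sub[OF subsp_W] by (auto simp: pts_def)
    then have "mv u ` x = (\<lambda>w. w) ` x" using mv_id[of u] that(1) by (intro image_cong) auto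
    then show ?thesis by simp
  qed
qed

end

section \<open>Finite fields\<close>

text \<open>The order of the field is a variable, so it cannot be a type. This single ring type contains every
  field structure on 'a, namely as a factor of the product of all of them, and makes type-class
  arithmetic available. The factor of integers keeps the ring nontrivial if there is no such structure.\<close>

typedef 'a uring = "{(n :: int, f :: 'a ring \<Rightarrow> 'a). \<forall>R. if field R then f R \<in> carrier R else f R = undefined}"
  by (rule exI[of _ "(0, \<lambda>R. if field R then \<zero>\<^bsub>R\<^esub> else undefined)"])
    (auto intro: ring.ring_simprules(2) cring.axioms(1) domain.axioms(1) field.axioms(1))

setup_lifting type_definition_uring

lemma field_cring: "field R \<Longrightarrow> cring R"
  by (intro domain.axioms(1) field.axioms(1))

instantiation uring :: (type) comm_ring_1
begin

lift_definition zero_uring :: "'a uring" is "(0, \<lambda>R. if field R then \<zero>\<^bsub>R\<^esub> else undefined)"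
  by (auto intro: cring.cring_simprules(2) field_cring)

lift_definition one_uring :: "'a uring" is "(1, \<lambda>R. if field R then \<one>\<^bsub>R\<^esub> else undefined)"
  by (auto intro: cring.cring_simprules(6) field_cring)

lift_definition plus_uring :: "'a uring \<Rightarrow> 'a uring \<Rightarrow> 'a uring" is
  "\<lambda>(m, f) (n, g). (m + n, \<lambda>R. if field R then f R \<oplus>\<^bsub>R\<^esub> g R else undefined)"
  by (auto intro: cring.cring_simprules(1) field_cring split: if_splits) (metis cring.cring_simprules(1) field_cring)

lift_definition times_uring :: "'a uring \<Rightarrow> 'a uring \<Rightarrow> 'a uring" is
  "\<lambda>(m, f) (n, g). (m * n, \<lambda>R. if field R then f R \<otimes>\<^bsub>R\<^esub> g R else undefined)"
  by (auto intro: cring.cring_simprules(5) field_cring split: if_splits) (metis cring.cring_simprules(5) field_cring)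

lift_definition uminus_uring :: "'a uring \<Rightarrow> 'a uring" is
  "\<lambda>(m, f). (- m, \<lambda>R. if field R then \<ominus>\<^bsub>R\<^esub> f R else undefined)"
  by (auto intro: cring.cring_simprules(3) field_cring split: if_splits) (metis cring.cring_simprules(3) field_cring)

definition minus_uring :: "'a uring \<Rightarrow> 'a uring \<Rightarrow> 'a uring" where
  "minus_uring x y = x + - y"

instance
proof
  fix a b c :: "'a uring"
  note laws = cring.cring_simprules[OF field_cring]
  show "a + b + c = a + (b + c)"
    by transfer (auto simp: fun_eq_iff laws(7) split: if_splits)
  show "a + b = b + a"
    by transfer (auto simp: fun_eq_iff laws(10) split: if_splits)
  show "0 + a = a"
    by transfer (auto simp: fun_eq_iff laws split: if_splits; metis)
  show "- a + a = 0"
    by transfer (auto simp: fun_eq_iff laws split: if_splits)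
  show "a - b = a + - b" by (simp add: minus_uring_def)
  show "a * b * c = a * (b * c)"
    by transfer (auto simp: fun_eq_iff laws split: if_splits)
  show "a * b = b * a"
    by transfer (auto simp: fun_eq_iff laws split: if_splits)
  show "1 * a = a"
    by transfer (auto simp: fun_eq_iff laws(12) split: if_splits; metis)
  show "(a + b) * c = a * c + b * c"
    by transfer (auto simp: fun_eq_iff algebra_simps laws split: if_splits)
  show "(0 :: 'a uring) \<noteq> 1" by transfer simp
qed

end

text \<open>The factor belonging to \<open>R\<close> receives \<open>x\<close> and every other
  factor receives zero. Sums and products are preserved, but the unit of \<open>R\<close> goes to an
  idempotent different from \<open>1\<close>, which is the origin of \<open>e\<close>.\<close>

lift_definition emb :: "'a ring \<Rightarrow> 'a \<Rightarrow> 'a uring" is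
  "\<lambda>R x. (0, \<lambda>S. if field S then (if S = R \<and> x \<in> carrier R then x else \<zero>\<^bsub>S\<^esub>) else undefined)"
  by (auto intro: cring.cring_simprules(2) field_cring)

context
  fixes R :: "'a ring" (structure) assumes R: "field R"
begin

interpretation field R by (rule R)

lemma emb_add: "x \<in> carrier R \<Longrightarrow> y \<in> carrier R \<Longrightarrow> emb R (x \<oplus> y) = emb R x + emb R y"
  by transfer (auto simp: fun_eq_iff R cring.cring_simprules(1,2,8)[OF field_cring])

lemma emb_mult: "x \<in> carrier R \<Longrightarrow> y \<in> carrier R \<Longrightarrow> emb R (x \<otimes> y) = emb R x * emb R y"
  by transfer (auto simp: fun_eq_iff R cring.cring_simprules(2,5)[OF field_cring] cring.cring_simprules(26)[OF field_cring])

lemma emb_zero: "emb R \<zero> = 0"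
  by transfer (auto simp: fun_eq_iff)

lemma emb_inj: "inj_on (emb R) (carrier R)"
proof (rule inj_on_inverseI)
  fix x assume "x \<in> carrier R"
  then show "snd (Rep_uring (emb R x)) R = x" by (simp add: emb.rep_eq R)
qed

end

text \<open>The ambient ring has a factor of integers and hence not characteristic \<open>p\<close>,
  so the assumption concerns \<open>x\<close> alone. It suffices because every middle binomial term
  contains both \<open>p\<close> and \<open>x\<close> as factors.\<close>

lemma frobenius_add:
  fixes x y :: "'r::comm_ring_1"
  assumes p: "Factorial_Ring.prime p" and px: "of_nat p * x = 0"
  shows "(x + y) ^ p = x ^ p + y ^ p"
proof -
  have p1: "0 < p" using p by (simp add: prime_gt_0_nat)
  have "(x + y) ^ p = (\<Sum>k\<le>p. of_nat (p choose k) * x ^ k * y ^ (p - k))" by (rule binomial_ring)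
  also have "\<dots> = (\<Sum>k\<in>{0, p}. of_nat (p choose k) * x ^ k * y ^ (p - k))"
  proof (rule sum.mono_neutral_right)
    show "\<forall>k\<in>{..p} - {0, p}. of_nat (p choose k) * x ^ k * y ^ (p - k) = 0"
    proof
      fix k assume k: "k \<in> {..p} - {0, p}"
      then have "p dvd (p choose k)" using p by (intro dvd_choose_prime) auto
      then obtain m where m: "p choose k = p * m" by (rule dvdE)
      obtain k' where k': "k = Suc k'" using k by (cases k) auto
      have "of_nat (p choose k) = (of_nat p * of_nat m :: 'r)" unfolding m by simp
      moreover have "x ^ k = x * x ^ k'" unfolding k' by simp
      ultimately have "of_nat (p choose k) * x ^ k * y ^ (p - k) = (of_nat p * x) * (of_nat m * x ^ k' * y ^ (p - k))"
        by (simp only: mult_ac)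
      then show "of_nat (p choose k) * x ^ k * y ^ (p - k) = 0" using px by simp
    qed
  qed auto
  also have "\<dots> = x ^ p + y ^ p" using p1 by (simp add: add.commute)
  finally show ?thesis .
qed

lemma frobenius_iter_add:
  fixes x y :: "'r::comm_ring_1"
  assumes p: "Factorial_Ring.prime p" and px: "of_nat p * x = 0"
  shows "(x + y) ^ (p ^ n) = x ^ (p ^ n) + y ^ (p ^ n)"
proof (induction n)
  case (Suc n)
  have p0: "0 < p ^ n" using p by (simp add: prime_gt_0_nat)
  have "of_nat p * x ^ (p ^ n) = (of_nat p * x) * x ^ (p ^ n - 1)"
    using p0 by (cases "p ^ n") (auto simp: mult.assoc)
  then have "of_nat p * x ^ (p ^ n) = 0" using px by simp
  moreover have "z ^ (p ^ Suc n) = (z ^ (p ^ n)) ^ p" for z :: 'r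
    by (simp add: power_mult[symmetric] mult.commute)
  ultimately show ?case using Suc frobenius_add[OF p, of "x ^ (p ^ n)" "y ^ (p ^ n)"] by simp
qed simp

text \<open>With \<open>N\<close> elements every \<open>x\<close> would satisfy
  \<open>x [^] N = x\<close>, so the polynomial \<open>X^N - X + 1\<close> would take only the value
  one and have no root.\<close>

lemma (in algebraically_closed) infinite_carrier: "infinite (carrier L)"
proof
  assume fin: "finite (carrier L)"
  let ?U = "poly_ring L"
  interpret UP: domain ?U using univ_poly_is_domain[OF carrier_is_subring] .
  define N where "N = card (carrier L)"
  have "{\<zero>, \<one>} \<subseteq> carrier L" by auto
  then have N: "2 \<le> N" using card_mono[OF fin, of "{\<zero>, \<one>}"] by (simp add: N_def)
  interpret M: group "Multiplicative_Group.mult_of L" by (rule field_mult_group)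
  have "x [^] (N - 1) = \<one>" if "x \<in> carrier L" "x \<noteq> \<zero>" for x
    using M.pow_order_eq_1[of x] that fin
    by (simp add: order_mult_of order_def N_def Multiplicative_Group.nat_pow_mult_of)
  then have pow: "x [^] N = x" if "x \<in> carrier L" for x
  proof (cases "x = \<zero>")
    case False
    have "x [^] Suc (N - 1) = x"
      using \<open>\<And>x. x \<in> carrier L \<Longrightarrow> x \<noteq> \<zero> \<Longrightarrow> x [^] (N - 1) = \<one>\<close> that False by simp
    then show ?thesis using N by simp
  qed (use N in \<open>simp add: nat_pow_zero\<close>)
  define g where "g = poly_add (monom \<one> N) [\<ominus> \<one>, \<one>]"
  have c1: "monom \<one> N \<in> carrier ?U" using monom_is_polynomial[OF carrier_is_subring, of \<one> N] by (simp add: univ_poly_carrier)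
  have c2: "[\<ominus> \<one>, \<one>] \<in> carrier ?U" by (simp add: univ_poly_carrier[symmetric] polynomial_def)
  have g: "g \<in> carrier ?U" using UP.a_closed[OF c1 c2] by (simp add: g_def univ_poly_add)
  have "degree g = N"
    unfolding g_def using poly_add_degree_eq[OF carrier_is_subring c1[folded univ_poly_carrier] c2[folded univ_poly_carrier]] N
    by (simp add: monom_def)
  then have "size (roots g) = N" using roots_over_carrier[OF g] by (simp add: splitted_def)
  then have "roots g \<noteq> {#}" using N by auto
  then obtain x where x: "x \<in> carrier L" "eval g x = \<zero>"
    using roots_mem_iff_is_root[OF g] unfolding is_root_def by blast
  have "eval g x = eval (monom \<one> N) x \<oplus> eval [\<ominus> \<one>, \<one>] x"
    unfolding g_def using x c1 c2 by (intro eval_poly_add) (auto simp: monom_def)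
  also have "\<dots> = x \<oplus> (\<ominus> \<one> \<otimes> x \<oplus> \<one>)" using x pow eval_monom[of \<one> x N] by simp
  also have "\<dots> = \<one>" using x by algebra
  finally show False using x by simp
qed

text \<open>The fixed points are the roots of \<open>X^q - X\<close>, and the issue is that these
  are simple. Instead of a derivative, evaluation is used: if \<open>(X - x)^2\<close> divides with
  cofactor \<open>r\<close>, then for \<open>z = y - x\<close> additivity gives
  \<open>z^q - z = z^2 * r(y)\<close>.\<close>

lemma (in algebraically_closed) card_frobenius_fixed:
  assumes q: "2 \<le> q" and frob: "\<And>x y. x \<in> carrier L \<Longrightarrow> y \<in> carrier L \<Longrightarrow> (x \<ominus> y) [^] (q::nat) = x [^] q \<ominus> y [^] q"
  shows "card {x \<in> carrier L. x [^] q = x} = q"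
proof -
  let ?U = "poly_ring L"
  interpret UP: domain ?U using univ_poly_is_domain[OF carrier_is_subring] .
  define g where "g = poly_add (monom \<one> q) [\<ominus> \<one>, \<zero>]"
  have c1: "monom \<one> q \<in> carrier ?U" using monom_is_polynomial[OF carrier_is_subring, of \<one> q] by (simp add: univ_poly_carrier)
  have c2: "[\<ominus> \<one>, \<zero>] \<in> carrier ?U" by (simp add: univ_poly_carrier[symmetric] polynomial_def)
  have g: "g \<in> carrier ?U" using UP.a_closed[OF c1 c2] by (simp add: g_def univ_poly_add)
  have deg: "degree g = q"
    unfolding g_def using poly_add_degree_eq[OF carrier_is_subring c1[folded univ_poly_carrier] c2[folded univ_poly_carrier]] q
    by (simp add: monom_def)
  have ev: "eval g y = y [^] q \<ominus> y" if y: "y \<in> carrier L" for y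
  proof -
    have "eval g y = eval (monom \<one> q) y \<oplus> eval [\<ominus> \<one>, \<zero>] y"
      unfolding g_def using y c1 c2 by (intro eval_poly_add) (auto simp: monom_def)
    also have "\<dots> = y [^] q \<oplus> (\<ominus> \<one> \<otimes> y \<oplus> \<zero>)" using y eval_monom[of \<one> y q] by simp
    also have "\<dots> = y [^] q \<ominus> y" using y nat_pow_closed[OF y, of q] by algebra
    finally show ?thesis .
  qed
  have g0: "g \<noteq> []" using deg q by auto
  have root_iff: "is_root g x \<longleftrightarrow> x \<in> carrier L \<and> x [^] q = x" for x
    using ev g0 by (auto simp: is_root_def)
  have simple: "count (roots g) x \<le> 1" for x
  proof (rule ccontr)
    assume "\<not> ?thesis"
    then have m: "2 \<le> alg_mult g x" using alg_mult_eq_count_roots[OF g] by simp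
    then have "is_root g x" using alg_mult_gt_zero_iff_is_root[OF g, of x] by simp
    then have x: "x \<in> carrier L" "x [^] q = x" using root_iff by auto
    define lx where "lx = [\<one>, \<ominus> x]"
    have lx: "lx \<in> carrier ?U" using x by (simp add: lx_def univ_poly_carrier[symmetric] polynomial_def)
    have "(lx [^]\<^bsub>?U\<^esub> (2::nat)) pdivides g" unfolding lx_def using le_alg_mult_imp_pdivides[OF x(1) g m] .
    then obtain r where r: "r \<in> carrier ?U" "g = (lx [^]\<^bsub>?U\<^esub> (2::nat)) \<otimes>\<^bsub>?U\<^esub> r"
      unfolding pdivides_def by (rule dividesE)
    \<comment> \<open>Dividing by \<open>z \<noteq> 0\<close> gives
      \<open>z^(q-1) - 1 = z * r(y)\<close>, so \<open>t\<close> vanishes at all \<open>y\<close>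
      except \<open>x\<close>, where its value is one. A nonzero polynomial cannot have infinitely
      many roots.\<close>
    define t where "t = (lx \<otimes>\<^bsub>?U\<^esub> r) \<ominus>\<^bsub>?U\<^esub> (lx [^]\<^bsub>?U\<^esub> (q - 1)) \<oplus>\<^bsub>?U\<^esub> \<one>\<^bsub>?U\<^esub>"
    have t: "t \<in> carrier ?U" using lx r by (simp add: t_def)
    have "eval t y = (if y = x then \<one> else \<zero>)" if y: "y \<in> carrier L" for y
    proof -
      interpret ev: ring_hom_ring ?U L "\<lambda>p. eval p y" using eval_ring_hom[OF carrier_is_subring y] .
      have lxy: "eval lx y = y \<ominus> x" using x y by (simp add: lx_def) algebra
      define ry where "ry = eval r y"
      have ry: "ry \<in> carrier L" using ev.hom_closed r by (simp add: ry_def)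
      define z where "z = y \<ominus> x"
      have z: "z \<in> carrier L" using x y by (simp add: z_def)
      have pw: "eval (lx [^]\<^bsub>?U\<^esub> (n::nat)) y = z [^] n" for n
        using ev.hom_nat_pow[OF lx] lxy by (simp add: z_def)
      have "y [^] q \<ominus> y = z [^] (2::nat) \<otimes> ry"
        using ev[OF y] r lx pw by (simp add: ry_def)
      moreover have "y [^] q \<ominus> y = z [^] q \<ominus> z"
      proof -
        have "z [^] q = y [^] q \<ominus> x" using frob[OF y x(1)] x(2) by (simp add: z_def)
        moreover have "u \<ominus> y = (u \<ominus> x) \<ominus> z" if "u \<in> carrier L" for u
          unfolding z_def using x y that by algebra
        ultimately show ?thesis using nat_pow_closed[OF y, of q] by simp
      qed
      ultimately have "z [^] q \<ominus> z = z [^] (2::nat) \<otimes> ry" by simp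
      moreover define w where "w = z [^] (q - 1)"
      have "z [^] q = z \<otimes> w" using nat_pow_Suc2[OF z, of "q - 1"] q by (simp add: w_def)
      moreover have w: "w \<in> carrier L" using z by (simp add: w_def)
      moreover have "z [^] (2::nat) = z \<otimes> z" using z by (simp add: numeral_2_eq_2)
      ultimately have "z \<otimes> w \<ominus> z = z \<otimes> z \<otimes> ry" by simp
      moreover have "z \<otimes> w \<ominus> z = z \<otimes> (w \<ominus> \<one>)" "z \<otimes> z \<otimes> ry = z \<otimes> (z \<otimes> ry)" using z w ry by algebra+
      ultimately have "z \<otimes> (w \<ominus> \<one>) = z \<otimes> (z \<otimes> ry)" by simp
      then have zw: "w \<ominus> \<one> = z \<otimes> ry" if "z \<noteq> \<zero>" using that z w ry m_lcancel by simp
      have et: "eval t y = z \<otimes> ry \<ominus> w \<oplus> \<one>"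
        using lx r pw lxy unfolding t_def by (simp add: w_def ry_def z_def UP.minus_eq a_minus_def)
      show ?thesis
      proof (cases "y = x")
        case True
        then have "z = \<zero>" using x(1) by (simp add: z_def)
        moreover from this have "w = \<zero>" using q by (simp add: w_def nat_pow_zero)
        ultimately show ?thesis using et ry True by (simp add: a_minus_def)
      next
        case False
        then have "z \<noteq> \<zero>" using x y by (simp add: z_def)
        then have "eval t y = (w \<ominus> \<one>) \<ominus> w \<oplus> \<one>" using et zw by simp
        also have "\<dots> = \<zero>" using w by algebra
        finally show ?thesis using False by simp
      qed
    qed
    then have vals: "eval t x = \<one>" "\<And>y. y \<in> carrier L \<Longrightarrow> y \<noteq> x \<Longrightarrow> eval t y = \<zero>" using x by auto
    then have "t \<noteq> []" by auto
    then have "carrier L - {x} \<subseteq> {y. is_root t y}" using vals by (auto simp: is_root_def)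
    then have "finite (carrier L - {x})" using finite_number_of_roots[OF t] by (rule finite_subset)
    then show False using infinite_carrier by simp
  qed
  have "set_mset (roots g) = {x \<in> carrier L. x [^] q = x}"
    using roots_mem_iff_is_root[OF g] root_iff by auto
  moreover have "size (roots g) = card (set_mset (roots g))"
  proof -
    have "count (roots g) x = 1" if "x \<in># roots g" for x
      using simple[of x] count_greater_zero_iff[of "roots g" x] that by linarith
    then show ?thesis by (simp add: size_multiset_overloaded_eq)
  qed
  moreover have "size (roots g) = q" using roots_over_carrier[OF g] deg by (simp add: splitted_def)
  ultimately show ?thesis by simp
qed

section \<open>The theorem\<close>

definition finite_scalars :: "'r::comm_ring set \<Rightarrow> 'r \<Rightarrow> nat \<Rightarrow> bool" where
  "finite_scalars K e q \<longleftrightarrow> 0 \<in> K \<and> e \<in> K \<and> (\<forall>a\<in>K. \<forall>b\<in>K. a + b \<in> K \<and> a * b \<in> K) \<and> (\<forall>a\<in>K. - a \<in> K \<and> e * a = a) \<and>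
    e \<noteq> 0 \<and> (\<forall>a\<in>K. a \<noteq> 0 \<longrightarrow> (\<exists>b\<in>K. b * a = e)) \<and> finite K \<and> card K = q"

lemma coordinate_spaceI:
  "\<lbrakk>finite_scalars K e q; finite B; 2 \<le> q;
      (affine \<Longrightarrow> 4 \<le> q)\<rbrakk> \<Longrightarrow> coordinate_space K e q B affine"
  unfolding finite_scalars_def by unfold_locales auto

text \<open>The field of order \<open>q\<close> arises as the set of fixed points of the
  \<open>q\<close>-th power map. Sums are handled after embedding, where powers of ring elements and
  the binomial theorem of the type class apply; \<open>pe\<close> expresses characteristic
  \<open>p\<close> there.\<close>

lemma finite_scalars_frobenius_fixed:
  fixes A :: "'a ring" (structure)
  assumes A: "algebraically_closed A" and p: "Factorial_Ring.prime p" and n: "0 < n"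
    and pe: "of_nat p * emb A \<one> = 0"
  shows "finite_scalars (emb A ` {x \<in> carrier A. x [^] (p ^ n) = x}) (emb A \<one>) (p ^ n)"
proof -
  interpret A: algebraically_closed A by fact
  have fA: "field A" by (rule A.field_axioms)
  have p2: "2 \<le> p" using p by (rule prime_ge_2_nat)
  let ?q = "p ^ n"
  have p2: "2 \<le> p" using p by (rule prime_ge_2_nat)
  have q2: "2 \<le> ?q" using p2 n by (meson le_trans power_increasing[of 1 n p] power_one_right self_le_power one_le_numeral)
  define em where "em = emb A"
  define e where "e = em \<one>"
  note em_add = emb_add[OF fA, folded em_def] and em_mult = emb_mult[OF fA, folded em_def]
    and em_zero = emb_zero[OF fA, folded em_def] and em_inj = emb_inj[OF fA, folded em_def]
  have em_eq: "em x = em y \<longleftrightarrow> x = y" if "x \<in> carrier A" "y \<in> carrier A" for x y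
    using em_inj that by (auto dest: inj_onD)
  have e_mult: "e * em x = em x" if "x \<in> carrier A" for x
    using that em_mult[of "\<one>" x] by (simp add: e_def)
  have px: "of_nat p * em x = 0" if "x \<in> carrier A" for x
    using pe e_mult[OF that] by (metis e_def em_def mult.assoc mult_zero_left)
  have em_pow: "em (x [^] Suc m) = em x ^ Suc m" if x: "x \<in> carrier A" for x m
    by (induction m) (use x in \<open>auto simp: em_mult mult.commute\<close>)
  have em_q: "em (x [^] ?q) = em x ^ ?q" if "x \<in> carrier A" for x
  proof -
    have "Suc (?q - 1) = ?q" using q2 by simp
    then show ?thesis using em_pow[OF that, of "?q - 1"] by (simp only:)
  qed
  have frob: "(x \<ominus> y) [^] ?q = x [^] ?q \<ominus> y [^] ?q" if xy: "x \<in> carrier A" "y \<in> carrier A" for x y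
  proof -
    let ?z = "x \<ominus> y"
    have z: "?z \<in> carrier A" using xy by simp
    have zy: "?z \<oplus> y = x" using xy A.add.inv_solve_right' by (simp add: A.minus_eq A.a_assoc A.l_neg)
    have "em (?z [^] ?q \<oplus> y [^] ?q) = em ?z ^ ?q + em y ^ ?q"
      using z xy em_add em_q by simp
    also have "\<dots> = (em ?z + em y) ^ ?q" using frobenius_iter_add[OF p px[OF z]] by simp
    also have "\<dots> = em (x [^] ?q)" using em_add[OF z xy(2)] zy em_q xy by simp
    finally have "?z [^] ?q \<oplus> y [^] ?q = x [^] ?q" using em_eq z xy by simp
    moreover have "u = (u \<oplus> v) \<ominus> v" if "u \<in> carrier A" "v \<in> carrier A" for u v
      using that by (simp add: A.minus_eq A.a_assoc A.r_neg)
    ultimately show ?thesis using z xy A.nat_pow_closed by metis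
  qed
  define K0 where "K0 = {x \<in> carrier A. x [^] ?q = x}"
  have cK0: "card K0 = ?q" unfolding K0_def by (rule A.card_frobenius_fixed[OF q2 frob])
  have KI: "em x \<in> em ` K0" if "x \<in> carrier A" "em x ^ ?q = em x" for x
  proof -
    have "x [^] ?q = x" using em_q[OF that(1)] em_eq[of "x [^] ?q" x] that by simp
    then show ?thesis using that(1) by (simp add: K0_def)
  qed
  have KE: "\<exists>x\<in>carrier A. u = em x \<and> em x ^ ?q = em x" if "u \<in> em ` K0" for u
    using that em_q by (auto simp: K0_def) metis
  have "finite_scalars (em ` K0) e ?q"
    unfolding finite_scalars_def
  proof (intro conjI ballI impI)
    show "0 \<in> em ` K0" using KI[of "\<zero>"] em_zero zero_power[of ?q] p2 by simp
    show eK: "e \<in> em ` K0" using em_q[of "\<one>"] KI[of "\<one>"] by (simp add: e_def)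
    show "e \<noteq> 0" using em_eq[of "\<one>" "\<zero>"] em_zero by (simp add: e_def)
    show "finite (em ` K0)" using cK0 q2 by (intro finite_imageI) (metis card.infinite not_numeral_le_zero)
    show "card (em ` K0) = ?q" using cK0 em_inj by (simp add: card_image inj_on_subset K0_def)
    fix u assume u: "u \<in> em ` K0"
    obtain x where x: "x \<in> carrier A" "u = em x" "em x ^ ?q = em x" using KE[OF u] by blast
    have xm: "em (\<ominus> x) = - em x" using em_add[of x "\<ominus> x"] x em_zero by (simp add: A.r_neg eq_neg_iff_add_eq_0 add.commute)
    have "(- em x) ^ ?q + em x ^ ?q = (- em x + em x) ^ ?q"
      using frobenius_iter_add[OF p, of "- em x" "em x" n] px[OF x(1)] by simp
    then have "(- em x) ^ ?q = - em x" using x p2 zero_power[of ?q] by (simp add: eq_neg_iff_add_eq_0)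
    then show "- u \<in> em ` K0" using KI[of "\<ominus> x"] x xm by simp
    show "e * u = u" using e_mult x by simp
    show "\<exists>b\<in>em ` K0. b * u = e" if "u \<noteq> 0"
    proof -
      have x0: "x \<noteq> \<zero>" using that x em_zero by auto
      define y where "y = inv x"
      have y: "y \<in> carrier A" "y \<otimes> x = \<one>" using A.field_Units x x0 by (auto simp: y_def)
      then have yx: "em y * em x = e" using em_mult x by (metis e_def)
      have "em y ^ ?q * em x = em y ^ ?q * em x ^ ?q" by (simp only: x(3))
      also have "\<dots> = e ^ ?q" by (simp only: power_mult_distrib[symmetric] yx)
      also have "\<dots> = e" using em_q[of "\<one>"] by (simp add: e_def)
      finally have "em y ^ ?q * em x = e" .
      then have "em y ^ ?q * em x * em y = em y" using e_mult y by simp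
      moreover have "em y ^ ?q * em x * em y = (em y * em x) * em y ^ ?q" by (simp only: mult_ac)
      then have "em y ^ ?q * em x * em y = em y ^ ?q"
        using e_mult[of "y [^] ?q"] em_q[OF y(1)] y(1) by (simp only: yx) simp
      ultimately have "em y \<in> em ` K0" using KI y by simp
      then show ?thesis using yx x by blast
    qed
    fix v assume v: "v \<in> em ` K0"
    obtain y where y: "y \<in> carrier A" "v = em y" "em y ^ ?q = em y" using KE[OF v] by blast
    have "(em x + em y) ^ ?q = em x + em y" using frobenius_iter_add[OF p px[OF x(1)]] x y by simp
    then show "u + v \<in> em ` K0" using KI[of "x \<oplus> y"] em_add x y by simp
    have "(em x * em y) ^ ?q = em x * em y" using x y by (simp add: power_mult_distrib)
    then show "u * v \<in> em ` K0" using KI[of "x \<otimes> y"] em_mult x y by simp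
  qed
  then show ?thesis by (simp add: K0_def em_def e_def)
qed

text \<open>The algebraic closure of the integers modulo \<open>p\<close> is used, and the type in
  the statement is that of its elements. The multiple \<open>m * e\<close> is the image of
  \<open>m mod p\<close>, so \<open>p * e = 0\<close>.\<close>

lemma finite_scalars_exist:
  assumes p: "Factorial_Ring.prime p" and n: "0 < n"
  shows "\<exists>(K :: ((int list \<times> nat) multiset \<Rightarrow> int) uring set) e. finite_scalars K e (p ^ n)"
proof -
  define F where "F = residue_ring (int p)"
  interpret F: residues_prime p F using p by (unfold_locales) (simp_all add: F_def)
  define A where "A = F.alg_closure"
  interpret A: algebraic_closure A "F.indexed_const ` carrier F" unfolding A_def by (rule F.alg_closureE(1))
  have hom: "F.indexed_const \<in> ring_hom F A" unfolding A_def by (rule F.alg_closureE(2))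
  have p2: "2 \<le> p" using p by (rule prime_ge_2_nat)
  note em_add = emb_add[OF A.field_axioms] and em_zero = emb_zero[OF A.field_axioms]
  define e where "e = emb A \<one>\<^bsub>A\<^esub>"
  have of_nat_e: "of_nat m * e = emb A (F.indexed_const (int m mod int p))" for m
  proof (induction m)
    case 0
    have "F.indexed_const \<zero>\<^bsub>F\<^esub> = \<zero>\<^bsub>A\<^esub>" using ring_hom_zero[OF hom F.ring_axioms A.ring_axioms] .
    then show ?case using em_zero by (simp add: F.res_zero_eq)
  next
    case (Suc m)
    have c: "int m mod int p \<in> carrier F" "1 \<in> carrier F" using p2 by (auto simp: F.res_carrier_eq)
    have "of_nat (Suc m) * e = emb A (F.indexed_const (int m mod int p)) + emb A (F.indexed_const 1)"
      using Suc ring_hom_one[OF hom] by (simp add: algebra_simps F.res_one_eq e_def)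
    also have "\<dots> = emb A (F.indexed_const (int m mod int p \<oplus>\<^bsub>F\<^esub> 1))"
      using em_add ring_hom_add[OF hom c] ring_hom_closed[OF hom] c by simp
    also have "int m mod int p \<oplus>\<^bsub>F\<^esub> 1 = int (Suc m) mod int p"
      by (simp add: F.res_add_eq mod_simps add.commute)
    finally show ?case .
  qed
  have "of_nat p * e = emb A (F.indexed_const 0)" using of_nat_e[of p] by simp
  also have "\<dots> = 0" using of_nat_e[of 0] by simp
  finally have pe: "of_nat p * e = 0" .
  show ?thesis
    using finite_scalars_frobenius_fixed[OF A.algebraically_closed_axioms p n] pe unfolding e_def by blast
qed

text \<open>The bound \<open>(q + 1)^2 \<le> q^4\<close> disposes of the polynomial in
  \<open>q\<close>; what is left is \<open>1 + 2 * c < 2 ^ (c - 5)\<close>, which holds for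
  \<open>12 \<le> c\<close>.\<close>

lemma power_dominates_square:
  assumes "2 \<le> (q::nat)" "12 \<le> c"
  shows "q + 1 + 2 * (q + 1) * ((q + 1) * c) < q ^ (c - 1)"
proof -
  have "1 + 2 * c < 2 ^ (c - 5)" using assms(2)
  proof (induction c rule: dec_induct)
    case (step m)
    then have "Suc m - 5 = Suc (m - 5)" by linarith
    then have eq: "2 ^ (Suc m - 5) = 2 * (2::nat) ^ (m - 5)" by (simp only: power_Suc)
    have "1 + 2 * Suc m < 2 * y" if "1 + 2 * m < y" for y using that step(1) by presburger
    from this[OF step(3)] have "1 + 2 * Suc m < 2 * (2::nat) ^ (m - 5)" .
    then show ?case by (simp only: eq)
  qed simp
  also have "\<dots> \<le> q ^ (c - 5)" using assms by (intro power_mono) auto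
  finally have 1: "1 + 2 * c < q ^ (c - 5)" .
  have "(q + 1) * (q + 1) \<le> q ^ 4"
  proof -
    have "q + 1 \<le> q * q" using assms(1) mult_le_mono1[OF assms(1), of q] by linarith
    then have "(q + 1) * (q + 1) \<le> (q * q) * (q * q)" by (rule mult_le_mono) fact
    then show ?thesis by (simp add: power4_eq_xxxx mult.assoc)
  qed
  have "q + 1 + 2 * (q + 1) * ((q + 1) * c) \<le> (q + 1) * (q + 1) * (1 + 2 * c)" by (simp add: algebra_simps)
  also have "\<dots> \<le> q ^ 4 * (1 + 2 * c)" by (intro mult_le_mono1) fact
  also have "\<dots> < q ^ 4 * q ^ (c - 5)" using 1 assms(1) by (intro mult_strict_left_mono) auto
  also have "\<dots> = q ^ (c - 1)" using assms by (simp add: power_add[symmetric])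
  finally show ?thesis .
qed

text \<open>The powers of \<open>q\<close> on the left combine to exponent \<open>d + n + 5\<close>,
  and the factor \<open>1 + 2 * (n * Suc n)\<close> is below \<open>q ^ (d - 6)\<close>; together
  the exponents make exactly \<open>d + d + n - 1\<close>.\<close>

lemma power_dominates_blocks:
  assumes q: "2 \<le> (q::nat)" and d: "12 + 2 * (n * Suc n) \<le> d"
  shows "q + 1 + 2 * (n * Suc n * q ^ (d + n + 2)) * q ^ 3 < q ^ (d + d + n - 1)"
proof -
  let ?m = "n * Suc n"
  have "1 + 2 * ?m < d - 6" using d by linarith
  also have "\<dots> < q ^ (d - 6)" using less_exp[of "d - 6"] power_mono[of 2 q "d - 6"] q by linarith
  finally have 1: "1 + 2 * ?m < q ^ (d - 6)" .
  have "q + 1 \<le> q ^ 2" unfolding power2_eq_square using q mult_le_mono1[OF q, of q] by linarith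
  also have "\<dots> \<le> q ^ (d + n + 5)" using q by (intro power_increasing) auto
  finally have "q + 1 + 2 * ?m * q ^ (d + n + 5) \<le> (1 + 2 * ?m) * q ^ (d + n + 5)"
    by (simp only: add_mult_distrib mult_1)
  moreover have "2 * (?m * q ^ (d + n + 2)) * q ^ 3 = 2 * ?m * (q ^ (d + n + 2) * q ^ 3)" by (simp only: mult_ac)
  moreover have "q ^ (d + n + 2) * q ^ 3 = q ^ (d + n + 5)" unfolding power_add[symmetric] by (simp add: add.commute)
  ultimately have "q + 1 + 2 * (?m * q ^ (d + n + 2)) * q ^ 3 \<le> (1 + 2 * ?m) * q ^ (d + n + 5)" by presburger
  also have "\<dots> < q ^ (d - 6) * q ^ (d + n + 5)" using 1 q by (intro mult_strict_right_mono) auto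
  also have "\<dots> = q ^ (d + d + n - 1)"
  proof -
    have "d - 6 + (d + n + 5) = d + d + n - 1" using d by linarith
    then show ?thesis unfolding power_add[symmetric] by simp
  qed
  finally show ?thesis .
qed

lemma large_design_exists:
  fixes G :: "('a, 'm) monoid_scheme" and K :: "'r::comm_ring set"
  assumes G: "group G" "finite (carrier G)"
    and K: "finite_scalars K e q" "2 \<le> q" "affine \<Longrightarrow> 4 \<le> q" and d: "12 + 2 * (card (carrier G) * Suc (card (carrier G))) \<le> d"
  shows "\<exists>(P :: ('a \<times> nat \<times> nat \<Rightarrow> 'r) set set) D. d \<le> card P \<and>
    design_2_1 (card P) (if affine then q else q + 1) P D \<and> design_Aut P D \<cong> G"
proof -
  obtain h where h: "bij_betw h {1..card (carrier G)} (carrier G)"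
    using ex_bij_betw_nat_finite_1[OF G(2)] by blast
  interpret E: enumerated_group G h d
    using G h by (simp add: enumerated_group_def enumerated_group_axioms_def)
  interpret C: coordinate_space K e q E.BB affine
    using coordinate_spaceI[OF K(1) E.finite_BB K(2,3)] .
  have k: "C.N 2 \<le> q + 1" and kap: "C.N 3 \<le> q ^ 3" using C.q_bounds by auto
  interpret S: group_space "C.pts C.W" "C.flats 2" "C.N 2" "C.flats 3" "C.N 3" G h d
    "\<lambda>A. C.pts (C.supported A)" q "\<lambda>u. image (C.mv u)"
  proof (unfold_locales)
    show "4 \<le> d" using d by simp
    show "C.N 2 + 2 * C.N 2 * (C.N 2 * c) < q ^ (c - 1)" if "d \<le> c" for c
    proof -
      have "C.N 2 + 2 * C.N 2 * (C.N 2 * c) \<le> q + 1 + 2 * (q + 1) * ((q + 1) * c)"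
        using k by (intro add_le_mono mult_le_mono) auto
      also have "\<dots> < q ^ (c - 1)" using that d K(2) by (intro power_dominates_square) auto
      finally show ?thesis .
    qed
    have "C.N 2 + 2 * (card (carrier G) * Suc (card (carrier G)) * q ^ (d + card (carrier G) + 2)) * C.N 3
      \<le> q + 1 + 2 * (card (carrier G) * Suc (card (carrier G)) * q ^ (d + card (carrier G) + 2)) * q ^ 3"
      using k kap by (intro add_le_mono mult_le_mono2)
    also have "\<dots> < q ^ (d + d + card (carrier G) - 1)" using d K(2) by (intro power_dominates_blocks)
    finally show "C.N 2 + 2 * (card (carrier G) * Suc (card (carrier G)) * q ^ (d + card (carrier G) + 2)) * C.N 3
      < q ^ (d + d + card (carrier G) - 1)" .
  qed
  have "E.BB \<noteq> {}" using E.card_BB d by auto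
  then have "q ^ (card E.BB - 1) \<le> card (C.pts C.W)" using C.Sp_card_ge by blast
  moreover have "d \<le> card E.BB - 1" using E.card_BB d by linarith
  moreover have "card E.BB - 1 < q ^ (card E.BB - 1)"
    using less_exp[of "card E.BB - 1"] power_mono[of 2 q "card E.BB - 1"] K(2) by linarith
  ultimately have "d \<le> card (C.pts C.W)" by linarith
  then show ?thesis unfolding C.N_values(2)[symmetric] using S.D.design S.design_Aut_iso by blast
qed

section \<open>Transport of designs to point sets of natural numbers\<close>

lemma conjugate_design_automorphism:
  assumes i: "bij_betw i P P'" and B: "\<And>b. b \<in> Bs \<Longrightarrow> b \<subseteq> P" and f: "f \<in> design_automorphisms P Bs"
  shows "(\<lambda>x\<in>P'. i (f (inv_into P i x))) \<in> design_automorphisms P' (image i ` Bs)"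
proof -
  let ?g = "\<lambda>x\<in>P'. i (f (inv_into P i x))"
  have fb: "bij_betw f P P" and fB: "\<And>b. b \<in> Bs \<Longrightarrow> f ` b \<in> Bs"
    using f by (auto simp: design_automorphisms_def Bij_def)
  have "bij_betw (i \<circ> (f \<circ> inv_into P i)) P' P'"
    using i fb bij_betw_inv_into[OF i] by (intro bij_betw_trans)
  then have "bij_betw ?g P' P'" by (rule bij_betw_cong[THEN iffD1, rotated]) simp
  moreover have "?g ` (i ` b) \<in> image i ` Bs" if b: "b \<in> Bs" for b
  proof -
    have "?g (i x) = i (f x)" if "x \<in> b" for x
    proof -
      have "x \<in> P" using B[OF b] that by blast
      then show ?thesis using i by (simp add: bij_betw_def bij_betwE[OF i])
    qed
    then have "?g ` (i ` b) = (\<lambda>x. i (f x)) ` b" unfolding image_image by (intro image_cong) auto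
    also have "\<dots> = i ` (f ` b)" by (simp add: image_image)
    finally show ?thesis using fB[OF b] by simp
  qed
  ultimately show ?thesis by (auto simp: design_automorphisms_def Bij_def)
qed

lemma design_transfer:
  assumes D: "design_2_1 v k P Bs" and i: "bij_betw i P P'"
  shows "design_2_1 v k P' (image i ` Bs)" and "design_Aut P' (image i ` Bs) \<cong> design_Aut P Bs"
proof -
  have fin: "finite P" "card P = v" and B: "\<And>b. b \<in> Bs \<Longrightarrow> b \<subseteq> P \<and> card b = k"
    and ex1: "\<And>x y. \<lbrakk>x \<in> P; y \<in> P;
      x \<noteq> y\<rbrakk> \<Longrightarrow> \<exists>!b. b \<in> Bs \<and> x \<in> b \<and> y \<in> b"
    using D by (auto simp: design_2_1_def)
  have inj: "inj_on i P" and im: "i ` P = P'" using i by (auto simp: bij_betw_def)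
  have mem: "i x \<in> i ` b \<longleftrightarrow> x \<in> b" if "x \<in> P" "b \<in> Bs" for x b
    using inj that B by (meson inj_on_image_mem_iff)
  show "design_2_1 v k P' (image i ` Bs)"
    unfolding design_2_1_def
  proof (intro conjI ballI impI)
    show "finite P'" "card P' = v" using fin i by (auto simp: bij_betw_finite bij_betw_same_card)
    show "c \<subseteq> P'" "card c = k" if "c \<in> image i ` Bs" for c
      using that B im inj by (auto simp: card_image inj_on_subset)
    fix x' y' assume xy: "x' \<in> P'" "y' \<in> P'" "x' \<noteq> y'"
    then obtain x y where x: "x \<in> P" "y \<in> P" "x' = i x" "y' = i y" "x \<noteq> y" using im by blast
    obtain b where b: "b \<in> Bs" "x \<in> b" "y \<in> b" "\<And>c. \<lbrakk>c \<in> Bs; x \<in> c; y \<in> c\<rbrakk> \<Longrightarrow> c = b"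
      using ex1[OF x(1,2,5)] by blast
    show "\<exists>!c. c \<in> image i ` Bs \<and> x' \<in> c \<and> y' \<in> c"
    proof (rule ex1I[of _ "i ` b"])
      show "c = i ` b" if c: "c \<in> image i ` Bs \<and> x' \<in> c \<and> y' \<in> c" for c
      proof -
        obtain a where a: "a \<in> Bs" "c = i ` a" using c by blast
        then have "x \<in> a" "y \<in> a" using c x mem by auto
        then show ?thesis using b(4) a by simp
      qed
      show "i ` b \<in> image i ` Bs \<and> x' \<in> i ` b \<and> y' \<in> i ` b"
        unfolding x(3,4) using b(1-3) by (intro conjI imageI)
    qed
  qed
  let ?j = "inv_into P i"
  have j: "bij_betw ?j P' P" using i by (rule bij_betw_inv_into)
  have jB: "image ?j ` image i ` Bs = Bs"
  proof -
    have "?j ` i ` b = b" if "b \<in> Bs" for b using B[OF that] inj by (simp add: inv_into_image_cancel)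
    then show ?thesis by (simp add: image_image)
  qed
  have ji: "inv_into P' ?j x = i x" if "x \<in> P" for x
    using that i j by (intro inv_into_f_eq) (auto simp: bij_betw_def)
  have ij: "?j (i x) = x" if "x \<in> P" for x using inj that by simp
  have ij': "i (?j y) = y" if "y \<in> P'" for y using i that by (simp add: bij_betw_inv_into_right)
  have jm: "?j y \<in> P" if "y \<in> P'" for y using j that by (auto simp: bij_betw_def)
  have im': "i x \<in> P'" if "x \<in> P" for x using im that by auto
  define F where "F g = (\<lambda>x\<in>P. ?j (g (inv_into P' ?j x)))" for g
  define E where "E f = (\<lambda>x\<in>P'. i (f (?j x)))" for f
  have Fm: "F g \<in> design_automorphisms P Bs" if "g \<in> design_automorphisms P' (image i ` Bs)" for g
    using conjugate_design_automorphism[OF j _ that] B im unfolding jB F_def by blast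
  have Em: "E f \<in> design_automorphisms P' (image i ` Bs)" if "f \<in> design_automorphisms P Bs" for f
    using conjugate_design_automorphism[OF i _ that] B unfolding E_def by blast
  have gP: "g y \<in> P'" if "g \<in> design_automorphisms P' (image i ` Bs)" "y \<in> P'" for g y
    using that by (auto simp: design_automorphisms_def Bij_def bij_betw_def)
  have fP: "f y \<in> P" if "f \<in> design_automorphisms P Bs" "y \<in> P" for f y
    using that by (auto simp: design_automorphisms_def Bij_def bij_betw_def)
  have "F \<in> iso (design_Aut P' (image i ` Bs)) (design_Aut P Bs)"
  proof (rule isoI)
    show "F \<in> hom (design_Aut P' (image i ` Bs)) (design_Aut P Bs)"
    proof (rule homI)
      fix g g' assume "g \<in> carrier (design_Aut P' (image i ` Bs))" "g' \<in> carrier (design_Aut P' (image i ` Bs))"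
      then have g: "g \<in> design_automorphisms P' (image i ` Bs)" "g' \<in> design_automorphisms P' (image i ` Bs)"
        by (auto simp: design_Aut_def)
      then have Bij: "g \<in> Bij P'" "g' \<in> Bij P'" "F g \<in> Bij P" "F g' \<in> Bij P"
        using Fm by (auto simp: design_automorphisms_def)
      have "F (compose P' g g') = compose P (F g) (F g')"
        by (rule ext) (auto simp: F_def compose_def ji im' ij' jm gP[OF g(2)])
      then show "F (g \<otimes>\<^bsub>design_Aut P' (image i ` Bs)\<^esub> g') = F g \<otimes>\<^bsub>design_Aut P Bs\<^esub> F g'"
        using Bij by (simp add: design_Aut_def BijGroup_def)
    qed (use Fm in \<open>auto simp: design_Aut_def\<close>)
    show "bij_betw F (carrier (design_Aut P' (image i ` Bs))) (carrier (design_Aut P Bs))"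
    proof (rule bij_betw_byWitness[where f' = E])
      show "\<forall>g\<in>carrier (design_Aut P' (image i ` Bs)). E (F g) = g"
      proof
        fix g assume "g \<in> carrier (design_Aut P' (image i ` Bs))"
        then have g: "g \<in> design_automorphisms P' (image i ` Bs)" by (simp add: design_Aut_def)
        then have "g \<in> extensional P'" by (auto simp: design_automorphisms_def Bij_def)
        then show "E (F g) = g"
          by (intro extensionalityI[of _ P']) (auto simp: E_def F_def ji jm ij' gP[OF g])
      qed
      show "\<forall>f\<in>carrier (design_Aut P Bs). F (E f) = f"
      proof
        fix f assume "f \<in> carrier (design_Aut P Bs)"
        then have f: "f \<in> design_automorphisms P Bs" by (simp add: design_Aut_def)
        then have "f \<in> extensional P" by (auto simp: design_automorphisms_def Bij_def)
        then show "F (E f) = f"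
          by (intro extensionalityI[of _ P]) (auto simp: E_def F_def ji ij im' fP[OF f])
      qed
    qed (use Fm Em in \<open>auto simp: design_Aut_def\<close>)
  qed
  then show "design_Aut P' (image i ` Bs) \<cong> design_Aut P Bs" by (auto simp: is_iso_def)
qed

lemma infinite_design_orders:
  fixes G :: "('a, 'm) monoid_scheme"
  assumes G: "group G" "finite (carrier G)" and q: "primepow q" "affine \<Longrightarrow> 4 \<le> q"
  shows "infinite {v. \<exists>(P :: nat set) Bs. design_2_1 v (if affine then q else q + 1) P Bs \<and> design_Aut P Bs \<cong> G}"
    (is "infinite ?V")
proof -
  obtain p n where p: "Factorial_Ring.prime p" "0 < n" "q = p ^ n" using q(1) by (auto simp: primepow_def)
  have q2: "2 \<le> q" using q(1) primepow_gt_Suc_0 by fastforce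
  obtain K :: "((int list \<times> nat) multiset \<Rightarrow> int) uring set" and e where K: "finite_scalars K e q"
    using finite_scalars_exist[OF p(1,2)] p(3) by blast
  have "\<exists>v\<ge>m. v \<in> ?V" for m
  proof -
    \<comment> \<open>The summand \<open>m\<close> pushes the number of points beyond any given
      bound.\<close>
    define d where "d = m + (12 + 2 * (card (carrier G) * Suc (card (carrier G))))"
    have d: "12 + 2 * (card (carrier G) * Suc (card (carrier G))) \<le> d" "m \<le> d" by (auto simp: d_def)
    obtain P :: "('a \<times> nat \<times> nat \<Rightarrow> ((int list \<times> nat) multiset \<Rightarrow> int) uring) set set" and D
      where P: "d \<le> card P" "design_2_1 (card P) (if affine then q else q + 1) P D" "design_Aut P D \<cong> G"
      using large_design_exists[OF G K q2 q(2) d(1)] by blast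
    have "finite P" using P(2) by (simp add: design_2_1_def)
    then obtain i where i: "bij_betw i P {0..<card P}" using ex_bij_betw_finite_nat by blast
    have "card P \<in> ?V"
      using design_transfer[OF P(2) i] iso_trans[OF _ P(3)] by blast
    then show ?thesis using P(1) d(2) by (meson le_trans)
  qed
  then show ?thesis by (metis (no_types, lifting) finite_nat_set_iff_bounded not_le)
qed

theorem theorem1p1:
  fixes G :: "('a, 'm) monoid_scheme" and q :: nat
  assumes "group G" and "finite (carrier G)" and "primepow q"
  shows "infinite {v. \<exists>(P :: nat set) Bs. design_2_1 v (q + 1) P Bs \<and> design_Aut P Bs \<cong> G}
    \<and> (q > 2 \<longrightarrow>
         infinite {v. \<exists>(P :: nat set) Bs. design_2_1 v q P Bs \<and> design_Aut P Bs \<cong> G})"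
proof (intro conjI impI)
  show "infinite {v. \<exists>(P :: nat set) Bs. design_2_1 v (q + 1) P Bs \<and> design_Aut P Bs \<cong> G}"
    using infinite_design_orders[OF assms, of False] by simp
  assume "q > 2"
  show "infinite {v. \<exists>(P :: nat set) Bs. design_2_1 v q P Bs \<and> design_Aut P Bs \<cong> G}"
  \<comment> \<open>The affine construction starts at \<open>q = 4\<close>; blocks of size 3 are the
    lines of projective spaces over the field with two elements.\<close>
  proof (cases "q = 3")
    case True
    have "primepow (2 :: nat)" by (intro primepow_prime two_is_prime_nat)
    then show ?thesis using infinite_design_orders[OF assms(1,2), of 2 False] True by simp
  next
    case False
    then show ?thesis using infinite_design_orders[OF assms, of True] \<open>q > 2\<close> by simp
  qed
qed

end
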